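(* Let $M\ge2$, let $\sigma_{\mathrm c}^2,\sigma_{\mathrm r}^2>0$, and let $C(\rho)$ be the capacity, under average power $\rho$, of the electro-optic comb phase-noise channel with $M$ subchannels described in the context. Then the multiplexing gain (pre-log) of the channel is $M-1$, that is, $$\lim_{\rho\to\infty}\frac{C(\rho)}{\log\rho}=M-1.$$
   Context: Conventions: $\log$ is base 2; $I$ denotes mutual information (in bits); $j$ is the imaginary unit; $\mathrm{wrap}_\pi(\theta)=((\theta+\pi)\bmod 2\pi)-\pi\in[-\pi,\pi)$ and $\theta\oplus\phi=\mathrm{wrap}_\pi(\theta+\phi)$. $\mathcal{CN}(0,1)$ is the standard circularly symmetric complex Gaussian law; $\mathcal{WN}(0,\sigma^2)$ is the law of $\mathrm{wrap}_\pi(X)$ for $X\sim\mathcal N(0,\sigma^2)$. $\|\cdot\|$ is the Euclidean norm. Channel: for $k=1,2,\dots$ and $m=0,\dots,M-1$, the output is $\mathbf y_{k,m}=e^{j\boldsymbol\theta_{k,m}}\mathbf x_{k,m}+\mathbf w_{k,m}$, where the $\mathbf w_{k,m}$ are i.i.d. $\mathcal{CN}(0,1)$ and $\boldsymbol\theta_{k,m}=\mathrm{wrap}_\pi(\boldsymbol\theta_k^{\mathrm c}+m\boldsymbol\theta_k^{\mathrm r})$. The two processes $(\boldsymbol\theta^{\mathrm c}_k)_{k\ge0}$, $(\boldsymbol\theta^{\mathrm r}_k)_{k\ge0}$ are independent of each other; for each of them, $\boldsymbol\theta_0^{\mathrm{c/r}}$ is uniform on $[-\pi,\pi)$ and $\boldsymbol\theta_k^{\mathrm{c/r}}=\boldsymbol\Delta_k^{\mathrm{c/r}}\oplus\boldsymbol\theta_{k-1}^{\mathrm{c/r}}$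 for $k\ge1$, where the $\boldsymbol\Delta_k^{\mathrm{c/r}}$ are i.i.d. $\mathcal{WN}(0,\sigma_{\mathrm{c/r}}^2)$, independent of $\boldsymbol\theta_0^{\mathrm{c/r}}$. Inputs, phase noises and additive noise are independent. Capacity: with $\underline{\mathbf x}_k=(\mathbf x_{k,0},\dots,\mathbf x_{k,M-1})\in\mathbb C^M$ and similarly $\underline{\mathbf y}_k$, $C(\rho)=\lim_{n\to\infty}\frac1n\sup I(\underline{\mathbf x}_1,\dots,\underline{\mathbf x}_n;\underline{\mathbf y}_1,\dots,\underline{\mathbf y}_n)$, the supremum being over all laws of $(\underline{\mathbf x}_1,\dots,\underline{\mathbf x}_n)$ with $\sum_{k=1}^n\mathbb E[\|\underline{\mathbf x}_k\|^2]\le n\rho$. *)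

theory Defs
  imports "HOL-Probability.Probability" "HOL-Library.Real_Mod"
begin

definition wrap_pi :: "real \<Rightarrow> real" where
  "wrap_pi \<theta> = (\<theta> + pi) rmod (2 * pi) - pi"

definition wrap_add :: "real \<Rightarrow> real \<Rightarrow> real" where
  "wrap_add \<theta> \<phi> = wrap_pi (\<theta> + \<phi>)"

(* The parameter v is the variance, whereas normal_density expects the standard deviation. *)
definition wrapped_normal :: "real \<Rightarrow> real measure" where
  "wrapped_normal v = distr (density lborel (\<lambda>x. ennreal (normal_density 0 (sqrt v) x))) borel wrap_pi"

definition std_complex_normal :: "complex measure" where
  "std_complex_normal = density lborel (\<lambda>z. ennreal (exp (- (cmod z)\<^sup>2) / pi))"

(* Joint law of the independent family (theta_0, Delta_1, Delta_2, ...); coordinate 0 is theta_0. *)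
definition phase_increments :: "real \<Rightarrow> (nat \<Rightarrow> real) measure" where
  "phase_increments v =
     (\<Pi>\<^sub>M k\<in>UNIV. if k = 0 then uniform_measure lborel {-pi..<pi} else wrapped_normal v)"

primrec phase :: "(nat \<Rightarrow> real) \<Rightarrow> nat \<Rightarrow> real" where
  "phase \<delta> 0 = \<delta> 0"
| "phase \<delta> (Suc k) = wrap_add (\<delta> (Suc k)) (phase \<delta> k)"

(* Indices (k, m) of the subchannels used in the first n blocks.  A sequence of n vectors in C^M
   is a function on this set. *)
definition comb_indices :: "nat \<Rightarrow> nat \<Rightarrow> (nat \<times> nat) set" where
  "comb_indices M n = {1..n} \<times> {..<M}"

abbreviation block_space :: "nat \<Rightarrow> nat \<Rightarrow> (nat \<times> nat \<Rightarrow> complex) measure" where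
  "block_space M n \<equiv> (\<Pi>\<^sub>M i\<in>comb_indices M n. borel)"

definition additive_noise :: "nat \<Rightarrow> (nat \<times> nat \<Rightarrow> complex) measure" where
  "additive_noise M = (\<Pi>\<^sub>M i\<in>{1..} \<times> {..<M}. std_complex_normal)"

type_synonym comb_sample =
  "(nat \<times> nat \<Rightarrow> complex) \<times> (nat \<Rightarrow> real) \<times> (nat \<Rightarrow> real) \<times> (nat \<times> nat \<Rightarrow> complex)"

(* Canonical sample space: the input with law P, the phase increments of the two phase processes
   and the additive noise, all independent.  vc and vr are the two innovation variances. *)
definition comb_space ::
  "nat \<Rightarrow> real \<Rightarrow> real \<Rightarrow> (nat \<times> nat \<Rightarrow> complex) measure \<Rightarrow> comb_sample measure" where
  "comb_space M vc vr P =
     P \<Otimes>\<^sub>M (phase_increments vc \<Otimes>\<^sub>M (phase_increments vr \<Otimes>\<^sub>M additive_noise M))"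

definition comb_input :: "comb_sample \<Rightarrow> nat \<times> nat \<Rightarrow> complex" where
  "comb_input = fst"

definition comb_output :: "nat \<Rightarrow> nat \<Rightarrow> comb_sample \<Rightarrow> nat \<times> nat \<Rightarrow> complex" where
  "comb_output M n = (\<lambda>(x, \<delta>c, \<delta>r, w).
     \<lambda>(k, m)\<in>comb_indices M n.
       cis (wrap_pi (phase \<delta>c k + real m * phase \<delta>r k)) * x (k, m) + w (k, m))"

(* The joint law of input and output is always absolutely continuous with respect to the product
   of its marginals, and the mutual information is finite under the power constraint, so the
   real-valued library notion is the usual one. *)
definition comb_information ::
  "nat \<Rightarrow> real \<Rightarrow> real \<Rightarrow> nat \<Rightarrow> (nat \<times> nat \<Rightarrow> complex) measure \<Rightarrow> real" where
  "comb_information M vc vr n P =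
     prob_space.mutual_information (comb_space M vc vr P) 2 (block_space M n) (block_space M n)
       comb_input (comb_output M n)"

definition input_laws :: "nat \<Rightarrow> nat \<Rightarrow> real \<Rightarrow> (nat \<times> nat \<Rightarrow> complex) measure set" where
  "input_laws M n \<rho> =
     {P. prob_space P \<and> sets P = sets (block_space M n) \<and>
         (\<Sum>k = 1..n. \<integral>\<^sup>+ x. ennreal (\<Sum>m<M. (cmod (x (k, m)))\<^sup>2) \<partial>P) \<le> ennreal (real n * \<rho>)}"

(* For fixed n and rho >= 0 the supremum is over a nonempty set that is bounded above. *)
definition comb_capacity :: "nat \<Rightarrow> real \<Rightarrow> real \<Rightarrow> real \<Rightarrow> real" where
  "comb_capacity M vc vr \<rho> =
     lim (\<lambda>n. (SUP P\<in>input_laws M n \<rho>. comb_information M vc vr n P) / real n)"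

end

theory Submission
  imports Defs
begin

text \<open>
  Conditionally on the input \<open>x\<close>, the output has the density \<open>W x y\<close>, a Gaussian density averaged
  over the phases, so the information is the expectation of \<open>ln (W / q)\<close>, \<open>q\<close> being the
  output density.

  Upper bound: given the past, the next phases have bounded densities. Integrating the phases out from
  the last block to the first therefore bounds \<open>W\<close> by a product over the blocks in which each
  of the subchannels \<open>m = 0, 1\<close> contributes a factor of order \<open>1 / (1 + |x|)\<close>, hence loses half of its
  degree of freedom. Comparing with a heavy-tailed product output density and linearising \<open>ln\<close> at \<open>\<rho>\<close>
  yields at most \<open>(M - 1 + M \<epsilon>) ln \<rho> + O(1)\<close> per block.

  Lower bound: for independent inputs to disjoint stretches of blocks, the product of their posterior
  densities is a mismatched posterior for the whole; with the stationarity of the phases this makes the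
  optimal information superadditive. Hence the limit exists and is at least the information of one
  block, for which inputs uniform on a box of area of order \<open>\<rho>\<close> give \<open>q = O(\<rho> powr - M)\<close>, while
  restricting the phase average to a \<open>1 / sqrt \<rho>\<close>-neighbourhood shows that \<open>W\<close> is at least of order \<open>1 / \<rho>\<close>.
\<close>

section \<open>Wrapping modulo a full turn\<close>

text \<open>Subchannels 0 and 1 carry the angles theta^c and theta^c + theta^r. Modulo full turns
  these two determine the angle of every other subchannel, and each of them keeps a diffuse
  innovation of its own. A diffuse angle hides one of the two real dimensions of a complex symbol,
  so exactly two halves of the M complex dimensions are lost.

  The obstacle is the memory of the phases. For the upper bound it is overcome by a bound that is
  uniform in the past: a phase window of width 1 / |x| receives mass of order 1 / |x| from the next
  innovation, wherever the previous phase was. For the lower bound memory can only help, so one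
  block, whose phases are uniform, suffices.

  No output entropy is ever formed. All comparisons are made inside the expectation of ln (W / q) by
  means of ln t <= t - 1, which asks only for finite second moments of input and noise. The
  \<epsilon> is forced by the plane: (1 + |y|^2) powr -1 is not integrable there, so the trial
  density needs an exponent above 1. It is removed only after \<rho> has gone to infinity.\<close>

lemma wrap_pi_eq_shift: "wrap_pi t = t - 2 * pi * of_int \<lfloor>(t + pi) / (2 * pi)\<rfloor>"
  by (simp add: wrap_pi_def rmod_def)

lemma wrap_pi_bounds: "wrap_pi t \<in> {-pi..<pi}"
  using rmod_less[of "2*pi" "t+pi"] rmod_nonneg[of "2*pi" "t+pi"] by (auto simp: wrap_pi_def)

lemma wrap_pi_unique: "s \<in> {-pi..<pi} \<Longrightarrow> t = s + 2 * pi * of_int n \<Longrightarrow> wrap_pi t = s"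
  using rmod_unique[of "s+pi" "2*pi" "t+pi" n] by (auto simp: wrap_pi_def algebra_simps)

lemma wrap_pi_periodic: "wrap_pi (t + 2 * pi * of_int n) = wrap_pi t"
  by (rule wrap_pi_unique[OF wrap_pi_bounds, of _ _ "n + \<lfloor>(t + pi) / (2 * pi)\<rfloor>"])
     (simp add: wrap_pi_eq_shift algebra_simps)

lemma wrap_pi_measurable [measurable]: "wrap_pi \<in> borel_measurable borel"
  unfolding wrap_pi_eq_shift[abs_def] by measurable

lemma wrap_add_measurable [measurable]:
  assumes [measurable]: "f \<in> borel_measurable N" "g \<in> borel_measurable N"
  shows "(\<lambda>x. wrap_add (f x) (g x)) \<in> borel_measurable N"
  unfolding wrap_add_def by measurable

lemma cis_measurable [measurable]: "cis \<in> borel_measurable borel"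
  by (intro borel_measurable_continuous_onI continuous_intros)

text \<open>Angles reach the output only through \<open>cis\<close>, so a wrapping can be undone
  even inside a sum. This is what permits computing with unwrapped sums of phases.\<close>

lemma cis_wrap_pi_add: "cis (wrap_pi t + s) = cis (t + s)"
proof -
  have "wrap_pi t + s = (t + s) - 2 * pi * of_int \<lfloor>(t + pi) / (2 * pi)\<rfloor>"
    by (simp add: wrap_pi_eq_shift)
  then show ?thesis
    by (simp only: cis_divide[symmetric] cis_multiple_2pi) simp
qed

lemma cis_wrap_pi [simp]: "cis (wrap_pi t) = cis t"
  using cis_wrap_pi_add[of t 0] by simp

text \<open>Rotation invariance of the circle. With \<open>d\<close> reduced to \<open>e\<close> in
  [0, 2 pi), wrapping moves {-pi..<pi-e} up by \<open>e\<close> and the remaining piece down by 2 pi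
  - \<open>e\<close>; the two images tile the interval again. It is the source of the stationarity
  of the phases.\<close>

lemma nn_integral_wrap_add_uniform:
  assumes [measurable]: "f \<in> borel_measurable borel"
  shows "(\<integral>\<^sup>+u. f (wrap_add d u) \<partial>uniform_measure lborel {-pi..<pi}) =
    (\<integral>\<^sup>+u. f u \<partial>uniform_measure lborel {-pi..<pi})"
proof -
  define e where "e = d rmod (2 * pi)"
  have e: "0 \<le> e" "e < 2 * pi"
    by (auto simp: e_def rmod_nonneg rmod_less)
  have d: "d = e + 2 * pi * of_int \<lfloor>d / (2 * pi)\<rfloor>"
    by (simp add: e_def rmod_def)
  have wd: "wrap_add d u = wrap_pi (e + u)" for u
  proof -
    have "d + u = e + u + 2 * pi * of_int \<lfloor>d / (2 * pi)\<rfloor>"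
      using d by simp
    then show ?thesis
      using wrap_pi_periodic[of "e+u" "\<lfloor>d / (2 * pi)\<rfloor>"] by (simp only: wrap_add_def)
  qed
  have w1: "wrap_pi (e + u) = e + u" if "u \<in> {-pi..<pi-e}" for u
    using that e by (intro wrap_pi_unique[of _ _ 0]) auto
  have w2: "wrap_pi (e + u) = e + u - 2 * pi" if "u \<in> {pi-e..<pi}" for u
    using that e by (intro wrap_pi_unique[of _ _ 1]) auto
  have "(\<integral>\<^sup>+u. f (wrap_add d u) * indicator {-pi..<pi} u \<partial>lborel) =
      (\<integral>\<^sup>+u. f (e + 1 * u) * indicator {-pi+e..<pi} (e + 1 * u)
          + f (e - 2 * pi + 1 * u) * indicator {-pi..<-pi+e} (e - 2 * pi + 1 * u) \<partial>lborel)"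
    unfolding wd
  proof (intro nn_integral_cong)
    fix u
    consider "u \<in> {-pi..<pi-e}" | "u \<in> {pi-e..<pi}" | "u \<notin> {-pi..<pi}" by force
    then show "f (wrap_pi (e + u)) * indicator {-pi..<pi} u =
        f (e + 1 * u) * indicator {-pi+e..<pi} (e + 1 * u)
          + f (e - 2 * pi + 1 * u) * indicator {-pi..<-pi+e} (e - 2 * pi + 1 * u)"
    proof cases
      case 1 then show ?thesis using e w1[OF 1] by (auto split: split_indicator)
    next
      case 2
      have "e - 2 * pi + 1 * u = e + u - 2 * pi" by simp
      then have feq: "f (e - 2 * pi + 1 * u) = f (e + u - 2 * pi)" by (rule arg_cong)
      show ?thesis unfolding w2[OF 2] feq using 2 e by (auto split: split_indicator)
    next
      case 3 then show ?thesis using e by (auto split: split_indicator)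
    qed
  qed
  also have "\<dots> = (\<integral>\<^sup>+u. f (e + 1 * u) * indicator {-pi+e..<pi} (e + 1 * u) \<partial>lborel)
      + (\<integral>\<^sup>+u. f (e - 2 * pi + 1 * u) * indicator {-pi..<-pi+e} (e - 2 * pi + 1 * u) \<partial>lborel)"
    by (intro nn_integral_add) auto
  also have "\<dots> = (\<integral>\<^sup>+u. f u * indicator {-pi+e..<pi} u \<partial>lborel)
      + (\<integral>\<^sup>+u. f u * indicator {-pi..<-pi+e} u \<partial>lborel)"
    using nn_integral_real_affine[of "\<lambda>u. f u * indicator {-pi+e..<pi} u" 1 e]
      nn_integral_real_affine[of "\<lambda>u. f u * indicator {-pi..<-pi+e} u" 1 "e - 2 * pi"]
    by simp
  also have "\<dots> = (\<integral>\<^sup>+u. f u * indicator {-pi+e..<pi} u + f u * indicator {-pi..<-pi+e} u \<partial>lborel)"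
    by (intro nn_integral_add[symmetric]) auto
  also have "\<dots> = (\<integral>\<^sup>+u. f u * indicator {-pi..<pi} u \<partial>lborel)"
    using e by (intro nn_integral_cong) (auto split: split_indicator)
  finally show ?thesis
    by (simp add: nn_integral_uniform_measure)
qed

section \<open>Gaussian integrals\<close>

definition cgauss :: "complex \<Rightarrow> real" where
  "cgauss z = exp (- (cmod z)\<^sup>2) / pi"

lemma cgauss_measurable [measurable]: "cgauss \<in> borel_measurable borel"
  unfolding cgauss_def[abs_def] by measurable

lemma cgauss_pos: "0 < cgauss z"
  by (simp add: cgauss_def)

lemma cgauss_nonneg [simp]: "0 \<le> cgauss z"
  by (simp add: cgauss_def)

lemma cgauss_le: "cgauss z \<le> 1 / pi"
  by (simp add: cgauss_def divide_right_mono)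

lemma cgauss_le_1: "cgauss z \<le> 1"
  using pi_ge_two by (intro order_trans[OF cgauss_le]) simp

lemma std_complex_normal_eq: "std_complex_normal = density lborel cgauss"
  by (simp add: std_complex_normal_def cgauss_def[abs_def])

lemma nn_integral_complex_prod:
  fixes f g :: "real \<Rightarrow> ennreal"
  assumes [measurable]: "f \<in> borel_measurable borel" "g \<in> borel_measurable borel"
  shows "(\<integral>\<^sup>+z. f (Re z) * g (Im z) \<partial>lborel) = (\<integral>\<^sup>+x. f x \<partial>lborel) * (\<integral>\<^sup>+x. g x \<partial>lborel)"
proof -
  have "(\<integral>\<^sup>+z. (\<Prod>b\<in>Basis. (if b = 1 then f else g) (z \<bullet> b)) \<partial>(lborel :: complex measure)) =
      (\<Prod>b\<in>(Basis :: complex set). (\<integral>\<^sup>+x. (if b = 1 then f else g) x \<partial>lborel))"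
    by (rule nn_integral_lborel_prod) auto
  then show ?thesis
    by (simp add: Basis_complex_def)
qed

lemma nn_integral_exp_neg_square:
  assumes c: "0 < c"
  shows "(\<integral>\<^sup>+x. ennreal (exp (- (c * (x - s)\<^sup>2))) \<partial>lborel) = ennreal (sqrt (pi / c))"
proof -
  define \<sigma> where "\<sigma> = sqrt (1 / (2 * c))"
  have \<sigma>: "\<sigma> > 0" "\<sigma>\<^sup>2 = 1 / (2 * c)"
    using c by (auto simp: \<sigma>_def)
  have eq: "exp (- (c * (x - s)\<^sup>2)) = sqrt (pi / c) * normal_density s \<sigma> x" for x
  proof -
    have "sqrt (pi / c) = sqrt (2 * pi * \<sigma>\<^sup>2)"
      by (simp add: \<sigma>)
    then show ?thesis
      using c \<sigma>(1) by (simp add: normal_density_def) (simp add: \<sigma>(2))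
  qed
  have "(\<integral>\<^sup>+x. ennreal (normal_density s \<sigma> x) \<partial>lborel) = 1"
    using \<sigma> by (subst nn_integral_eq_integral) auto
  then show ?thesis
    using c by (simp add: eq ennreal_mult nn_integral_cmult)
qed

lemma nn_integral_complex_gauss:
  assumes c: "0 < c"
  shows "(\<integral>\<^sup>+z. ennreal (exp (- (c * (cmod z)\<^sup>2))) \<partial>lborel) = ennreal (pi / c)"
proof -
  have "(\<integral>\<^sup>+z. ennreal (exp (- (c * (cmod z)\<^sup>2))) \<partial>lborel) =
      (\<integral>\<^sup>+z. ennreal (exp (- (c * (Re z - 0)\<^sup>2))) * ennreal (exp (- (c * (Im z - 0)\<^sup>2))) \<partial>lborel)"
    by (intro nn_integral_cong)
       (simp add: cmod_power2 ennreal_mult[symmetric] exp_add[symmetric] algebra_simps)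
  also have "\<dots> = ennreal (sqrt (pi / c)) * ennreal (sqrt (pi / c))"
    unfolding nn_integral_exp_neg_square[OF c, of 0, symmetric] by (rule nn_integral_complex_prod) auto
  also have "\<dots> = ennreal (pi / c)"
    using c by (simp add: ennreal_mult[symmetric])
  finally show ?thesis .
qed

lemma nn_integral_cgauss: "(\<integral>\<^sup>+z. ennreal (cgauss z) \<partial>lborel) = 1"
proof -
  have "(\<integral>\<^sup>+z. ennreal (cgauss z) \<partial>lborel) =
      (\<integral>\<^sup>+z. ennreal (1 / pi) * ennreal (exp (- (1 * (cmod z)\<^sup>2))) \<partial>lborel)"
    by (intro nn_integral_cong) (simp add: cgauss_def ennreal_mult[symmetric])
  also have "\<dots> = ennreal (1 / pi) * ennreal (pi / 1)"
    by (subst nn_integral_cmult) (auto simp: nn_integral_complex_gauss[of 1, simplified])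
  finally show ?thesis
    by (simp add: ennreal_mult[symmetric])
qed

lemma nn_integral_lborel_translation:
  fixes a :: "'a::euclidean_space"
  assumes [measurable]: "f \<in> borel_measurable borel"
  shows "(\<integral>\<^sup>+z. f (a + z) \<partial>lborel) = (\<integral>\<^sup>+z. f z \<partial>lborel)"
  by (subst (2) lborel_distr_plus[of a, symmetric]) (simp add: nn_integral_distr)

lemma nn_integral_cgauss_diff: "(\<integral>\<^sup>+z. ennreal (cgauss (z - a)) \<partial>lborel) = 1"
  using nn_integral_lborel_translation[of "\<lambda>z. ennreal (cgauss z)" "- a"] nn_integral_cgauss by simp

text \<open>Here the input is the integration variable, not the output. A rotation preserves
  distances, so the Gaussian can be recentred in \<open>z\<close>. This feeds the second claim of
  \<open>comb_kernel_total\<close>.\<close>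

lemma nn_integral_cgauss_rotated: "(\<integral>\<^sup>+z. ennreal (cgauss (y - cis t * z)) \<partial>lborel) = 1"
proof -
  have "cmod (y - cis t * z) = cmod (z - cis (- t) * y)" for z
  proof -
    have "y - cis t * z = cis t * (cis (- t) * y - z)"
      by (simp add: algebra_simps cis_mult mult.assoc[symmetric])
    then show ?thesis
      by (simp add: norm_mult norm_minus_commute)
  qed
  then have "cgauss (y - cis t * z) = cgauss (z - cis (- t) * y)" for z
    by (simp add: cgauss_def)
  then show ?thesis
    by (simp add: nn_integral_cgauss_diff)
qed

lemma prob_space_std_complex_normal: "prob_space std_complex_normal"
  by (rule prob_spaceI) (simp add: std_complex_normal_eq emeasure_density nn_integral_cgauss)

lemma sets_std_complex_normal [simp, measurable_cong]: "sets std_complex_normal = sets borel"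
  by (simp add: std_complex_normal_eq)

lemma space_std_complex_normal [simp]: "space std_complex_normal = UNIV"
  by (simp add: std_complex_normal_eq)

text \<open>Any finite constant serves. Half of the exponent absorbs the square by t / 2 <= exp (t /
  2); the Gaussian that is left has mass 2 pi, which the prefactor 2 / pi turns into 4.\<close>

lemma second_moment_std_complex_normal:
  "(\<integral>\<^sup>+z. ennreal ((cmod z)\<^sup>2) \<partial>std_complex_normal) \<le> 4"
proof -
  have "(\<integral>\<^sup>+z. ennreal ((cmod z)\<^sup>2) \<partial>std_complex_normal) =
      (\<integral>\<^sup>+z. ennreal (cgauss z) * ennreal ((cmod z)\<^sup>2) \<partial>lborel)"
    unfolding std_complex_normal_eq by (subst nn_integral_density) auto
  also have "\<dots> \<le> (\<integral>\<^sup>+z. ennreal (2 / pi) * ennreal (exp (- (1/2 * (cmod z)\<^sup>2))) \<partial>lborel)"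
  proof (intro nn_integral_mono)
    fix z :: complex
    have "exp ((cmod z)\<^sup>2 / 2) \<ge> (cmod z)\<^sup>2 / 2"
      using exp_ge_add_one_self[of "(cmod z)\<^sup>2 / 2"] by linarith
    moreover have "exp (- (cmod z)\<^sup>2) * exp ((cmod z)\<^sup>2 / 2) = exp (- (1/2 * (cmod z)\<^sup>2))"
      by (simp add: exp_add[symmetric])
    ultimately have "exp (- (cmod z)\<^sup>2) * ((cmod z)\<^sup>2 / 2) \<le> exp (- (1/2 * (cmod z)\<^sup>2))"
      by (metis exp_ge_zero mult_left_mono)
    then have "cgauss z * (cmod z)\<^sup>2 \<le> 2 / pi * exp (- (1/2 * (cmod z)\<^sup>2))"
      by (simp add: cgauss_def field_simps)
    then show "ennreal (cgauss z) * ennreal ((cmod z)\<^sup>2) \<le> ennreal (2 / pi) * ennreal (exp (- (1/2 * (cmod z)\<^sup>2)))"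
      by (simp add: ennreal_mult[symmetric] ennreal_leI)
  qed
  also have "\<dots> = ennreal (2 / pi) * ennreal (pi / (1/2))"
    using nn_integral_complex_gauss[of "1/2"] by (subst nn_integral_cmult) auto
  also have "\<dots> = 4"
    by (simp add: ennreal_mult[symmetric])
  finally show ?thesis .
qed

section \<open>Heavy-tailed densities on the plane\<close>

text \<open>The integrand is at most 1 on [-1, 1] and at most |x| powr (-2p) outside, where 2p >
  1.\<close>

lemma nn_integral_cauchy_power_finite:
  fixes p :: real assumes p: "1/2 < p"
  shows "(\<integral>\<^sup>+x. ennreal ((1 + x\<^sup>2) powr - p) \<partial>lborel) < \<infinity>"
proof -
  let ?F = "\<lambda>x. ennreal (x powr (-2 * p)) * indicator {1..} x"
  have "((\<lambda>x. x powr (-2*p)) has_integral - (1 powr (-2*p+1)) / (-2*p+1)) {1..}"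
    using p by (intro has_integral_powr_to_inf) auto
  then have "((\<lambda>x. if x \<in> {1..} then x powr (-2*p) else 0) has_integral - (1 powr (-2*p+1)) / (-2*p+1)) UNIV"
    by (simp only: has_integral_restrict_UNIV)
  then have "(\<integral>\<^sup>+x. ennreal (if x \<in> {1..} then x powr (-2*p) else 0) \<partial>lborel) = ennreal (- (1 powr (-2*p+1)) / (-2*p+1))"
    by (intro nn_integral_has_integral_lborel) auto
  moreover have "ennreal (if x \<in> {1..} then x powr (-2*p) else 0) = ?F x" for x
    by (auto split: split_indicator)
  ultimately have F: "(\<integral>\<^sup>+x. ?F x \<partial>lborel) < \<infinity>"
    by simp
  have F': "(\<integral>\<^sup>+x. ?F (- x) \<partial>lborel) < \<infinity>"
    using nn_integral_real_affine[of ?F "-1" 0] F by simp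
  have "(\<integral>\<^sup>+x. ennreal ((1 + x\<^sup>2) powr - p) \<partial>lborel) \<le>
      (\<integral>\<^sup>+x. indicator {-1..1} x + (?F x + ?F (- x)) \<partial>lborel)"
  proof (intro nn_integral_mono)
    fix x :: real
    show "ennreal ((1 + x\<^sup>2) powr - p) \<le> indicator {-1..1} x + (?F x + ?F (- x))"
    proof (cases "\<bar>x\<bar> \<le> 1")
      case True
      have "(1 + x\<^sup>2) powr - p \<le> 1"
        using p powr_mono[of "-p" 0 "1 + x\<^sup>2"] by (simp add: add_nonneg_eq_0_iff)
      then show ?thesis using True by (auto intro: order_trans[of _ 1] simp: ennreal_le_1 abs_le_iff)
    next
      case False
      then have "(1 + x\<^sup>2) powr - p \<le> (\<bar>x\<bar>\<^sup>2) powr - p"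
        using p by (intro powr_mono2') auto
      also have "\<dots> = \<bar>x\<bar> powr (-2 * p)"
        using False by (simp add: powr_powr powr_numeral[symmetric] del: powr_numeral power2_abs)
      finally show ?thesis using False by (auto simp: abs_if ennreal_leI split: if_splits)
    qed
  qed
  also have "\<dots> = (\<integral>\<^sup>+x. indicator {-1..1::real} x \<partial>lborel) + ((\<integral>\<^sup>+x. ?F x \<partial>lborel) + (\<integral>\<^sup>+x. ?F (- x) \<partial>lborel))"
    by (subst nn_integral_add; (subst nn_integral_add)?) auto
  also have "\<dots> < \<infinity>"
    using F F' by simp
  finally show ?thesis .
qed

text \<open>The exponent is split into two equal halves \<open>p\<close> > 1/2, and in each factor
  |z|^2 is replaced by the square of one coordinate; the plane integral is then dominated by a
  product of two line integrals. Taking \<open>Z\<close> one above the integral keeps it positive at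
  the price of a mass below 1, which \<open>info_upper_bound\<close> allows.\<close>

lemma complex_cauchy_power_density:
  fixes \<epsilon> :: real assumes "0 < \<epsilon>"
  obtains Z where "0 < Z" "(\<integral>\<^sup>+z. ennreal ((1 + (cmod z)\<^sup>2) powr - (1 + \<epsilon>) / Z) \<partial>lborel) \<le> 1"
proof -
  define p where "p = (1 + \<epsilon>) / 2"
  let ?f = "\<lambda>x::real. ennreal ((1 + x\<^sup>2) powr - p)"
  let ?g = "\<lambda>z::complex. ennreal ((1 + (cmod z)\<^sup>2) powr - (1 + \<epsilon>))"
  have fin: "(\<integral>\<^sup>+x. ?f x \<partial>lborel) < \<infinity>"
    using assms by (intro nn_integral_cauchy_power_finite) (simp add: p_def)
  have "(\<integral>\<^sup>+z. ?g z \<partial>lborel) \<le> (\<integral>\<^sup>+z. ?f (Re z) * ?f (Im z) \<partial>lborel)"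
  proof (intro nn_integral_mono)
    fix z :: complex
    have "(1 + (cmod z)\<^sup>2) powr - (1 + \<epsilon>) = (1 + (cmod z)\<^sup>2) powr - p * (1 + (cmod z)\<^sup>2) powr - p"
    proof -
      have "- (1 + \<epsilon>) = - p + - p" by (simp add: p_def)
      then show ?thesis by (simp only: powr_add)
    qed
    also have "\<dots> \<le> (1 + (Re z)\<^sup>2) powr - p * (1 + (Im z)\<^sup>2) powr - p"
      using assms by (intro mult_mono powr_mono2') (auto simp: p_def cmod_power2 add_pos_nonneg)
    finally show "?g z \<le> ?f (Re z) * ?f (Im z)"
      by (simp add: ennreal_mult[symmetric] ennreal_leI)
  qed
  also have "\<dots> < \<infinity>"
    using fin by (subst nn_integral_complex_prod) (auto simp: ennreal_mult_less_top)
  finally obtain r where r: "0 \<le> r" "(\<integral>\<^sup>+z. ?g z \<partial>lborel) = ennreal r"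
    by (cases "\<integral>\<^sup>+z. ?g z \<partial>lborel") auto
  have "(\<integral>\<^sup>+z. ennreal ((1 + (cmod z)\<^sup>2) powr - (1 + \<epsilon>) / (r + 1)) \<partial>lborel) =
      (\<integral>\<^sup>+z. ?g z * ennreal (1 / (r + 1)) \<partial>lborel)"
    using r by (intro nn_integral_cong) (simp add: ennreal_mult[symmetric])
  also have "\<dots> = ennreal (r / (r + 1))"
    using r by (subst nn_integral_multc) (auto simp: ennreal_mult[symmetric])
  also have "\<dots> \<le> 1"
    using r by (simp add: ennreal_le_1)
  finally show ?thesis using r that[of "r + 1"] by simp
qed

section \<open>Averaging a Gaussian over a diffuse phase\<close>

text \<open>On this range u^2 <= 4, so the cubic Taylor error |u|^3 / 6 takes away at most two
  thirds of |u|.\<close>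

lemma abs_sin_ge_third:
  assumes "\<bar>u\<bar> \<le> pi / 2" shows "\<bar>u\<bar> / 3 \<le> \<bar>sin u\<bar>"
proof -
  have "\<bar>u\<bar> < 2"
    using assms pi_half_less_two by linarith
  then have "u\<^sup>2 \<le> 4"
    using abs_le_square_iff[of u 2] by simp
  then have "\<bar>u\<bar> * u\<^sup>2 \<le> \<bar>u\<bar> * 4"
    by (intro mult_left_mono) auto
  moreover have "\<bar>sin u - u\<bar> \<le> \<bar>u\<bar> * u\<^sup>2 / 6"
    using Maclaurin_sin_bound[of u 3]
    by (simp add: numeral_3_eq_3 sin_coeff_def power2_eq_square abs_mult fact_numeral)
  ultimately show ?thesis by linarith
qed

text \<open>Around the zero k pi of the sine nearest to \<open>t\<close>, the integrand lies below a
  Gaussian in (t - k pi) / 3. Let m pi be the zero nearest to \<open>c\<close>: |t - c| <= pi and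
  two rounding errors of pi / 2 give |k - m| <= 2. So five Gaussians suffice, each of mass 3 sqrt pi
  / a.\<close>

lemma nn_integral_exp_neg_sin_square_period:
  assumes a: "0 < a"
  shows "(\<integral>\<^sup>+t\<in>{c-pi..c+pi}. ennreal (exp (- (a * sin t)\<^sup>2)) \<partial>lborel) \<le> ennreal (15 * sqrt pi / a)"
proof -
  define m where "m = round (c / pi)"
  let ?h = "\<lambda>j t. ennreal (exp (- (a\<^sup>2 / 9 * (t - of_int (m + j) * pi)\<^sup>2)))"
  have near: "\<bar>s - of_int (round (s / pi)) * pi\<bar> \<le> pi / 2" for s
  proof -
    have "\<bar>s / pi - of_int (round (s / pi))\<bar> * pi \<le> 1 / 2 * pi"
      using of_int_round_abs_le[of "s / pi"] by (intro mult_right_mono) (auto simp: abs_minus_commute)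
    then show ?thesis
      by (simp add: abs_mult_pos left_diff_distrib)
  qed
  have "(\<integral>\<^sup>+t\<in>{c-pi..c+pi}. ennreal (exp (- (a * sin t)\<^sup>2)) \<partial>lborel) \<le>
      (\<integral>\<^sup>+t. (\<Sum>j\<in>{-2..2::int}. ?h j t) \<partial>lborel)"
  proof (intro nn_integral_mono)
    fix t
    show "ennreal (exp (- (a * sin t)\<^sup>2)) * indicator {c-pi..c+pi} t \<le> (\<Sum>j\<in>{-2..2::int}. ?h j t)"
    proof (cases "t \<in> {c-pi..c+pi}")
      case True
      define k where "k = round (t / pi)"
      have tk: "\<bar>t - of_int k * pi\<bar> \<le> pi / 2"
        unfolding k_def by (rule near)
      have "\<bar>c - of_int m * pi\<bar> \<le> pi / 2"
        unfolding m_def by (rule near)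
      then have "\<bar>(of_int k - of_int m) * pi\<bar> \<le> 2 * pi"
        using True tk unfolding left_diff_distrib abs_le_iff atLeastAtMost_iff by linarith
      then have "\<bar>of_int (k - m)\<bar> \<le> (2::real)"
        by (simp add: abs_mult)
      then have km: "k - m \<in> {-2..2}"
        by (simp only: of_int_abs[symmetric]) (auto simp: abs_le_iff)
      have "\<bar>sin t\<bar> = \<bar>sin (t - of_int k * pi)\<bar>"
      proof -
        have "sin (t - of_int k * pi) = sin t * cos (of_int k * pi)"
          using sin_times_pi_eq_0[of "of_int k :: real"] by (simp add: sin_diff)
        moreover have "\<bar>cos (of_int k * pi)\<bar> = 1"
        proof -
          have "(cos (of_int k * pi))\<^sup>2 = 1"
            unfolding cos_squared_eq using sin_times_pi_eq_0[of "of_int k :: real"] by simp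
          then show ?thesis by (simp only: abs_square_eq_1)
        qed
        moreover have "sin (of_int k * pi) = 0"
          using sin_times_pi_eq_0[of "of_int k"] by simp
        ultimately show ?thesis by (simp add: abs_mult sin_diff)
      qed
      then have "\<bar>t - of_int k * pi\<bar> / 3 \<le> \<bar>sin t\<bar>"
        using abs_sin_ge_third[OF tk] by simp
      then have "\<bar>(t - of_int k * pi) / 3\<bar> \<le> \<bar>sin t\<bar>"
        by simp
      then have "((t - of_int k * pi) / 3)\<^sup>2 \<le> (sin t)\<^sup>2"
        by (simp only: abs_le_square_iff)
      then have "a\<^sup>2 * ((t - of_int k * pi) / 3)\<^sup>2 \<le> a\<^sup>2 * (sin t)\<^sup>2"
        by (intro mult_left_mono) auto
      then have "ennreal (exp (- (a * sin t)\<^sup>2)) \<le> ?h (k - m) t"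
        by (intro ennreal_leI) (simp add: power_mult_distrib power_divide)
      also have "\<dots> \<le> (\<Sum>j\<in>{-2..2::int}. ?h j t)"
        using km by (intro member_le_sum) auto
      finally show ?thesis using True by simp
    qed simp
  qed
  also have "\<dots> = (\<Sum>j\<in>{-2..2::int}. \<integral>\<^sup>+t. ?h j t \<partial>lborel)"
    by (rule nn_integral_sum) auto
  also have "\<dots> = (\<Sum>j\<in>{-2..2::int}. ennreal (sqrt (pi / (a\<^sup>2 / 9))))"
    using a by (intro sum.cong refl nn_integral_exp_neg_square) auto
  also have "\<dots> = ennreal (5 * sqrt (pi / (a\<^sup>2 / 9)))"
    using a by (simp add: ennreal_mult)
  also have "5 * sqrt (pi / (a\<^sup>2 / 9)) = 15 * sqrt pi / a"
    using a by (simp add: real_sqrt_divide real_sqrt_mult)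
  finally show ?thesis .
qed

text \<open>The normal density at \<open>x\<close> is at most a multiple of the normal density of doubled variance
  at every point within distance \<open>\<pi>\<close> of \<open>x\<close>; averaging over such points reduces an
  integral over the line to integrals over one period.\<close>

lemma normal_expectation_le_period_integral:
  assumes \<sigma>: "0 < \<sigma>"
  obtains K where "0 < K"
    "\<And>h B. h \<in> borel_measurable borel \<Longrightarrow> (\<And>c. (\<integral>\<^sup>+x\<in>{c-pi..c+pi}. h x \<partial>lborel) \<le> B) \<Longrightarrow>
      (\<integral>\<^sup>+x. ennreal (normal_density 0 \<sigma> x) * h x \<partial>lborel) \<le> ennreal K * B"
proof -
  define \<tau> where "\<tau> = sqrt 2 * \<sigma>"
  \<comment> \<open>\<open>K\<close> acts as a bound on the wrapped density: sqrt 2 is the ratio of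
    the two normalisations, 2 pi the length of the averaging window, and the exponential pays for
    u^2 <= 2 x^2 + 2 pi^2, which is (2 x - u)^2 >= 0 together with |u - x| <= pi.\<close>
  define K where "K = sqrt 2 * exp (pi\<^sup>2 / (2 * \<sigma>\<^sup>2)) / (2 * pi)"
  have \<tau>: "0 < \<tau>" "\<tau>\<^sup>2 = 2 * \<sigma>\<^sup>2" and K: "0 < K"
    using \<sigma> by (auto simp: \<tau>_def K_def power_mult_distrib)
  have dens: "normal_density 0 \<sigma> x \<le> 2 * pi * K * normal_density 0 \<tau> u" if "u \<in> {x-pi..x+pi}" for x u
  proof -
    have "(u - x)\<^sup>2 \<le> pi\<^sup>2"
      using that abs_le_square_iff[of "u - x" pi] by auto
    moreover have "2 * x\<^sup>2 + 2 * (u - x)\<^sup>2 - u\<^sup>2 = (2 * x - u)\<^sup>2"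
      by (simp add: power2_eq_square algebra_simps)
    ultimately have "u\<^sup>2 \<le> 2 * x\<^sup>2 + 2 * pi\<^sup>2"
      using zero_le_power2[of "2 * x - u"] by linarith
    then have "- x\<^sup>2 / (2 * \<sigma>\<^sup>2) \<le> pi\<^sup>2 / (2 * \<sigma>\<^sup>2) - u\<^sup>2 / (4 * \<sigma>\<^sup>2)"
      using \<sigma> by (simp add: field_simps)
    then have "exp (- x\<^sup>2 / (2 * \<sigma>\<^sup>2)) \<le> exp (pi\<^sup>2 / (2 * \<sigma>\<^sup>2)) * exp (- (u\<^sup>2 / (4 * \<sigma>\<^sup>2)))"
      by (simp add: exp_add[symmetric])
    then have "1 / sqrt (2 * pi * \<sigma>\<^sup>2) * exp (- x\<^sup>2 / (2 * \<sigma>\<^sup>2)) \<le>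
        1 / sqrt (2 * pi * \<sigma>\<^sup>2) * (exp (pi\<^sup>2 / (2 * \<sigma>\<^sup>2)) * exp (- (u\<^sup>2 / (4 * \<sigma>\<^sup>2))))"
      by (intro mult_left_mono) auto
    also have "\<dots> = 2 * pi * K * normal_density 0 \<tau> u"
    proof -
      have "sqrt 2 * sqrt 2 = (2::real)" by simp
      then show ?thesis
        using \<sigma> by (simp add: normal_density_def \<tau> K_def real_sqrt_mult field_simps)
    qed
    finally show ?thesis
      by (simp add: normal_density_def)
  qed
  show ?thesis
  proof (rule that[OF K])
    fix h :: "real \<Rightarrow> ennreal" and B
    assume h[measurable]: "h \<in> borel_measurable borel"
      and B: "\<And>c. (\<integral>\<^sup>+x\<in>{c-pi..c+pi}. h x \<partial>lborel) \<le> B"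
    have "ennreal (normal_density 0 \<sigma> x) \<le>
        (\<integral>\<^sup>+u. ennreal K * ennreal (normal_density 0 \<tau> u) * indicator {x-pi..x+pi} u \<partial>lborel)" for x
    proof -
      have "ennreal (normal_density 0 \<sigma> x) =
          (\<integral>\<^sup>+u. ennreal (normal_density 0 \<sigma> x / (2 * pi)) * indicator {x-pi..x+pi} u \<partial>lborel)"
        by (simp add: nn_integral_cmult ennreal_mult[symmetric])
      also have "\<dots> \<le> (\<integral>\<^sup>+u. ennreal K * ennreal (normal_density 0 \<tau> u) * indicator {x-pi..x+pi} u \<partial>lborel)"
        using dens[of _ x] K
        by (intro nn_integral_mono)
           (auto split: split_indicator simp: ennreal_mult[symmetric] divide_le_eq mult_ac intro!: ennreal_leI)
      finally show ?thesis .
    qed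
    then have "(\<integral>\<^sup>+x. ennreal (normal_density 0 \<sigma> x) * h x \<partial>lborel) \<le>
        (\<integral>\<^sup>+x. (\<integral>\<^sup>+u. ennreal K * ennreal (normal_density 0 \<tau> u) * indicator {x-pi..x+pi} u \<partial>lborel) * h x \<partial>lborel)"
      by (intro nn_integral_mono mult_right_mono) auto
    \<comment> \<open>Being within distance pi is symmetric in \<open>x\<close> and
      \<open>u\<close>, so after exchanging the integrals the inner one runs over a single period
      centred at \<open>u\<close>.\<close>
    also have "\<dots> = (\<integral>\<^sup>+x. (\<integral>\<^sup>+u. ennreal K * ennreal (normal_density 0 \<tau> u) * (h x * indicator {u-pi..u+pi} x) \<partial>lborel) \<partial>lborel)"
      by (intro nn_integral_cong, subst nn_integral_multc[symmetric])
         (auto split: split_indicator intro!: nn_integral_cong)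
    also have "\<dots> = (\<integral>\<^sup>+u. (\<integral>\<^sup>+x. ennreal K * ennreal (normal_density 0 \<tau> u) * (h x * indicator {u-pi..u+pi} x) \<partial>lborel) \<partial>lborel)"
    proof (rule lborel_pair.Fubini')
      have "indicator {u-pi..u+pi} x = (if u - pi \<le> x \<and> x \<le> u + pi then 1 else 0 :: ennreal)" for u x
        by (auto split: split_indicator)
      then show "(\<lambda>(u, x). ennreal K * ennreal (normal_density 0 \<tau> u) * (h x * indicator {u-pi..u+pi} x))
          \<in> borel_measurable (lborel \<Otimes>\<^sub>M lborel)"
        by simp
    qed
    also have "\<dots> \<le> (\<integral>\<^sup>+u. ennreal K * ennreal (normal_density 0 \<tau> u) * B \<partial>lborel)"
      using B by (intro nn_integral_mono) (simp add: nn_integral_cmult mult_left_mono)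
    also have "\<dots> = ennreal K * B * (\<integral>\<^sup>+u. ennreal (normal_density 0 \<tau> u) \<partial>lborel)"
      by (subst nn_integral_cmult[symmetric]) (auto intro!: nn_integral_cong simp: mult_ac)
    also have "(\<integral>\<^sup>+u. ennreal (normal_density 0 \<tau> u) \<partial>lborel) = 1"
      using \<tau> by (subst nn_integral_eq_integral) auto
    finally show "(\<integral>\<^sup>+x. ennreal (normal_density 0 \<sigma> x) * h x \<partial>lborel) \<le> ennreal K * B"
      by simp
  qed
qed

lemma nn_integral_wrapped_normal:
  assumes [measurable]: "f \<in> borel_measurable borel"
  shows "(\<integral>\<^sup>+\<delta>. f \<delta> \<partial>wrapped_normal v) =
    (\<integral>\<^sup>+x. ennreal (normal_density 0 (sqrt v) x) * f (wrap_pi x) \<partial>lborel)"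
  unfolding wrapped_normal_def
  by (subst nn_integral_distr) (auto simp: nn_integral_density)

lemma sets_wrapped_normal [simp, measurable_cong]: "sets (wrapped_normal v) = sets borel"
  by (simp add: wrapped_normal_def)

lemma space_wrapped_normal [simp]: "space (wrapped_normal v) = UNIV"
  by (simp add: wrapped_normal_def)

lemma prob_space_wrapped_normal:
  assumes "0 < v" shows "prob_space (wrapped_normal v)"
proof -
  interpret prob_space "density lborel (normal_density 0 (sqrt v))"
    using assms by (intro prob_space_normal_density) auto
  show ?thesis
    unfolding wrapped_normal_def by (intro prob_space_distr) auto
qed

text \<open>The form is dictated by \<open>cmod_power2_add_le\<close>, which compares the output
  power with 1 + 2 |x|^2. Its square root makes the gain from a diffuse phase exactly half of the
  logarithm charged by the trial density.\<close>

abbreviation amp :: "complex \<Rightarrow> real" where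
  "amp z \<equiv> sqrt (1 + 2 * (cmod z)\<^sup>2)"

text \<open>An output can be explained only by phases within about 1 / |x| of two opposite
  directions, and a diffuse phase gives these little mass. The bound is uniform in the shift
  \<open>s\<close>, which later stands for everything known about the past. Inputs with |x| <= 1
  resolve no phase, and there the trivial bound on the Gaussian is used.\<close>

lemma phase_averaged_cgauss_le:
  assumes v: "0 < v"
  obtains C where "0 < C"
    "\<And>y x s. (\<integral>\<^sup>+\<delta>. ennreal (cgauss (y - cis (\<delta> + s) * x)) \<partial>wrapped_normal v)
      \<le> ennreal (C / amp x)"
proof -
  obtain K where K: "0 < K" "\<And>h B. h \<in> borel_measurable borel \<Longrightarrow>
      (\<And>c. (\<integral>\<^sup>+x\<in>{c-pi..c+pi}. h x \<partial>lborel) \<le> B) \<Longrightarrow>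
      (\<integral>\<^sup>+x. ennreal (normal_density 0 (sqrt v) x) * h x \<partial>lborel) \<le> ennreal K * B"
    using normal_expectation_le_period_integral[of "sqrt v"] v by auto
  \<comment> \<open>The factor sqrt 3 comes from amp x <= sqrt 3 * max 1 |x|; the maximum covers the
    two cases |x| <= 1 and |x| > 1.\<close>
  define C where "C = sqrt 3 * max (1 / pi) (K * (15 * sqrt pi / pi))"
  interpret prob_space "wrapped_normal v"
    by (rule prob_space_wrapped_normal[OF v])
  have "(\<integral>\<^sup>+\<delta>. ennreal (cgauss (y - cis (\<delta> + s) * x)) \<partial>wrapped_normal v)
      \<le> ennreal (C / amp x)" for y x s
  proof (cases "cmod x \<le> 1")
    case True
    have "(\<integral>\<^sup>+\<delta>. ennreal (cgauss (y - cis (\<delta> + s) * x)) \<partial>wrapped_normal v) \<le>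
        (\<integral>\<^sup>+\<delta>. ennreal (1 / pi) \<partial>wrapped_normal v)"
      by (intro nn_integral_mono ennreal_leI cgauss_le)
    also have "\<dots> = ennreal (1 / pi)"
      by (simp add: emeasure_space_1[simplified])
    also have "1 / pi \<le> C / amp x"
    proof -
      have "(cmod x)\<^sup>2 \<le> 1"
        using True by (simp add: power_le_one)
      then have "amp x \<le> sqrt 3" by simp
      then have "1 / pi * amp x \<le> max (1 / pi) (K * (15 * sqrt pi / pi)) * sqrt 3"
        by (intro mult_mono) (auto simp: le_max_iff_disj)
      moreover have "0 < amp x"
        by (simp add: add_pos_nonneg)
      ultimately show ?thesis
        unfolding C_def by (subst pos_le_divide_eq) (auto simp: mult_ac)
    qed
    finally show ?thesis by (simp add: ennreal_leI)
  next
    case False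
    then have x: "cmod x > 1" by simp
    \<comment> \<open>Rotating by -Arg y makes the output a nonnegative real, so the imaginary part
      of the difference contains the input alone and its size |x| |sin (t + \<open>\<phi>\<close>)|
      bounds the distance from below.\<close>
    define \<phi> where "\<phi> = s + Arg x - Arg y"
    have pw: "cgauss (y - cis (t + s) * x) \<le> 1 / pi * exp (- (cmod x * sin (t + \<phi>))\<^sup>2)" for t
    proof -
      have "y - cis (t + s) * x = cis (Arg y) * (cmod y - cmod x * cis (t + \<phi>))"
      proof -
        have "x = cmod x * cis (Arg x)" "y = cmod y * cis (Arg y)"
          by (simp_all add: rcis_cmod_Arg[unfolded rcis_def])
        then have "y - cis (t + s) * x = cmod y * cis (Arg y) - cis (t + s) * (cmod x * cis (Arg x))"
          by metis
        also have "\<dots> = cis (Arg y) * (cmod y - cmod x * cis (t + \<phi>))"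
          by (simp add: \<phi>_def algebra_simps cis_mult)
        finally show ?thesis .
      qed
      then have "cmod (y - cis (t + s) * x) = cmod (cmod y - cmod x * cis (t + \<phi>))"
        by (simp add: norm_mult)
      also have "\<dots> \<ge> \<bar>cmod x * sin (t + \<phi>)\<bar>"
        using abs_Im_le_cmod[of "cmod y - cmod x * cis (t + \<phi>)"] by simp
      finally have "(cmod x * sin (t + \<phi>))\<^sup>2 \<le> (cmod (y - cis (t + s) * x))\<^sup>2"
        by (metis abs_le_square_iff abs_norm_cancel)
      then show ?thesis
        by (simp add: cgauss_def divide_right_mono)
    qed
    let ?h = "\<lambda>t. ennreal (cgauss (y - cis (t + s) * x))"
    have "(\<integral>\<^sup>+t\<in>{c-pi..c+pi}. ?h t \<partial>lborel) \<le> ennreal (15 * sqrt pi / (pi * cmod x))" for c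
    proof -
      have "(\<integral>\<^sup>+t\<in>{c-pi..c+pi}. ?h t \<partial>lborel) \<le>
          (\<integral>\<^sup>+t. ennreal (1 / pi) * (ennreal (exp (- (cmod x * sin (t + \<phi>))\<^sup>2)) * indicator {c-pi..c+pi} t) \<partial>lborel)"
        using pw by (intro nn_integral_mono)
          (auto split: split_indicator simp: ennreal_mult[symmetric] intro!: ennreal_leI)
      also have "\<dots> = ennreal (1 / pi) *
          (\<integral>\<^sup>+t. (ennreal (exp (- (cmod x * sin (\<phi> + 1 * t))\<^sup>2)) * indicator {(c+\<phi>)-pi..(c+\<phi>)+pi} (\<phi> + 1 * t)) \<partial>lborel)"
        by (subst nn_integral_cmult[symmetric])
           (auto intro!: nn_integral_cong simp: add.commute split: split_indicator)
      also have "\<dots> = ennreal (1 / pi) *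
          (\<integral>\<^sup>+t\<in>{(c+\<phi>)-pi..(c+\<phi>)+pi}. ennreal (exp (- (cmod x * sin t)\<^sup>2)) \<partial>lborel)"
        by (subst nn_integral_real_affine[of _ 1 \<phi>]) auto
      also have "\<dots> \<le> ennreal (1 / pi) * ennreal (15 * sqrt pi / cmod x)"
        using x by (intro mult_left_mono nn_integral_exp_neg_sin_square_period) auto
      also have "\<dots> = ennreal (15 * sqrt pi / (pi * cmod x))"
        by (simp add: ennreal_mult[symmetric])
      finally show ?thesis .
    qed
    then have "(\<integral>\<^sup>+t. ennreal (normal_density 0 (sqrt v) t) * ?h t \<partial>lborel) \<le>
        ennreal K * ennreal (15 * sqrt pi / (pi * cmod x))"
      by (intro K) auto
    then have "(\<integral>\<^sup>+\<delta>. ennreal (cgauss (y - cis (\<delta> + s) * x)) \<partial>wrapped_normal v) \<le>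
        ennreal (K * (15 * sqrt pi / (pi * cmod x)))"
      using K(1) x
      by (simp add: nn_integral_wrapped_normal cis_wrap_pi_add ennreal_mult[symmetric] del: times_divide_eq_right)
    also have "K * (15 * sqrt pi / (pi * cmod x)) \<le> C / amp x"
    proof -
      have "1 < (cmod x)\<^sup>2"
        using x by (simp add: one_less_power)
      then have "amp x \<le> sqrt (3 * (cmod x)\<^sup>2)" by simp
      then have "amp x \<le> sqrt 3 * cmod x" by (simp add: real_sqrt_mult)
      then have "K * (15 * sqrt pi / pi) * amp x \<le>
          max (1 / pi) (K * (15 * sqrt pi / pi)) * (sqrt 3 * cmod x)"
        using K by (intro mult_mono) (auto simp: le_max_iff_disj)
      moreover have "0 < amp x"
        by (simp add: add_pos_nonneg)
      ultimately have "K * (15 * sqrt pi / pi) \<le> C * cmod x / amp x"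
        unfolding C_def by (subst pos_le_divide_eq) (auto simp: mult_ac)
      then have "K * (15 * sqrt pi / pi) / cmod x \<le> C * cmod x / amp x / cmod x"
        by (rule divide_right_mono) simp
      then show ?thesis
        using x by (auto split: if_splits)
    qed
    finally show ?thesis by (simp add: ennreal_leI)
  qed
  moreover have "0 < C"
    by (simp add: C_def less_max_iff_disj)
  ultimately show ?thesis using that by blast
qed

section \<open>Mutual information of a channel given by a density\<close>

lemma (in prob_space) integral_pos_of_pos:
  fixes f :: "'a \<Rightarrow> real"
  assumes "integrable M f" "\<And>x. 0 < f x"
  shows "0 < (\<integral>x. f x \<partial>M)"
proof -
  have "(\<integral>x. f x \<partial>M) \<noteq> 0"
  proof
    assume "(\<integral>x. f x \<partial>M) = 0"
    then have "AE x in M. f x = 0"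
      using assms by (subst (asm) integral_nonneg_eq_0_iff_AE) (auto simp: less_imp_le)
    then have "AE x in M. False"
      using assms(2) by (auto elim!: eventually_mono simp: less_le)
    then show False by simp
  qed
  moreover have "0 \<le> (\<integral>x. f x \<partial>M)"
    using assms by (intro integral_nonneg_AE) (auto simp: less_imp_le)
  ultimately show ?thesis by simp
qed

text \<open>\<open>S\<close> is kept apart from the product space so that bounds may involve
  quantities such as the noise that are not functions of (X, Y). Positivity of \<open>W\<close> at
  every point keeps all quotients and logarithms away from their default values, and the uniform
  bound makes the output density finite at every \<open>y\<close> rather than almost every
  one.\<close>

locale density_channel =
  P: prob_space P + L: sigma_finite_measure L + S: prob_space S
  for P :: "'a measure" and L :: "'b measure" and S :: "'s measure" +
  fixes W :: "'a \<Rightarrow> 'b \<Rightarrow> real" and B :: real and X :: "'s \<Rightarrow> 'a" and Y :: "'s \<Rightarrow> 'b"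
  assumes W_measurable [measurable]: "(\<lambda>(x, y). W x y) \<in> borel_measurable (P \<Otimes>\<^sub>M L)"
    and W_pos: "0 < W x y"
    and W_le: "W x y \<le> B"
    and W_total: "x \<in> space P \<Longrightarrow> (\<integral>\<^sup>+y. ennreal (W x y) \<partial>L) = 1"
    and X_measurable [measurable]: "X \<in> measurable S P"
    and Y_measurable [measurable]: "Y \<in> measurable S L"
    and joint_law: "distr S (P \<Otimes>\<^sub>M L) (\<lambda>s. (X s, Y s)) = density (P \<Otimes>\<^sub>M L) (\<lambda>(x, y). ennreal (W x y))"
begin

sublocale PL: pair_sigma_finite P L ..

definition out :: "'b \<Rightarrow> real" where
  "out y = (\<integral>x. W x y \<partial>P)"

text \<open>The information density, in nats; \<open>mutual_information_eq\<close> converts to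
  bits.\<close>

definition info :: "'s \<Rightarrow> real" where
  "info s = ln (W (X s) (Y s) / out (Y s))"

lemma W_nonneg [simp]: "0 \<le> W x y"
  using W_pos[of x y] by simp

lemma W_section_integrable: "y \<in> space L \<Longrightarrow> integrable P (\<lambda>x. W x y)"
  using W_le by (intro P.integrable_const_bound[where B = B]) auto

lemma ennreal_out: "y \<in> space L \<Longrightarrow> ennreal (out y) = (\<integral>\<^sup>+x. ennreal (W x y) \<partial>P)"
  unfolding out_def by (intro nn_integral_eq_integral[symmetric] W_section_integrable) auto

lemma out_pos: "y \<in> space L \<Longrightarrow> 0 < out y"
  unfolding out_def by (intro P.integral_pos_of_pos W_section_integrable W_pos)

lemma out_measurable [measurable]: "out \<in> borel_measurable L"
  unfolding out_def by measurable

lemma posterior_total: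
  assumes y: "y \<in> space L"
  shows "(\<integral>\<^sup>+x. ennreal (W x y / out y) \<partial>P) = 1"
proof -
  have "(\<integral>\<^sup>+x. ennreal (W x y / out y) \<partial>P) = (\<integral>\<^sup>+x. ennreal (W x y) * ennreal (1 / out y) \<partial>P)"
    using out_pos[OF y] by (intro nn_integral_cong) (simp add: ennreal_mult[symmetric])
  also have "\<dots> = ennreal (out y) * ennreal (1 / out y)"
    using y by (subst nn_integral_multc) (auto simp: ennreal_out[OF y])
  finally show ?thesis
    using out_pos[OF y] by (simp add: ennreal_mult[symmetric])
qed

lemma nn_integral_joint:
  assumes [measurable]: "f \<in> borel_measurable (P \<Otimes>\<^sub>M L)"
  shows "(\<integral>\<^sup>+s. f (X s, Y s) \<partial>S) = (\<integral>\<^sup>+x. \<integral>\<^sup>+y. ennreal (W x y) * f (x, y) \<partial>L \<partial>P)"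
proof -
  have "(\<integral>\<^sup>+s. f (X s, Y s) \<partial>S) = (\<integral>\<^sup>+z. f z \<partial>distr S (P \<Otimes>\<^sub>M L) (\<lambda>s. (X s, Y s)))"
    by (subst nn_integral_distr) auto
  also have "\<dots> = (\<integral>\<^sup>+z. (case z of (x, y) \<Rightarrow> ennreal (W x y)) * f z \<partial>(P \<Otimes>\<^sub>M L))"
    unfolding joint_law by (subst nn_integral_density) auto
  also have "\<dots> = (\<integral>\<^sup>+x. \<integral>\<^sup>+y. ennreal (W x y) * f (x, y) \<partial>L \<partial>P)"
    by (subst L.nn_integral_fst[symmetric]) auto
  finally show ?thesis .
qed

lemma nn_integral_joint':
  assumes [measurable]: "f \<in> borel_measurable (P \<Otimes>\<^sub>M L)"
  shows "(\<integral>\<^sup>+s. f (X s, Y s) \<partial>S) = (\<integral>\<^sup>+y. \<integral>\<^sup>+x. ennreal (W x y) * f (x, y) \<partial>P \<partial>L)"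
  unfolding nn_integral_joint[OF assms]
  by (rule PL.Fubini'[symmetric]) measurable

lemma distr_X: "distr S P X = P"
proof (rule measure_eqI)
  fix A assume "A \<in> sets (distr S P X)"
  then have [measurable]: "A \<in> sets P" by simp
  have "emeasure (distr S P X) A = (\<integral>\<^sup>+s. indicator A (fst (X s, Y s)) \<partial>S)"
    by (simp add: nn_integral_distr[symmetric, of X S P "indicator A"])
  also have "\<dots> = (\<integral>\<^sup>+x. \<integral>\<^sup>+y. ennreal (W x y) * indicator A x \<partial>L \<partial>P)"
    by (subst nn_integral_joint[of "\<lambda>z. indicator A (fst z)"]) auto
  also have "\<dots> = (\<integral>\<^sup>+x. indicator A x \<partial>P)"
    by (intro nn_integral_cong) (simp add: nn_integral_multc W_total)
  finally show "emeasure (distr S P X) A = emeasure P A" by simp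
qed simp

lemma distr_Y: "distr S L Y = density L (\<lambda>y. ennreal (out y))"
proof (rule measure_eqI)
  fix A assume "A \<in> sets (distr S L Y)"
  then have [measurable]: "A \<in> sets L" by simp
  have "emeasure (distr S L Y) A = (\<integral>\<^sup>+s. indicator A (snd (X s, Y s)) \<partial>S)"
    by (simp add: nn_integral_distr[symmetric, of Y S L "indicator A"])
  also have "\<dots> = (\<integral>\<^sup>+y. \<integral>\<^sup>+x. ennreal (W x y) * indicator A y \<partial>P \<partial>L)"
    by (subst nn_integral_joint'[of "\<lambda>z. indicator A (snd z)"]) auto
  also have "\<dots> = (\<integral>\<^sup>+y. ennreal (out y) * indicator A y \<partial>L)"
    by (intro nn_integral_cong) (simp add: nn_integral_multc ennreal_out)
  also have "\<dots> = emeasure (density L (\<lambda>y. ennreal (out y))) A"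
    by (simp add: emeasure_density)
  finally show "emeasure (distr S L Y) A = emeasure (density L (\<lambda>y. ennreal (out y))) A" .
qed simp

text \<open>Identifies W / out as the Radon-Nikodym derivative of the joint law with respect to the
  product of its marginals, which is the form in which the KL divergence can be evaluated.\<close>

lemma joint_law_relative:
  "distr S (P \<Otimes>\<^sub>M L) (\<lambda>s. (X s, Y s)) =
    density (P \<Otimes>\<^sub>M density L (\<lambda>y. ennreal (out y))) (\<lambda>(x, y). ennreal (W x y / out y))"
proof -
  interpret Q: prob_space "density L (\<lambda>y. ennreal (out y))"
    unfolding distr_Y[symmetric] by (rule S.prob_space_distr) measurable
  have "P \<Otimes>\<^sub>M density L (\<lambda>y. ennreal (out y)) = density (P \<Otimes>\<^sub>M L) (\<lambda>(x, y). ennreal (out y))"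
    using pair_measure_density[of "\<lambda>_. 1" P "\<lambda>y. ennreal (out y)" L] Q.sigma_finite_measure_axioms
      L.sigma_finite_measure_axioms
    by (simp add: density_1)
  then have "density (P \<Otimes>\<^sub>M density L (\<lambda>y. ennreal (out y))) (\<lambda>(x, y). ennreal (W x y / out y)) =
      density (P \<Otimes>\<^sub>M L) (\<lambda>z. (case z of (x, y) \<Rightarrow> ennreal (out y)) * (case z of (x, y) \<Rightarrow> ennreal (W x y / out y)))"
    by (simp add: density_density_eq)
  also have "\<dots> = density (P \<Otimes>\<^sub>M L) (\<lambda>(x, y). ennreal (W x y))"
  proof (intro density_cong AE_I2)
    fix z assume "z \<in> space (P \<Otimes>\<^sub>M L)"
    then have "0 < out (snd z)"
      by (auto simp: space_pair_measure intro: out_pos)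
    then show "(case z of (x, y) \<Rightarrow> ennreal (out y)) * (case z of (x, y) \<Rightarrow> ennreal (W x y / out y)) =
        (case z of (x, y) \<Rightarrow> ennreal (W x y))"
      by (simp add: split_beta' ennreal_mult[symmetric])
  qed measurable
  finally show ?thesis
    by (simp add: joint_law)
qed

text \<open>\<open>SX\<close> and \<open>SY\<close> are left free because the capacity refers to the
  Borel product spaces, whereas the channel uses the input law and Lebesgue measure, which merely
  have the same measurable sets.\<close>

lemma mutual_information_eq:
  assumes "sets SX = sets P" "sets SY = sets L"
  shows "S.mutual_information 2 SX SY X Y = (\<integral>s. info s \<partial>S) / ln 2"
proof -
  let ?Q = "density L (\<lambda>y. ennreal (out y))"
  interpret Q: prob_space ?Q
    unfolding distr_Y[symmetric] by (rule S.prob_space_distr) measurable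
  interpret PQ: pair_prob_space P ?Q ..
  have "S.mutual_information 2 SX SY X Y =
      KL_divergence 2 (distr S P X \<Otimes>\<^sub>M distr S L Y) (distr S (P \<Otimes>\<^sub>M L) (\<lambda>s. (X s, Y s)))"
    unfolding S.mutual_information_def
    by (intro arg_cong2[where f = "KL_divergence 2"] arg_cong2[where f = pair_measure] distr_cong
          sets_pair_measure_cong assms refl)
  also have "\<dots> = KL_divergence 2 (P \<Otimes>\<^sub>M ?Q) (density (P \<Otimes>\<^sub>M ?Q) (\<lambda>z. ennreal (W (fst z) (snd z) / out (snd z))))"
    unfolding distr_X distr_Y joint_law_relative by (simp add: split_beta')
  also have "\<dots> = (\<integral>z. W (fst z) (snd z) / out (snd z) * log 2 (W (fst z) (snd z) / out (snd z)) \<partial>(P \<Otimes>\<^sub>M ?Q))"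
    by (intro PQ.KL_density)
       (auto simp: space_pair_measure intro!: divide_nonneg_nonneg AE_I2 less_imp_le[OF out_pos])
  also have "\<dots> = (\<integral>z. log 2 (W (fst z) (snd z) / out (snd z)) \<partial>distr S (P \<Otimes>\<^sub>M L) (\<lambda>s. (X s, Y s)))"
    unfolding joint_law_relative split_beta'
    by (subst integral_density)
       (auto simp: space_pair_measure intro!: divide_nonneg_nonneg AE_I2 less_imp_le[OF out_pos])
  also have "\<dots> = (\<integral>s. log 2 (W (X s) (Y s) / out (Y s)) \<partial>S)"
    by (subst integral_distr) auto
  also have "\<dots> = (\<integral>s. info s / ln 2 \<partial>S)"
    by (simp add: info_def log_def)
  finally show ?thesis by simp
qed

lemma info_measurable [measurable]: "info \<in> borel_measurable S"
  unfolding info_def by measurable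

lemma out_Y_pos: "s \<in> space S \<Longrightarrow> 0 < out (Y s)"
  using measurable_space[OF Y_measurable] by (rule out_pos)

text \<open>Both bounds use only \<open>ln t \<le> t - 1\<close>: the information is at least
  \<open>1 - out / W\<close>, and at most \<open>U + r / out - 1\<close>, where \<open>r\<close> is a trial output density.\<close>

lemma info_upper_bound:
  assumes r[measurable]: "r \<in> borel_measurable L" and r_pos: "\<And>y. y \<in> space L \<Longrightarrow> 0 < r y"
    and r_total: "(\<integral>\<^sup>+y. ennreal (r y) \<partial>L) \<le> 1"
    and U: "integrable S U"
    and le: "\<And>s. s \<in> space S \<Longrightarrow> W (X s) (Y s) \<le> r (Y s) * exp (U s)"
  shows "integrable S info" "(\<integral>s. info s \<partial>S) \<le> (\<integral>s. U s \<partial>S)"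
proof -
  have "(\<integral>\<^sup>+s. ennreal (r (Y s) / out (Y s)) \<partial>S) = (\<integral>\<^sup>+y. \<integral>\<^sup>+x. ennreal (W x y) * ennreal (r y / out y) \<partial>P \<partial>L)"
    using nn_integral_joint'[of "\<lambda>z. ennreal (r (snd z) / out (snd z))"] by simp
  also have "\<dots> = (\<integral>\<^sup>+y. ennreal (r y) \<partial>L)"
  proof (intro nn_integral_cong)
    fix y assume y: "y \<in> space L"
    then show "(\<integral>\<^sup>+x. ennreal (W x y) * ennreal (r y / out y) \<partial>P) = ennreal (r y)"
      using out_pos[OF y] r_pos[OF y]
      by (subst nn_integral_multc) (auto simp: ennreal_out[symmetric] ennreal_mult[symmetric])
  qed
  finally have ru: "(\<integral>\<^sup>+s. ennreal (r (Y s) / out (Y s)) \<partial>S) \<le> 1"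
    using r_total by simp
  have nn: "AE s in S. 0 \<le> r (Y s) / out (Y s)"
    by (intro AE_I2 divide_nonneg_nonneg less_imp_le out_Y_pos r_pos measurable_space[OF Y_measurable])
  have int_r: "integrable S (\<lambda>s. r (Y s) / out (Y s))"
    using ru nn by (intro integrableI_nonneg) (auto intro: le_less_trans)
  have E_r: "(\<integral>s. r (Y s) / out (Y s) \<partial>S) \<le> 1"
    using ru nn_integral_eq_integral[OF int_r nn] by simp

  \<comment> \<open>Under the joint law the factor \<open>W\<close> cancels, so this expectation is
    the total output mass. It controls \<open>info\<close> from below; without it only the positive
    part would be known to be integrable.\<close>
  have "(\<integral>\<^sup>+s. ennreal (out (Y s) / W (X s) (Y s)) \<partial>S) =
      (\<integral>\<^sup>+y. \<integral>\<^sup>+x. ennreal (W x y) * ennreal (out y / W x y) \<partial>P \<partial>L)"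
    using nn_integral_joint'[of "\<lambda>z. ennreal (out (snd z) / W (fst z) (snd z))"] by simp
  also have "\<dots> = (\<integral>\<^sup>+y. \<integral>\<^sup>+x. ennreal (out y) \<partial>P \<partial>L)"
    using out_pos W_pos
    by (intro nn_integral_cong) (simp add: ennreal_mult[symmetric] less_imp_le less_imp_neq[THEN not_sym])
  also have "\<dots> = emeasure (distr S L Y) (space L)"
    by (simp add: distr_Y emeasure_density P.emeasure_space_1 cong: nn_integral_cong)
  also have "\<dots> < \<infinity>"
    by (simp add: emeasure_distr less_top[symmetric] S.emeasure_finite)
  finally have int_o: "integrable S (\<lambda>s. out (Y s) / W (X s) (Y s))"
    by (intro integrableI_nonneg AE_I2 divide_nonneg_nonneg W_nonneg less_imp_le[OF out_Y_pos]) auto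

  have upper: "info s \<le> U s + r (Y s) / out (Y s) - 1" if s: "s \<in> space S" for s
  proof -
    note pos = W_pos[of "X s" "Y s"] out_Y_pos[OF s] r_pos[OF measurable_space[OF Y_measurable s]]
    have "W (X s) (Y s) / out (Y s) \<le> exp (U s) * (r (Y s) / out (Y s))"
      using le[OF s] pos by (simp add: divide_right_mono mult.commute)
    then have "info s \<le> ln (exp (U s) * (r (Y s) / out (Y s)))"
      unfolding info_def using pos by (subst ln_le_cancel_iff) auto
    also have "\<dots> = U s + ln (r (Y s) / out (Y s))"
      using pos by (subst ln_mult) auto
    also have "\<dots> \<le> U s + (r (Y s) / out (Y s) - 1)"
      using pos by (intro add_left_mono ln_le_minus_one) auto
    finally show ?thesis by simp
  qed
  have lower: "1 - out (Y s) / W (X s) (Y s) \<le> info s" if s: "s \<in> space S" for s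
  proof -
    note pos = W_pos[of "X s" "Y s"] out_Y_pos[OF s]
    have "ln (out (Y s) / W (X s) (Y s)) \<le> out (Y s) / W (X s) (Y s) - 1"
      using pos by (intro ln_le_minus_one) auto
    moreover have "info s = - ln (out (Y s) / W (X s) (Y s))"
      unfolding info_def using pos by (simp add: ln_div)
    ultimately show ?thesis by simp
  qed
  let ?b = "\<lambda>s. \<bar>U s + r (Y s) / out (Y s) - 1\<bar> + \<bar>1 - out (Y s) / W (X s) (Y s)\<bar>"
  show int: "integrable S info"
  proof (rule Bochner_Integration.integrable_bound[of _ ?b])
    show "integrable S ?b"
      using U int_r int_o by simp
    show "AE s in S. norm (info s) \<le> norm (?b s)"
    proof (rule AE_I2)
      fix s assume "s \<in> space S"
      from upper[OF this] lower[OF this] show "norm (info s) \<le> norm (?b s)"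
        by simp
    qed
  qed measurable
  have "(\<integral>s. info s \<partial>S) \<le> (\<integral>s. U s + r (Y s) / out (Y s) - 1 \<partial>S)"
    using U int_r int upper by (intro integral_mono) auto
  also have "\<dots> = (\<integral>s. U s \<partial>S) + (\<integral>s. r (Y s) / out (Y s) \<partial>S) - 1"
    using U int_r by (simp add: S.prob_space)
  finally show "(\<integral>s. info s \<partial>S) \<le> (\<integral>s. U s \<partial>S)"
    using E_r by simp
qed

text \<open>Replacing the true posterior density \<open>W x y / out y\<close> by any other conditional density
  \<open>V\<close> of the input given the output lowers the expected logarithm.\<close>

lemma mismatched_le_info:
  assumes V[measurable]: "(\<lambda>(x, y). V x y) \<in> borel_measurable (P \<Otimes>\<^sub>M L)"
    and V_pos: "\<And>x y. x \<in> space P \<Longrightarrow> y \<in> space L \<Longrightarrow> 0 < V x y"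
    and V_total: "\<And>y. y \<in> space L \<Longrightarrow> (\<integral>\<^sup>+x. ennreal (V x y) \<partial>P) \<le> 1"
    and int_V: "integrable S (\<lambda>s. ln (V (X s) (Y s)))"
    and int: "integrable S info"
  shows "(\<integral>s. ln (V (X s) (Y s)) \<partial>S) \<le> (\<integral>s. info s \<partial>S)"
proof -
  \<comment> \<open>The ratio of \<open>V\<close> to the true posterior W / out. Its mean is at most
    1 since \<open>V\<close> has mass at most 1 for each output, and ln R <= R - 1 then compares the
    two expected logarithms.\<close>
  let ?R = "\<lambda>s. V (X s) (Y s) * out (Y s) / W (X s) (Y s)"
  have sp: "X s \<in> space P" "Y s \<in> space L" if "s \<in> space S" for s
    using that measurable_space[OF X_measurable] measurable_space[OF Y_measurable] by auto
  have "(\<integral>\<^sup>+s. ennreal (?R s) \<partial>S) =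
      (\<integral>\<^sup>+y. \<integral>\<^sup>+x. ennreal (W x y) * ennreal (V x y * out y / W x y) \<partial>P \<partial>L)"
    using nn_integral_joint'[of "\<lambda>z. ennreal (V (fst z) (snd z) * out (snd z) / W (fst z) (snd z))"] V by simp
  also have "\<dots> = (\<integral>\<^sup>+y. \<integral>\<^sup>+x. ennreal (V x y) * ennreal (out y) \<partial>P \<partial>L)"
    using out_pos W_pos V_pos
    by (intro nn_integral_cong) (simp add: ennreal_mult[symmetric] less_imp_le less_imp_neq[THEN not_sym])
  also have "\<dots> \<le> (\<integral>\<^sup>+y. ennreal (out y) \<partial>L)"
  proof (intro nn_integral_mono)
    fix y assume y: "y \<in> space L"
    have "(\<integral>\<^sup>+x. ennreal (V x y) * ennreal (out y) \<partial>P) = (\<integral>\<^sup>+x. ennreal (V x y) \<partial>P) * ennreal (out y)"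
      using V y by (intro nn_integral_multc) auto
    also have "\<dots> \<le> 1 * ennreal (out y)"
      by (intro mult_right_mono V_total y) auto
    finally show "(\<integral>\<^sup>+x. ennreal (V x y) * ennreal (out y) \<partial>P) \<le> ennreal (out y)" by simp
  qed
  also have "\<dots> = emeasure (distr S L Y) (space L)"
    by (simp add: distr_Y emeasure_density cong: nn_integral_cong)
  also have "\<dots> = 1"
    using S.prob_space_distr[OF Y_measurable] by (simp add: prob_space.emeasure_space_1[of "distr S L Y", simplified])
  finally have R: "(\<integral>\<^sup>+s. ennreal (?R s) \<partial>S) \<le> 1" .
  have nn: "AE s in S. 0 \<le> ?R s"
    using sp V_pos out_pos W_pos by (intro AE_I2 divide_nonneg_nonneg mult_nonneg_nonneg less_imp_le) auto
  have int_R: "integrable S ?R"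
    using R nn V by (intro integrableI_nonneg) (auto intro: le_less_trans)
  have E_R: "(\<integral>s. ?R s \<partial>S) \<le> 1"
    using R nn_integral_eq_integral[OF int_R nn] by simp
  have "(\<integral>s. ln (V (X s) (Y s)) \<partial>S) \<le> (\<integral>s. info s + (?R s - 1) \<partial>S)"
  proof (intro integral_mono)
    fix s assume s: "s \<in> space S"
    note pos = W_pos[of "X s" "Y s"] out_pos[OF sp(2)[OF s]] V_pos[OF sp[OF s]]
    have "ln (?R s) \<le> ?R s - 1"
      using pos by (intro ln_le_minus_one) auto
    moreover have "ln (?R s) = ln (V (X s) (Y s)) - info s"
      unfolding info_def using pos by (simp add: ln_div ln_mult)
    ultimately show "ln (V (X s) (Y s)) \<le> info s + (?R s - 1)" by simp
  qed (use int_V int int_R in auto)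
  also have "\<dots> = (\<integral>s. info s \<partial>S) + ((\<integral>s. ?R s \<partial>S) - 1)"
    using int int_R by (simp add: S.prob_space)
  finally show ?thesis using E_R by simp
qed

end

section \<open>The phase process\<close>

definition increment_law :: "real \<Rightarrow> nat \<Rightarrow> real measure" where
  "increment_law v k = (if k = 0 then uniform_measure lborel {-pi..<pi} else wrapped_normal v)"

lemma phase_increments_eq: "phase_increments v = PiM UNIV (increment_law v)"
  by (simp add: phase_increments_def increment_law_def[abs_def])

lemma sets_increment_law [simp, measurable_cong]: "sets (increment_law v k) = sets borel"
  by (simp add: increment_law_def)

lemma space_increment_law [simp]: "space (increment_law v k) = UNIV"
  by (simp add: increment_law_def)

lemma prob_space_uniform_phase: "prob_space (uniform_measure lborel {-pi..<pi::real})"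
  by (rule prob_space_uniform_measure) auto

lemma prob_space_increment_law: "0 < v \<Longrightarrow> prob_space (increment_law v k)"
  by (simp add: increment_law_def prob_space_wrapped_normal prob_space_uniform_phase)

lemma sets_phase_increments [measurable_cong]: "sets (phase_increments v) = sets (PiM UNIV (\<lambda>_. borel))"
  unfolding phase_increments_eq by (rule sets_PiM_cong) auto

lemma space_phase_increments [simp]: "space (phase_increments v) = UNIV"
  using sets_eq_imp_space_eq[OF sets_phase_increments] by (simp add: space_PiM)

lemma prob_space_phase_increments: "0 < v \<Longrightarrow> prob_space (phase_increments v)"
  unfolding phase_increments_eq by (intro prob_space_PiM prob_space_increment_law)

lemma phase_measurable_PiM:
  assumes "{..k} \<subseteq> J"
  shows "(\<lambda>\<delta>. phase \<delta> k) \<in> borel_measurable (PiM J (\<lambda>_. borel))"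
  using assms
proof (induction k)
  case 0
  then show ?case by (simp add: measurable_component_singleton)
next
  case (Suc k)
  have "{..k} \<subseteq> J" "Suc k \<in> J"
    using Suc.prems by auto
  then have [measurable]: "(\<lambda>\<delta>. phase \<delta> k) \<in> borel_measurable (PiM J (\<lambda>_. borel))"
    "(\<lambda>\<delta>. \<delta> (Suc k)) \<in> borel_measurable (PiM J (\<lambda>_. borel))"
    using Suc.IH by (auto intro!: measurable_component_singleton)
  show ?case by simp
qed

lemma phase_measurable [measurable]: "(\<lambda>\<delta>. phase \<delta> k) \<in> borel_measurable (PiM UNIV (\<lambda>_. borel))"
  by (rule phase_measurable_PiM) simp

lemma phase_cong: "(\<And>i. i \<le> k \<Longrightarrow> \<delta> i = \<delta>' i) \<Longrightarrow> phase \<delta> k = phase \<delta>' k"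
  by (induction k) auto

text \<open>Transfers to a finite product, where coordinates can be integrated one at a time. The
  hypothesis \<open>restrict\<close> says that \<open>f\<close> looks only at the coordinates in
  \<open>J\<close>.\<close>

lemma nn_integral_phase_increments_finite:
  assumes v: "0 < v" and J: "finite J"
    and f: "f \<in> borel_measurable (PiM J (\<lambda>_. borel))"
    and restrict: "\<And>\<delta>. f (restrict \<delta> J) = f \<delta>"
  shows "(\<integral>\<^sup>+\<delta>. f \<delta> \<partial>phase_increments v) = (\<integral>\<^sup>+\<delta>. f \<delta> \<partial>PiM J (increment_law v))"
proof -
  interpret product_prob_space "increment_law v" UNIV
    using prob_space_increment_law[OF v]
    by (intro product_prob_spaceI)
  have "(\<integral>\<^sup>+\<delta>. f \<delta> \<partial>PiM J (increment_law v)) =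
      (\<integral>\<^sup>+\<delta>. f \<delta> \<partial>distr (PiM UNIV (increment_law v)) (PiM J (increment_law v)) (\<lambda>x. restrict x J))"
    using distr_PiM_restrict_finite[OF J] by simp
  also have "\<dots> = (\<integral>\<^sup>+\<delta>. f (restrict \<delta> J) \<partial>PiM UNIV (increment_law v))"
  proof (rule nn_integral_distr)
    have "f \<in> borel_measurable (PiM J (increment_law v))"
      using f by (simp cong: measurable_cong_sets sets_PiM_cong)
    then show "f \<in> borel_measurable (distr (PiM UNIV (increment_law v)) (PiM J (increment_law v)) (\<lambda>x. restrict x J))"
      by simp
  qed (auto intro!: measurable_restrict_subset)
  finally show ?thesis
    unfolding phase_increments_eq restrict by simp
qed

text \<open>Only the last factor involves the newest increment. Since \<open>A k\<close> is uniform
  in the preceding phase \<open>s\<close>, integrating that increment out leaves the product for the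
  earlier blocks and no trace of the memory; induction does the rest.\<close>

lemma nn_integral_prod_phase_le:
  assumes v: "0 < v"
    and h: "\<And>k. k \<in> {1..n} \<Longrightarrow> h k \<in> borel_measurable borel"
    and A: "\<And>k s. k \<in> {1..n} \<Longrightarrow> (\<integral>\<^sup>+\<delta>. h k (wrap_add \<delta> s) \<partial>wrapped_normal v) \<le> A k"
  shows "(\<integral>\<^sup>+\<delta>. (\<Prod>k = 1..n. h k (phase \<delta> k)) \<partial>phase_increments v) \<le> (\<Prod>k = 1..n. A k :: ennreal)"
proof -
  let ?H = "\<lambda>m \<delta>. \<Prod>k = 1..m. h k (phase \<delta> k)" and ?Q = "\<lambda>m. PiM {..m} (increment_law v)"
  interpret product_sigma_finite "increment_law v"
    using prob_space_increment_law[OF v]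
    by (auto simp: product_sigma_finite_def intro!: prob_space_imp_sigma_finite)
  have meas: "(\<lambda>\<delta>. \<Prod>k = 1..m. h k (phase \<delta> k)) \<in> borel_measurable (PiM {..m} (\<lambda>_. borel))" if "m \<le> n" for m
  proof (intro borel_measurable_prod_ennreal)
    fix k assume k: "k \<in> {1..m}"
    then have [measurable]: "h k \<in> borel_measurable borel" using h that by auto
    have [measurable]: "(\<lambda>\<delta>. phase \<delta> k) \<in> borel_measurable (PiM {..m} (\<lambda>_. borel))"
      using k by (intro phase_measurable_PiM) auto
    show "(\<lambda>\<delta>. h k (phase \<delta> k)) \<in> borel_measurable (PiM {..m} (\<lambda>_. borel))"
      by measurable
  qed
  have "(\<integral>\<^sup>+\<delta>. ?H m \<delta> \<partial>?Q m) \<le> (\<Prod>k = 1..m. A k)" if "m \<le> n" for m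
    using that
  proof (induction m)
    case 0
    interpret P: prob_space "PiM {..0} (increment_law v)"
      by (intro prob_space_PiM prob_space_increment_law v)
    show ?case using P.emeasure_space_1 by simp
  next
    case (Suc m)
    have ins: "{..Suc m} = insert (Suc m) {..m}" by auto
    have phm: "phase (\<delta>(Suc m := t)) k = phase \<delta> k" if "k \<le> m" for \<delta> t k
      using that by (intro phase_cong) auto
    have [measurable]: "h (Suc m) \<in> borel_measurable borel"
      using h Suc.prems by auto
    have "(\<integral>\<^sup>+\<delta>. ?H (Suc m) \<delta> \<partial>?Q (Suc m)) =
        (\<integral>\<^sup>+\<delta>. \<integral>\<^sup>+t. (\<Prod>k = 1..Suc m. h k (phase (\<delta>(Suc m := t)) k)) \<partial>increment_law v (Suc m) \<partial>?Q m)"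
      unfolding ins
    proof (rule product_nn_integral_insert)
      show "(\<lambda>\<delta>. \<Prod>k = 1..Suc m. h k (phase \<delta> k)) \<in> borel_measurable (PiM (insert (Suc m) {..m}) (increment_law v))"
        using meas[OF Suc.prems] unfolding ins by (simp cong: measurable_cong_sets sets_PiM_cong)
    qed auto
    also have "\<dots> = (\<integral>\<^sup>+\<delta>. \<integral>\<^sup>+t. ?H m \<delta> * h (Suc m) (wrap_add t (phase \<delta> m)) \<partial>wrapped_normal v \<partial>?Q m)"
      by (intro nn_integral_cong) (simp add: phm increment_law_def)
    also have "\<dots> \<le> (\<integral>\<^sup>+\<delta>. ?H m \<delta> * A (Suc m) \<partial>?Q m)"
    proof (intro nn_integral_mono)
      fix \<delta>
      have "(\<integral>\<^sup>+t. ?H m \<delta> * h (Suc m) (wrap_add t (phase \<delta> m)) \<partial>wrapped_normal v) =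
          ?H m \<delta> * (\<integral>\<^sup>+t. h (Suc m) (wrap_add t (phase \<delta> m)) \<partial>wrapped_normal v)"
        by (intro nn_integral_cmult) measurable
      also have "\<dots> \<le> ?H m \<delta> * A (Suc m)"
        using Suc.prems by (intro mult_left_mono A) auto
      finally show "(\<integral>\<^sup>+t. ?H m \<delta> * h (Suc m) (wrap_add t (phase \<delta> m)) \<partial>wrapped_normal v)
          \<le> ?H m \<delta> * A (Suc m)" .
    qed
    also have "\<dots> = (\<integral>\<^sup>+\<delta>. ?H m \<delta> \<partial>?Q m) * A (Suc m)"
      using meas[of m] Suc.prems
      by (intro nn_integral_multc) (simp cong: measurable_cong_sets sets_PiM_cong)
    also have "\<dots> \<le> (\<Prod>k = 1..m. A k) * A (Suc m)"
      using Suc by (intro mult_right_mono) auto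
    finally show ?case by simp
  qed
  moreover have "(\<integral>\<^sup>+\<delta>. ?H n \<delta> \<partial>phase_increments v) =
      (\<integral>\<^sup>+\<delta>. ?H n \<delta> \<partial>?Q n)"
    using meas[of n] by (intro nn_integral_phase_increments_finite[OF v])
       (auto intro!: prod.cong arg_cong[where f = "h _"] phase_cong)
  ultimately show ?thesis by simp
qed

section \<open>Stationarity of the phases\<close>

text \<open>The time shift of the phase process, expressed on increments: the phase after one step
  becomes the new initial phase. Stationarity thereby becomes invariance of
  \<open>phase_increments\<close> under a measurable map.\<close>

definition shift_increments :: "(nat \<Rightarrow> real) \<Rightarrow> nat \<Rightarrow> real" where
  "shift_increments \<delta> k = (if k = 0 then phase \<delta> 1 else \<delta> (Suc k))"

lemma phase_shift_increments: "phase (shift_increments \<delta>) k = phase \<delta> (Suc k)"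
  by (induction k) (auto simp: shift_increments_def)

lemma phase_shift_increments_funpow: "phase ((shift_increments ^^ n) \<delta>) k = phase \<delta> (n + k)"
  by (induction n arbitrary: k) (auto simp: phase_shift_increments simp del: phase.simps)

lemma shift_increments_measurable [measurable]:
  "shift_increments \<in> measurable (PiM UNIV (\<lambda>_. borel)) (PiM UNIV (\<lambda>_. borel))"
proof (rule measurable_PiM_single')
  fix k :: nat
  show "(\<lambda>\<delta>. shift_increments \<delta> k) \<in> borel_measurable (PiM UNIV (\<lambda>_. borel))"
    unfolding shift_increments_def by (cases "k = 0") auto
qed (auto simp: space_PiM)

text \<open>With the increment held fixed, the uniform initial phase is integrated first; rotation
  invariance makes the result independent of the increment.\<close>

lemma distr_phase_1:
  assumes v: "0 < v"
  shows "distr (phase_increments v) borel (\<lambda>\<delta>. phase \<delta> 1) = uniform_measure lborel {-pi..<pi}"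
proof (rule measure_eqI)
  interpret product_sigma_finite "increment_law v"
    using prob_space_increment_law[OF v]
    by (auto simp: product_sigma_finite_def intro!: prob_space_imp_sigma_finite)
  interpret P: prob_space "PiM {1} (increment_law v)"
    by (intro prob_space_PiM prob_space_increment_law v)
  fix A assume "A \<in> sets (distr (phase_increments v) borel (\<lambda>\<delta>. phase \<delta> 1))"
  then have [measurable]: "A \<in> sets borel" by simp
  let ?f = "\<lambda>\<delta>. indicator A (phase \<delta> 1) :: ennreal"
  have [measurable]: "(\<lambda>\<delta>. phase \<delta> 1) \<in> borel_measurable (PiM {0, 1} (\<lambda>_. borel))"
    by (rule phase_measurable_PiM) auto
  have f: "?f \<in> borel_measurable (PiM {0, 1} (\<lambda>_. borel))"
    by measurable
  have "emeasure (distr (phase_increments v) borel (\<lambda>\<delta>. phase \<delta> 1)) A = (\<integral>\<^sup>+\<delta>. ?f \<delta> \<partial>phase_increments v)"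
    by (subst nn_integral_indicator[symmetric], simp, subst nn_integral_distr) auto
  also have "\<dots> = (\<integral>\<^sup>+\<delta>. ?f \<delta> \<partial>PiM {0, 1} (increment_law v))"
    by (rule nn_integral_phase_increments_finite[OF v _ f]) auto
  also have "\<dots> = (\<integral>\<^sup>+\<delta>. \<integral>\<^sup>+t. ?f (\<delta>(0 := t)) \<partial>increment_law v 0 \<partial>PiM {1} (increment_law v))"
    using f by (intro product_nn_integral_insert) (auto cong: measurable_cong_sets sets_PiM_cong)
  also have "\<dots> = (\<integral>\<^sup>+\<delta>. \<integral>\<^sup>+t. indicator A (wrap_add (\<delta> 1) t) \<partial>uniform_measure lborel {-pi..<pi} \<partial>PiM {1} (increment_law v))"
    by (simp add: increment_law_def)
  also have "\<dots> = (\<integral>\<^sup>+\<delta>. emeasure (uniform_measure lborel {-pi..<pi}) A \<partial>PiM {1} (increment_law v))"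
    by (subst nn_integral_wrap_add_uniform) auto
  also have "\<dots> = emeasure (uniform_measure lborel {-pi..<pi}) A"
    using P.emeasure_space_1 by simp
  finally show "emeasure (distr (phase_increments v) borel (\<lambda>\<delta>. phase \<delta> 1)) A = \<dots>" .
qed simp

text \<open>The coordinates of the shifted sequence are functions of disjoint groups of independent
  coordinates, hence independent; it remains to compare marginals, and only coordinate 0 needs an
  argument, namely \<open>distr_phase_1\<close>.\<close>

lemma distr_shift_increments:
  assumes v: "0 < v"
  shows "distr (phase_increments v) (phase_increments v) shift_increments = phase_increments v"
proof -
  let ?N = "phase_increments v" and ?B = "\<lambda>_::nat. borel :: real measure"
  interpret N: prob_space ?N by (rule prob_space_phase_increments[OF v])
  have comp: "distr ?N borel (\<lambda>\<delta>. \<delta> k) = increment_law v k" for k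
  proof -
    have "distr ?N borel (\<lambda>\<delta>. \<delta> k) = distr (PiM UNIV (increment_law v)) (increment_law v k) (\<lambda>\<delta>. \<delta> k)"
      unfolding phase_increments_eq by (rule distr_cong) auto
    then show ?thesis
      by (simp add: distr_PiM_component prob_space_increment_law[OF v])
  qed
  have rv[measurable]: "(\<lambda>\<delta>. \<delta> k) \<in> borel_measurable ?N" for k
    by measurable
  have indep: "N.indep_vars ?B (\<lambda>k \<delta>. \<delta> k) UNIV"
  proof (subst N.indep_vars_iff_distr_eq_PiM)
    have "distr ?N (PiM UNIV ?B) (\<lambda>x. \<lambda>i\<in>UNIV. x i) = distr ?N ?N (\<lambda>x. x)"
      by (rule distr_cong) (auto simp: sets_phase_increments)
    then show "distr ?N (PiM UNIV ?B) (\<lambda>x. \<lambda>i\<in>UNIV. x i) = PiM UNIV (\<lambda>i. distr ?N borel (\<lambda>\<delta>. \<delta> i))"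
      unfolding comp by (simp add: distr_id2 phase_increments_eq[symmetric])
  qed auto
  \<comment> \<open>The groups are {0, 1}, {2}, {3}, ...: the new initial phase consumes both the
    old one and the first increment. \<open>F\<close> recovers the shifted coordinate from its
    group.\<close>
  define K where "K j = (if j = 0 then {0, 1} else {Suc j})" for j :: nat
  define F where "F j f = (if j = 0 then wrap_add (f 1) (f 0) else f (Suc j))" for j :: nat and f :: "nat \<Rightarrow> real"
  have "N.indep_vars (\<lambda>j. PiM (K j) ?B) (\<lambda>j \<delta>. restrict (\<lambda>i. \<delta> i) (K j)) UNIV"
    by (rule N.indep_vars_restrict[OF indep]) (auto simp: K_def disjoint_family_on_def)
  then have "N.indep_vars ?B (\<lambda>j \<delta>. F j (restrict (\<lambda>i. \<delta> i) (K j))) UNIV"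
  proof (rule N.indep_vars_compose2)
    fix j
    have [measurable]: "(\<lambda>f. f 0) \<in> borel_measurable (PiM (K 0) ?B)" "(\<lambda>f. f (Suc 0)) \<in> borel_measurable (PiM (K 0) ?B)"
      "j \<noteq> 0 \<Longrightarrow> (\<lambda>f. f (Suc j)) \<in> borel_measurable (PiM (K j) ?B)"
      unfolding K_def by (auto intro!: measurable_component_singleton)
    show "F j \<in> borel_measurable (PiM (K j) ?B)"
      unfolding F_def by (cases "j = 0") auto
  qed
  also have "(\<lambda>j \<delta>. F j (restrict (\<lambda>i. \<delta> i) (K j))) = (\<lambda>j \<delta>. shift_increments \<delta> j)"
    by (auto simp: fun_eq_iff F_def K_def shift_increments_def)
  finally have "distr ?N (PiM UNIV ?B) (\<lambda>\<delta>. \<lambda>i\<in>UNIV. shift_increments \<delta> i) =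
      PiM UNIV (\<lambda>i. distr ?N borel (\<lambda>\<delta>. shift_increments \<delta> i))"
    by (subst (asm) N.indep_vars_iff_distr_eq_PiM) auto
  also have "distr ?N (PiM UNIV ?B) (\<lambda>\<delta>. \<lambda>i\<in>UNIV. shift_increments \<delta> i) = distr ?N ?N shift_increments"
    by (rule distr_cong) (auto simp: sets_phase_increments)
  also have "(\<lambda>i. distr ?N borel (\<lambda>\<delta>. shift_increments \<delta> i)) = increment_law v"
  proof
    fix k
    show "distr ?N borel (\<lambda>\<delta>. shift_increments \<delta> k) = increment_law v k"
    proof (cases "k = 0")
      case True
      then show ?thesis
        using distr_phase_1[OF v] by (simp add: shift_increments_def increment_law_def del: phase.simps)
    next
      case False
      then show ?thesis
        using comp[of "Suc k"] by (simp add: shift_increments_def increment_law_def)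
    qed
  qed
  finally show ?thesis
    by (simp add: phase_increments_eq)
qed

lemma shift_increments_funpow_measurable [measurable]:
  "shift_increments ^^ n \<in> measurable (PiM UNIV (\<lambda>_. borel)) (PiM UNIV (\<lambda>_. borel))"
  by (induction n) (auto simp: id_def intro: measurable_comp[OF _ shift_increments_measurable])

lemma distr_shift_increments_funpow:
  assumes v: "0 < v"
  shows "distr (phase_increments v) (phase_increments v) (shift_increments ^^ n) = phase_increments v"
proof (induction n)
  case 0
  then show ?case by (simp add: distr_id2 id_def)
next
  case (Suc n)
  have "distr (phase_increments v) (phase_increments v) (shift_increments ^^ Suc n) =
      distr (distr (phase_increments v) (phase_increments v) (shift_increments ^^ n)) (phase_increments v) shift_increments"
    by (subst distr_distr) auto
  then show ?case
    by (simp only: Suc distr_shift_increments[OF v])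
qed

section \<open>Joint law of input and output\<close>

type_synonym block = "nat \<times> nat \<Rightarrow> complex"

definition comb_phases :: "real \<Rightarrow> real \<Rightarrow> ((nat \<Rightarrow> real) \<times> (nat \<Rightarrow> real)) measure" where
  "comb_phases vc vr = phase_increments vc \<Otimes>\<^sub>M phase_increments vr"

text \<open>Left unwrapped: the outer wrapping in the channel disappears under
  \<open>cis\<close>.\<close>

definition comb_angle :: "(nat \<Rightarrow> real) \<times> (nat \<Rightarrow> real) \<Rightarrow> nat \<times> nat \<Rightarrow> real" where
  "comb_angle \<omega> i = phase (fst \<omega>) (fst i) + real (snd i) * phase (snd \<omega>) (fst i)"

definition comb_likelihood ::
  "nat \<Rightarrow> nat \<Rightarrow> block \<Rightarrow> block \<Rightarrow> (nat \<Rightarrow> real) \<times> (nat \<Rightarrow> real) \<Rightarrow> real" where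
  "comb_likelihood M n x y \<omega> = (\<Prod>i\<in>comb_indices M n. cgauss (y i - cis (comb_angle \<omega> i) * x i))"

text \<open>The transition density \<open>W\<close> of the channel. Averaging over whole phase paths
  is what couples the blocks.\<close>

definition comb_kernel ::
  "nat \<Rightarrow> real \<Rightarrow> real \<Rightarrow> nat \<Rightarrow> block \<Rightarrow> block \<Rightarrow> real" where
  "comb_kernel M vc vr n x y = (\<integral>\<omega>. comb_likelihood M n x y \<omega> \<partial>comb_phases vc vr)"

abbreviation comb_noise :: "comb_sample \<Rightarrow> block" where
  "comb_noise s \<equiv> snd (snd (snd s))"

abbreviation block_power :: "nat \<Rightarrow> block \<Rightarrow> nat \<Rightarrow> real" where
  "block_power M x k \<equiv> \<Sum>m<M. (cmod (x (k, m)))\<^sup>2"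

abbreviation block_lborel :: "nat \<Rightarrow> nat \<Rightarrow> block measure" where
  "block_lborel M n \<equiv> (\<Pi>\<^sub>M i\<in>comb_indices M n. lborel)"

lemma finite_comb_indices [simp]: "finite (comb_indices M n)"
  by (simp add: comb_indices_def)

lemma sets_block_lborel [measurable_cong]: "sets (block_lborel M n) = sets (block_space M n)"
  by (rule sets_PiM_cong) auto

lemma space_block_lborel: "space (block_lborel M n) = space (block_space M n)"
  by (simp add: space_PiM)

lemma sigma_finite_block_lborel: "sigma_finite_measure (block_lborel M n)"
proof -
  interpret product_sigma_finite "\<lambda>_::nat \<times> nat. lborel :: complex measure" ..
  show ?thesis by (rule sigma_finite) simp
qed

lemma sets_comb_phases [measurable_cong]:
  "sets (comb_phases vc vr) = sets (PiM UNIV (\<lambda>_. borel) \<Otimes>\<^sub>M PiM UNIV (\<lambda>_. borel))"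
  unfolding comb_phases_def by (intro sets_pair_measure_cong sets_phase_increments)

lemma space_comb_phases [simp]: "space (comb_phases vc vr) = UNIV"
  by (simp add: comb_phases_def space_pair_measure)

lemma prob_space_comb_phases: "0 < vc \<Longrightarrow> 0 < vr \<Longrightarrow> prob_space (comb_phases vc vr)"
  unfolding comb_phases_def by (intro prob_space_pair prob_space_phase_increments)

lemma comb_angle_measurable [measurable]:
  "(\<lambda>\<omega>. comb_angle \<omega> i) \<in> borel_measurable (PiM UNIV (\<lambda>_. borel) \<Otimes>\<^sub>M PiM UNIV (\<lambda>_. borel))"
  unfolding comb_angle_def by measurable

lemma comb_likelihood_measurable [measurable (raw)]:
  assumes X: "X \<in> measurable N (block_space M n)" and Y: "Y \<in> measurable N (block_space M n)"
    and Z[measurable]: "Z \<in> measurable N (PiM UNIV (\<lambda>_. borel) \<Otimes>\<^sub>M PiM UNIV (\<lambda>_. borel))"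
  shows "(\<lambda>s. comb_likelihood M n (X s) (Y s) (Z s)) \<in> borel_measurable N"
  unfolding comb_likelihood_def
proof (intro borel_measurable_prod)
  fix i assume i: "i \<in> comb_indices M n"
  have [measurable]: "(\<lambda>s. X s i) \<in> borel_measurable N" "(\<lambda>s. Y s i) \<in> borel_measurable N"
    using measurable_compose[OF X measurable_component_singleton[OF i]]
      measurable_compose[OF Y measurable_component_singleton[OF i]] by simp_all
  show "(\<lambda>s. cgauss (Y s i - cis (comb_angle (Z s) i) * X s i)) \<in> borel_measurable N"
    by measurable
qed

lemma comb_likelihood_pos: "0 < comb_likelihood M n x y \<omega>"
  unfolding comb_likelihood_def by (intro prod_pos) (auto simp: cgauss_pos)

lemma comb_likelihood_le_1: "comb_likelihood M n x y \<omega> \<le> 1"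
  unfolding comb_likelihood_def by (intro prod_le_1) (auto simp: cgauss_le_1)

lemma comb_likelihood_section_measurable [measurable]:
  "comb_likelihood M n x y \<in> borel_measurable (PiM UNIV (\<lambda>_. borel) \<Otimes>\<^sub>M PiM UNIV (\<lambda>_. borel))"
  unfolding comb_likelihood_def by measurable

lemma integrable_comb_likelihood:
  assumes "0 < vc" "0 < vr"
  shows "integrable (comb_phases vc vr) (comb_likelihood M n x y)"
proof -
  interpret prob_space "comb_phases vc vr" by (rule prob_space_comb_phases[OF assms])
  show ?thesis
    using comb_likelihood_le_1 comb_likelihood_pos
    by (intro integrable_const_bound[where B = 1]) (auto simp: less_imp_le abs_of_pos)
qed

lemma ennreal_comb_kernel:
  assumes "0 < vc" "0 < vr"
  shows "ennreal (comb_kernel M vc vr n x y) = (\<integral>\<^sup>+\<omega>. ennreal (comb_likelihood M n x y \<omega>) \<partial>comb_phases vc vr)"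
  unfolding comb_kernel_def using integrable_comb_likelihood[OF assms] comb_likelihood_pos
  by (intro nn_integral_eq_integral[symmetric]) (auto simp: less_imp_le)

lemma comb_kernel_pos:
  assumes "0 < vc" "0 < vr"
  shows "0 < comb_kernel M vc vr n x y"
  unfolding comb_kernel_def
  by (intro prob_space.integral_pos_of_pos prob_space_comb_phases integrable_comb_likelihood comb_likelihood_pos assms)

lemma comb_kernel_le_1:
  assumes "0 < vc" "0 < vr"
  shows "comb_kernel M vc vr n x y \<le> 1"
proof -
  interpret prob_space "comb_phases vc vr" by (rule prob_space_comb_phases[OF assms])
  show ?thesis
    unfolding comb_kernel_def
    using integrable_comb_likelihood[OF assms] comb_likelihood_le_1 by (intro integral_le_const) auto
qed

lemma comb_kernel_measurable [measurable (raw)]: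
  assumes v: "0 < vc" "0 < vr"
    and [measurable]: "X \<in> measurable N (block_space M n)" "Y \<in> measurable N (block_space M n)"
  shows "(\<lambda>s. comb_kernel M vc vr n (X s) (Y s)) \<in> borel_measurable N"
proof -
  interpret prob_space "comb_phases vc vr" by (rule prob_space_comb_phases[OF v])
  show ?thesis
    unfolding comb_kernel_def by measurable
qed

section \<open>The output law given the input\<close>

text \<open>Serves both the Gaussian noise and the inputs uniform on a box. A finite product measure
  is determined by its values on boxes, where both sides factorise.\<close>

lemma (in product_sigma_finite) PiM_density:
  assumes I: "finite I" and f: "\<And>i. f i \<in> borel_measurable (M i)"
    and sf: "\<And>i. sigma_finite_measure (density (M i) (f i))"
  shows "PiM I (\<lambda>i. density (M i) (f i)) = density (PiM I M) (\<lambda>y. \<Prod>i\<in>I. f i (y i))" (is "_ = ?R")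
proof -
  interpret N: product_sigma_finite "\<lambda>i. density (M i) (f i)"
    by (simp add: product_sigma_finite_def sf)
  show ?thesis
  proof (rule N.PiM_eqI[OF I, symmetric])
    show "sets ?R = sets (PiM I (\<lambda>i. density (M i) (f i)))" by (auto intro!: sets_PiM_cong)
    fix A assume "\<And>i. i \<in> I \<Longrightarrow> A i \<in> sets (density (M i) (f i))"
    then have A: "i \<in> I \<Longrightarrow> A i \<in> sets (M i)" for i by simp
    have dm: "(\<lambda>y. \<Prod>i\<in>I. f i (y i)) \<in> borel_measurable (PiM I M)"
      using f by (intro borel_measurable_prod_ennreal) (rule measurable_compose[OF measurable_component_singleton])
    have "emeasure ?R (Pi\<^sub>E I A) = (\<integral>\<^sup>+y. (\<Prod>i\<in>I. f i (y i)) * indicator (Pi\<^sub>E I A) y \<partial>PiM I M)"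
      using A I dm by (intro emeasure_density sets_PiM_I_finite) auto
    also have "\<dots> = (\<integral>\<^sup>+y. (\<Prod>i\<in>I. f i (y i) * indicator (A i) (y i)) \<partial>PiM I M)"
    proof (intro nn_integral_cong)
      fix y assume y: "y \<in> space (PiM I M)"
      have "indicator (Pi\<^sub>E I A) y = (\<Prod>i\<in>I. indicator (A i) (y i) :: ennreal)"
        using y I by (cases "y \<in> Pi\<^sub>E I A") (auto simp: space_PiM PiE_iff split: split_indicator)
      then show "(\<Prod>i\<in>I. f i (y i)) * indicator (Pi\<^sub>E I A) y = (\<Prod>i\<in>I. f i (y i) * indicator (A i) (y i))"
        by (simp add: prod.distrib)
    qed
    also have "\<dots> = (\<Prod>i\<in>I. \<integral>\<^sup>+z. f i z * indicator (A i) z \<partial>M i)"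
      using A I f by (intro product_nn_integral_prod) auto
    also have "\<dots> = (\<Prod>i\<in>I. emeasure (density (M i) (f i)) (A i))"
      using A f by (intro prod.cong refl) (simp add: emeasure_density)
    finally show "emeasure ?R (Pi\<^sub>E I A) = (\<Prod>i\<in>I. emeasure (density (M i) (f i)) (A i))" .
  qed
qed

text \<open>The means \<open>a\<close> will be the rotated inputs for fixed input and phases. Each
  coordinate is a translated Gaussian by translation invariance of Lebesgue measure, and
  \<open>PiM_density\<close> assembles the coordinates.\<close>

lemma translated_noise_density:
  fixes a :: "'i \<Rightarrow> complex"
  assumes I: "finite I"
  shows "distr (PiM I (\<lambda>_. std_complex_normal)) (PiM I (\<lambda>_. lborel)) (\<lambda>w. \<lambda>i\<in>I. a i + w i) =
    density (PiM I (\<lambda>_. lborel)) (\<lambda>y. \<Prod>i\<in>I. ennreal (cgauss (y i - a i)))" (is "?L = ?R")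
proof -
  define N where "N i = density lborel (\<lambda>z. ennreal (cgauss (z - a i)))" for i
  have sN[simp]: "sets (N i) = sets borel" "space (N i) = UNIV" for i
    by (simp_all add: N_def)
  have "prob_space (N i)" for i
    by (rule prob_spaceI) (simp add: N_def emeasure_density nn_integral_cgauss_diff)
  then interpret N: product_sigma_finite N
    by (auto simp: product_sigma_finite_def intro!: prob_space_imp_sigma_finite)
  interpret G: product_sigma_finite "\<lambda>_::'i. std_complex_normal"
    by (auto simp: product_sigma_finite_def intro!: prob_space_imp_sigma_finite prob_space_std_complex_normal)
  interpret B: product_sigma_finite "\<lambda>_::'i. lborel :: complex measure" ..
  have [measurable]: "(\<lambda>w. \<lambda>i\<in>I. a i + w i) \<in> measurable (PiM I (\<lambda>_. std_complex_normal)) (PiM I (\<lambda>_. lborel))"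
    by (intro measurable_restrict) (auto intro!: measurable_component_singleton borel_measurable_add simp: measurable_lborel1)
  have "?L = PiM I N"
  proof (rule N.PiM_eqI[OF I])
    show "sets ?L = sets (PiM I N)" by (auto intro!: sets_PiM_cong)
    fix A assume "\<And>i. i \<in> I \<Longrightarrow> A i \<in> sets (N i)"
    then have A: "i \<in> I \<Longrightarrow> A i \<in> sets borel" for i by simp
    have pre: "(\<lambda>z. a i + z) -` A i \<in> sets borel" if "i \<in> I" for i
      using measurable_sets[of "\<lambda>z. a i + z" borel borel "A i"] A[OF that] by simp
    have "emeasure ?L (Pi\<^sub>E I A) =
        emeasure (PiM I (\<lambda>_. std_complex_normal)) ((\<lambda>w. \<lambda>i\<in>I. a i + w i) -` Pi\<^sub>E I A \<inter> space (PiM I (\<lambda>_. std_complex_normal)))"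
      using A I by (intro emeasure_distr sets_PiM_I_finite) auto
    also have "(\<lambda>w. \<lambda>i\<in>I. a i + w i) -` Pi\<^sub>E I A \<inter> space (PiM I (\<lambda>_. std_complex_normal)) = Pi\<^sub>E I (\<lambda>i. (\<lambda>z. a i + z) -` A i)"
      by (auto simp: space_PiM PiE_iff)
    also have "emeasure (PiM I (\<lambda>_. std_complex_normal)) \<dots> = (\<Prod>i\<in>I. emeasure std_complex_normal ((\<lambda>z. a i + z) -` A i))"
      using pre by (intro G.emeasure_PiM I) auto
    also have "\<dots> = (\<Prod>i\<in>I. emeasure (N i) (A i))"
    proof (intro prod.cong refl)
      fix i assume i: "i \<in> I"
      note [measurable] = A[OF i] pre[OF i]
      have "emeasure std_complex_normal ((\<lambda>z. a i + z) -` A i) =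
          (\<integral>\<^sup>+z. ennreal (cgauss (a i + z - a i)) * indicator (A i) (a i + z) \<partial>lborel)"
        by (auto simp: std_complex_normal_eq emeasure_density intro!: nn_integral_cong split: split_indicator)
      also have "\<dots> = (\<integral>\<^sup>+z. ennreal (cgauss (z - a i)) * indicator (A i) z \<partial>lborel)"
        by (rule nn_integral_lborel_translation[of "\<lambda>z. ennreal (cgauss (z - a i)) * indicator (A i) z"]) measurable
      also have "\<dots> = emeasure (N i) (A i)"
        by (simp add: N_def emeasure_density)
      finally show "emeasure std_complex_normal ((\<lambda>z. a i + z) -` A i) = emeasure (N i) (A i)" .
    qed
    finally show "emeasure ?L (Pi\<^sub>E I A) = (\<Prod>i\<in>I. emeasure (N i) (A i))" .
  qed
  also have "PiM I N = ?R"
    unfolding N_def using N.sigma_finite_measures by (intro B.PiM_density I) (auto simp: N_def)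
  finally show ?thesis .
qed

lemma nn_integral_additive_noise:
  assumes f[measurable]: "f \<in> borel_measurable (block_space M n)"
  shows "(\<integral>\<^sup>+w. f (\<lambda>i\<in>comb_indices M n. a i + w i) \<partial>additive_noise M) =
    (\<integral>\<^sup>+y. (\<Prod>i\<in>comb_indices M n. ennreal (cgauss (y i - a i))) * f y \<partial>block_lborel M n)"
proof -
  let ?I = "comb_indices M n" and ?J = "{1..} \<times> {..<M}"
  interpret product_prob_space "\<lambda>_. std_complex_normal" ?J
    by (intro product_prob_spaceI prob_space_std_complex_normal)
  have g[measurable]: "(\<lambda>w. f (\<lambda>i\<in>?I. a i + w i)) \<in> borel_measurable (PiM ?I (\<lambda>_. std_complex_normal))"
  proof (rule measurable_compose[OF _ f])
    show "(\<lambda>w. \<lambda>i\<in>?I. a i + w i) \<in> measurable (PiM ?I (\<lambda>_. std_complex_normal)) (block_space M n)"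
      by (intro measurable_restrict) (auto intro!: measurable_component_singleton borel_measurable_add)
  qed
  have t[measurable]: "(\<lambda>w. \<lambda>i\<in>?I. a i + w i) \<in> measurable (PiM ?I (\<lambda>_. std_complex_normal)) (block_lborel M n)"
    by (intro measurable_restrict) (auto intro!: measurable_component_singleton borel_measurable_add simp: measurable_lborel1)
  have "(\<integral>\<^sup>+w. f (\<lambda>i\<in>?I. a i + w i) \<partial>additive_noise M) =
      (\<integral>\<^sup>+w. f (\<lambda>i\<in>?I. a i + restrict w ?I i) \<partial>PiM ?J (\<lambda>_. std_complex_normal))"
    unfolding additive_noise_def by (intro nn_integral_cong arg_cong[where f = f]) auto
  also have "\<dots> = (\<integral>\<^sup>+w. f (\<lambda>i\<in>?I. a i + w i)
      \<partial>distr (PiM ?J (\<lambda>_. std_complex_normal)) (PiM ?I (\<lambda>_. std_complex_normal)) (\<lambda>w. restrict w ?I))"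
  proof (rule nn_integral_distr[symmetric])
    show "(\<lambda>w. restrict w ?I) \<in> measurable (PiM ?J (\<lambda>_. std_complex_normal)) (PiM ?I (\<lambda>_. std_complex_normal))"
      by (intro measurable_restrict_subset) (auto simp: comb_indices_def)
  qed (use g in simp)
  also have "\<dots> = (\<integral>\<^sup>+w. f (\<lambda>i\<in>?I. a i + w i) \<partial>PiM ?I (\<lambda>_. std_complex_normal))"
    by (subst distr_PiM_restrict_finite) (auto simp: comb_indices_def)
  also have "\<dots> = (\<integral>\<^sup>+y. f y \<partial>distr (PiM ?I (\<lambda>_. std_complex_normal)) (block_lborel M n) (\<lambda>w. \<lambda>i\<in>?I. a i + w i))"
    by (subst nn_integral_distr) auto
  also have "\<dots> = (\<integral>\<^sup>+y. (\<Prod>i\<in>?I. ennreal (cgauss (y i - a i))) * f y \<partial>block_lborel M n)"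
    unfolding translated_noise_density[OF finite_comb_indices]
  proof (subst nn_integral_density)
    show "(\<lambda>y. \<Prod>i\<in>?I. ennreal (cgauss (y i - a i))) \<in> borel_measurable (block_lborel M n)"
    proof (intro borel_measurable_prod_ennreal)
      fix i assume i: "i \<in> ?I"
      have [measurable]: "(\<lambda>y. y i) \<in> borel_measurable (block_lborel M n)"
        using measurable_component_singleton[OF i, of "\<lambda>_. lborel :: complex measure"] by simp
      show "(\<lambda>y. ennreal (cgauss (y i - a i))) \<in> borel_measurable (block_lborel M n)" by measurable
    qed
  qed auto
  finally show ?thesis .
qed

lemma comb_output_eq:
  "comb_output M n (x, \<delta>c, \<delta>r, w) =
    (\<lambda>i\<in>comb_indices M n. cis (comb_angle (\<delta>c, \<delta>r) i) * x i + w i)"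
  by (auto simp: comb_output_def comb_angle_def fun_eq_iff restrict_def)

lemma sets_additive_noise [measurable_cong]:
  "sets (additive_noise M) = sets (PiM ({1..} \<times> {..<M}) (\<lambda>_. borel))"
  unfolding additive_noise_def by (rule sets_PiM_cong) auto

lemma prob_space_additive_noise: "prob_space (additive_noise M)"
  unfolding additive_noise_def by (intro prob_space_PiM prob_space_std_complex_normal)

lemma prob_space_comb_space:
  assumes "0 < vc" "0 < vr" "prob_space P"
  shows "prob_space (comb_space M vc vr P)"
  unfolding comb_space_def
  by (intro prob_space_pair prob_space_phase_increments prob_space_additive_noise assms)

lemma sets_comb_space:
  assumes "sets P = sets (block_space M n)"
  shows "sets (comb_space M vc vr P) = sets (block_space M n \<Otimes>\<^sub>M (PiM UNIV (\<lambda>_. borel) \<Otimes>\<^sub>M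
    (PiM UNIV (\<lambda>_. borel) \<Otimes>\<^sub>M PiM ({1..} \<times> {..<M}) (\<lambda>_. borel))))"
  unfolding comb_space_def
  by (intro sets_pair_measure_cong assms sets_phase_increments sets_additive_noise)

lemma comb_output_measurable:
  assumes P[measurable_cong]: "sets P = sets (block_space M n)"
  shows "comb_output M n \<in> measurable (comb_space M vc vr P) (block_space M n)"
proof -
  note [measurable_cong] = sets_comb_space[OF P, of vc vr]
  have eq: "comb_output M n = (\<lambda>s. \<lambda>i\<in>comb_indices M n.
      cis (comb_angle (fst (snd s), fst (snd (snd s))) i) * fst s i + comb_noise s i)"
    by (auto simp: fun_eq_iff comb_output_eq)
  show ?thesis
    unfolding eq
  proof (intro measurable_restrict)
    fix i assume i: "i \<in> comb_indices M n"
    then have i': "i \<in> {1..} \<times> {..<M}" by (auto simp: comb_indices_def)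
    have [measurable]: "(\<lambda>x. x i) \<in> borel_measurable (block_space M n)"
      "(\<lambda>w. w i) \<in> borel_measurable (PiM ({1..} \<times> {..<M}) (\<lambda>_. borel :: complex measure))"
      using i i' by (auto intro!: measurable_component_singleton)
    show "(\<lambda>s. cis (comb_angle (fst (snd s), fst (snd (snd s))) i) * fst s i + comb_noise s i)
        \<in> borel_measurable (comb_space M vc vr P)"
      by measurable
  qed
qed

lemma comb_input_measurable:
  assumes "sets P = sets (block_space M n)"
  shows "comb_input \<in> measurable (comb_space M vc vr P) P"
  unfolding comb_input_def comb_space_def by measurable

text \<open>Tonelli in two stages: for fixed input and phases the noise integral becomes a Lebesgue
  integral over outputs weighted by the likelihood; then the phases are moved innermost, where
  averaging the likelihood yields the kernel.\<close>

lemma nn_integral_comb_space: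
  assumes v: "0 < vc" "0 < vr" and P: "prob_space P" "sets P = sets (block_space M n)"
    and f[measurable]: "f \<in> borel_measurable (block_space M n \<Otimes>\<^sub>M block_space M n)"
  shows "(\<integral>\<^sup>+s. f (comb_input s, comb_output M n s) \<partial>comb_space M vc vr P) =
    (\<integral>\<^sup>+x. \<integral>\<^sup>+y. ennreal (comb_kernel M vc vr n x y) * f (x, y) \<partial>block_lborel M n \<partial>P)"
proof -
  let ?C = "phase_increments vc" and ?R = "phase_increments vr" and ?N = "additive_noise M"
    and ?Ph = "comb_phases vc vr" and ?L = "block_lborel M n"
  note [measurable_cong] = P(2) sets_comb_space[OF P(2), of vc vr]
  interpret N: prob_space ?N by (rule prob_space_additive_noise)
  interpret R: prob_space ?R by (rule prob_space_phase_increments[OF v(2)])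
  interpret C: prob_space ?C by (rule prob_space_phase_increments[OF v(1)])
  interpret P: prob_space P by (rule P(1))
  interpret RN: pair_prob_space ?R ?N ..
  interpret CRN: pair_prob_space ?C "?R \<Otimes>\<^sub>M ?N" ..
  interpret L: sigma_finite_measure ?L by (rule sigma_finite_block_lborel)
  interpret Ph: prob_space ?Ph by (rule prob_space_comb_phases[OF v])
  interpret LPh: pair_sigma_finite ?L ?Ph ..
  have O[measurable]: "comb_output M n \<in> measurable (comb_space M vc vr P) (block_space M n)"
    by (rule comb_output_measurable[OF P(2)])
  have I[measurable]: "comb_input \<in> measurable (comb_space M vc vr P) (block_space M n)"
    using comb_input_measurable[OF P(2)] by (simp cong: measurable_cong_sets add: P(2))
  have g: "(\<lambda>s. f (comb_input s, comb_output M n s)) \<in> borel_measurable (comb_space M vc vr P)"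
    by measurable
  have lik: "(\<lambda>\<omega>. \<integral>\<^sup>+y. ennreal (comb_likelihood M n x y \<omega>) * f (x, y) \<partial>?L)
      \<in> borel_measurable (?Ph)" if "x \<in> space P" for x
    using that by (auto simp: sets_eq_imp_space_eq[OF P(2)])
  have "(\<integral>\<^sup>+s. f (comb_input s, comb_output M n s) \<partial>comb_space M vc vr P) =
      (\<integral>\<^sup>+x. \<integral>\<^sup>+\<delta>c. \<integral>\<^sup>+\<delta>r. \<integral>\<^sup>+w. f (x, comb_output M n (x, \<delta>c, \<delta>r, w)) \<partial>?N
        \<partial>?R \<partial>?C \<partial>P)"
  proof -
    define F where "F s = f (comb_input s, comb_output M n s)" for s
    have F: "F \<in> borel_measurable (P \<Otimes>\<^sub>M (?C \<Otimes>\<^sub>M (?R \<Otimes>\<^sub>M ?N)))"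
      using g by (simp add: F_def[abs_def] comb_space_def)
    have "(\<integral>\<^sup>+s. F s \<partial>comb_space M vc vr P) = (\<integral>\<^sup>+x. \<integral>\<^sup>+t. F (x, t)
        \<partial>(?C \<Otimes>\<^sub>M (?R \<Otimes>\<^sub>M ?N)) \<partial>P)"
      unfolding comb_space_def by (rule CRN.nn_integral_fst[OF F, symmetric])
    also have "\<dots> = (\<integral>\<^sup>+x. \<integral>\<^sup>+\<delta>c. \<integral>\<^sup>+t. F (x, \<delta>c, t)
        \<partial>(?R \<Otimes>\<^sub>M ?N) \<partial>?C \<partial>P)"
      by (intro nn_integral_cong RN.nn_integral_fst[symmetric] measurable_Pair2[OF F])
    also have "\<dots> = (\<integral>\<^sup>+x. \<integral>\<^sup>+\<delta>c. \<integral>\<^sup>+\<delta>r. \<integral>\<^sup>+w. F (x, \<delta>c, \<delta>r, w) \<partial>?N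
        \<partial>?R \<partial>?C \<partial>P)"
      by (intro nn_integral_cong N.nn_integral_fst[symmetric] measurable_Pair2[OF measurable_Pair2[OF F]])
    finally show ?thesis
      by (simp add: F_def comb_input_def)
  qed
  also have "\<dots> = (\<integral>\<^sup>+x. \<integral>\<^sup>+\<delta>c. \<integral>\<^sup>+\<delta>r. \<integral>\<^sup>+y. ennreal (comb_likelihood M n x y (\<delta>c, \<delta>r)) * f (x, y) \<partial>?L
        \<partial>?R \<partial>?C \<partial>P)"
    unfolding comb_output_eq comb_likelihood_def
    by (intro nn_integral_cong, subst nn_integral_additive_noise[of "\<lambda>y. f (_, y)"])
       (auto simp: prod_ennreal[symmetric] sets_eq_imp_space_eq[OF P(2)])
  also have "\<dots> = (\<integral>\<^sup>+x. \<integral>\<^sup>+\<omega>. \<integral>\<^sup>+y. ennreal (comb_likelihood M n x y \<omega>) * f (x, y) \<partial>?L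
        \<partial>?Ph \<partial>P)"
    using lik unfolding comb_phases_def
    by (intro nn_integral_cong) (rule R.nn_integral_fst)
  also have "\<dots> = (\<integral>\<^sup>+x. \<integral>\<^sup>+y. \<integral>\<^sup>+\<omega>. ennreal (comb_likelihood M n x y \<omega>) * f (x, y) \<partial>?Ph
        \<partial>?L \<partial>P)"
    by (intro nn_integral_cong LPh.Fubini') (simp add: sets_eq_imp_space_eq[OF P(2)])
  also have "\<dots> = (\<integral>\<^sup>+x. \<integral>\<^sup>+y. ennreal (comb_kernel M vc vr n x y) * f (x, y) \<partial>?L \<partial>P)"
    by (intro nn_integral_cong, subst nn_integral_multc) (auto simp: ennreal_comb_kernel[OF v])
  finally show ?thesis .
qed

lemma nn_integral_cgauss_prod:
  assumes "finite I"
  shows "(\<integral>\<^sup>+y. (\<Prod>i\<in>I. ennreal (cgauss (y i - a i))) \<partial>PiM I (\<lambda>_. lborel)) = 1"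
    and "(\<integral>\<^sup>+x. (\<Prod>i\<in>I. ennreal (cgauss (a i - cis (b i) * x i))) \<partial>PiM I (\<lambda>_. lborel)) = 1"
proof -
  interpret product_sigma_finite "\<lambda>_. lborel :: complex measure" ..
  have "(\<integral>\<^sup>+y. (\<Prod>i\<in>I. ennreal (cgauss (y i - a i))) \<partial>PiM I (\<lambda>_. lborel)) = (\<Prod>i\<in>I. \<integral>\<^sup>+z. ennreal (cgauss (z - a i)) \<partial>lborel)"
    by (intro product_nn_integral_prod assms) auto
  then show "(\<integral>\<^sup>+y. (\<Prod>i\<in>I. ennreal (cgauss (y i - a i))) \<partial>PiM I (\<lambda>_. lborel)) = 1"
    by (simp add: nn_integral_cgauss_diff)
  have "(\<integral>\<^sup>+x. (\<Prod>i\<in>I. ennreal (cgauss (a i - cis (b i) * x i))) \<partial>PiM I (\<lambda>_. lborel)) =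
      (\<Prod>i\<in>I. \<integral>\<^sup>+z. ennreal (cgauss (a i - cis (b i) * z)) \<partial>lborel)"
    by (intro product_nn_integral_prod assms) auto
  then show "(\<integral>\<^sup>+x. (\<Prod>i\<in>I. ennreal (cgauss (a i - cis (b i) * x i))) \<partial>PiM I (\<lambda>_. lborel)) = 1"
    by (simp add: nn_integral_cgauss_rotated)
qed

text \<open>For each phase path the likelihood is a probability density in the output, and also in
  the input because rotations preserve area. The second fact bounds the output density of a uniform
  input in the lower bound.\<close>

lemma comb_kernel_total:
  assumes v: "0 < vc" "0 < vr"
  shows "x \<in> space (block_space M n) \<Longrightarrow> (\<integral>\<^sup>+y. ennreal (comb_kernel M vc vr n x y) \<partial>block_lborel M n) = 1"
    and "y \<in> space (block_space M n) \<Longrightarrow> (\<integral>\<^sup>+x. ennreal (comb_kernel M vc vr n x y) \<partial>block_lborel M n) = 1"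
proof -
  interpret L: sigma_finite_measure "block_lborel M n" by (rule sigma_finite_block_lborel)
  interpret Ph: prob_space "comb_phases vc vr" by (rule prob_space_comb_phases[OF v])
  interpret LPh: pair_sigma_finite "block_lborel M n" "comb_phases vc vr" ..
  note [simp] = prod_ennreal[symmetric] nn_integral_cgauss_prod
  note one = Ph.emeasure_space_1[unfolded space_comb_phases]
  {
    assume x: "x \<in> space (block_space M n)"
    have "(\<integral>\<^sup>+y. ennreal (comb_kernel M vc vr n x y) \<partial>block_lborel M n) =
        (\<integral>\<^sup>+\<omega>. \<integral>\<^sup>+y. ennreal (comb_likelihood M n x y \<omega>) \<partial>block_lborel M n \<partial>comb_phases vc vr)"
      unfolding ennreal_comb_kernel[OF v] using x by (intro LPh.Fubini'[symmetric]) simp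
    then show "(\<integral>\<^sup>+y. ennreal (comb_kernel M vc vr n x y) \<partial>block_lborel M n) = 1"
      by (simp add: comb_likelihood_def one)
  }
  {
    assume y: "y \<in> space (block_space M n)"
    have "(\<integral>\<^sup>+x. ennreal (comb_kernel M vc vr n x y) \<partial>block_lborel M n) =
        (\<integral>\<^sup>+\<omega>. \<integral>\<^sup>+x. ennreal (comb_likelihood M n x y \<omega>) \<partial>block_lborel M n \<partial>comb_phases vc vr)"
      unfolding ennreal_comb_kernel[OF v] using y by (intro LPh.Fubini'[symmetric]) simp
    then show "(\<integral>\<^sup>+x. ennreal (comb_kernel M vc vr n x y) \<partial>block_lborel M n) = 1"
      by (simp add: comb_likelihood_def one)
  }
qed

lemma density_channel_comb:
  assumes v: "0 < vc" "0 < vr" and P: "prob_space P" "sets P = sets (block_space M n)"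
  shows "density_channel P (block_lborel M n) (comb_space M vc vr P) (comb_kernel M vc vr n) 1
    comb_input (comb_output M n)"
proof -
  note [measurable_cong] = P(2)
  interpret L: sigma_finite_measure "block_lborel M n" by (rule sigma_finite_block_lborel)
  interpret P: prob_space P by (rule P)
  interpret S: prob_space "comb_space M vc vr P" by (rule prob_space_comb_space[OF v P(1)])
  have O[measurable]: "comb_output M n \<in> measurable (comb_space M vc vr P) (block_lborel M n)"
    using comb_output_measurable[OF P(2)] by (simp cong: measurable_cong_sets add: sets_block_lborel)
  have I[measurable]: "comb_input \<in> measurable (comb_space M vc vr P) P"
    by (rule comb_input_measurable[OF P(2)])
  have W[measurable]: "(\<lambda>(x, y). comb_kernel M vc vr n x y) \<in> borel_measurable (P \<Otimes>\<^sub>M block_lborel M n)"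
    using v by measurable
  show ?thesis
  proof unfold_locales
    show "distr (comb_space M vc vr P) (P \<Otimes>\<^sub>M block_lborel M n) (\<lambda>s. (comb_input s, comb_output M n s)) =
        density (P \<Otimes>\<^sub>M block_lborel M n) (\<lambda>(x, y). ennreal (comb_kernel M vc vr n x y))" (is "?L = ?R")
    proof (rule measure_eqI)
      fix A assume "A \<in> sets ?L"
      then have A[measurable]: "A \<in> sets (P \<Otimes>\<^sub>M block_lborel M n)" by simp
      have A': "A \<in> sets (block_space M n \<Otimes>\<^sub>M block_space M n)"
        using A by (simp cong: sets_pair_measure_cong add: P(2) sets_block_lborel)
      have "emeasure ?L A = (\<integral>\<^sup>+s. indicator A (comb_input s, comb_output M n s) \<partial>comb_space M vc vr P)"
        by (subst nn_integral_indicator[symmetric], simp, subst nn_integral_distr) auto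
      also have "\<dots> = (\<integral>\<^sup>+x. \<integral>\<^sup>+y. ennreal (comb_kernel M vc vr n x y) * indicator A (x, y) \<partial>block_lborel M n \<partial>P)"
        using A' by (intro nn_integral_comb_space[OF v P]) auto
      also have "\<dots> = emeasure ?R A"
        by (subst emeasure_density) (auto simp: L.nn_integral_fst[symmetric])
      finally show "emeasure ?L A = emeasure ?R A" .
    qed simp
  qed (auto simp: comb_kernel_pos[OF v] comb_kernel_le_1[OF v] comb_kernel_total[OF v] sets_eq_imp_space_eq[OF P(2)])
qed

section \<open>Upper bound on the information\<close>

text \<open>Subchannel 0 sees the carrier phase alone and subchannel 1 the carrier plus the rate
  phase, so the average splits into an inner integral over rate phases and an outer one over carrier
  phases. The likelihood factors of the subchannels m >= 2 are simply bounded by 1.\<close>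

lemma comb_kernel_upper_bound:
  assumes M: "2 \<le> M" and v: "0 < vc" "0 < vr"
  obtains C where "0 < C"
    "\<And>n x y. comb_kernel M vc vr n x y \<le>
      (\<Prod>k = 1..n. C / (amp (x (k, 0)) * amp (x (k, 1))))"
proof -
  obtain Cc where Cc: "0 < Cc"
    "\<And>y x s. (\<integral>\<^sup>+\<delta>. ennreal (cgauss (y - cis (\<delta> + s) * x)) \<partial>wrapped_normal vc) \<le> ennreal (Cc / amp x)"
    using phase_averaged_cgauss_le[OF v(1)] by blast
  obtain Cr where Cr: "0 < Cr"
    "\<And>y x s. (\<integral>\<^sup>+\<delta>. ennreal (cgauss (y - cis (\<delta> + s) * x)) \<partial>wrapped_normal vr) \<le> ennreal (Cr / amp x)"
    using phase_averaged_cgauss_le[OF v(2)] by blast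
  interpret R: prob_space "phase_increments vr" by (rule prob_space_phase_increments[OF v(2)])
  have bound: "comb_kernel M vc vr n x y \<le>
      (\<Prod>k = 1..n. (Cc * Cr) / (amp (x (k, 0)) * amp (x (k, 1))))" for n x y
  proof -
    let ?A = "\<lambda>C m k. ennreal (C / amp (x (k, m)))"
    let ?h = "\<lambda>m k t. ennreal (cgauss (y (k, m) - cis t * x (k, m)))"
    let ?H0 = "\<lambda>\<delta>c. \<Prod>k = 1..n. ?h 0 k (phase \<delta>c k)"
      and ?H1 = "\<lambda>\<delta>c \<delta>r. \<Prod>k = 1..n. ?h 1 k (phase \<delta>c k + phase \<delta>r k)"
    have lik: "comb_likelihood M n x y \<omega> \<le>
        (\<Prod>k = 1..n. cgauss (y (k, 0) - cis (comb_angle \<omega> (k, 0)) * x (k, 0)) *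
          cgauss (y (k, 1) - cis (comb_angle \<omega> (k, 1)) * x (k, 1)))" for \<omega>
    proof -
      let ?g = "\<lambda>k m. cgauss (y (k, m) - cis (comb_angle \<omega> (k, m)) * x (k, m))"
      have "comb_likelihood M n x y \<omega> = (\<Prod>k = 1..n. \<Prod>m<M. ?g k m)"
        unfolding comb_likelihood_def comb_indices_def by (subst prod.cartesian_product) (simp add: split_beta')
      also have "\<dots> \<le> (\<Prod>k = 1..n. ?g k 0 * ?g k 1)"
      proof (intro prod_mono conjI prod_nonneg)
        fix k
        have "{..<M} = {0, 1} \<union> {2..<M}" using M by auto
        then have "(\<Prod>m<M. ?g k m) = (\<Prod>m\<in>{0, 1}. ?g k m) * (\<Prod>m\<in>{2..<M}. ?g k m)"
          by (simp only:) (rule prod.union_disjoint, auto)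
        also have "\<dots> \<le> (\<Prod>m\<in>{0, 1}. ?g k m) * 1"
          using cgauss_le_1 by (intro mult_left_mono prod_le_1 prod_nonneg) auto
        finally show "(\<Prod>m<M. ?g k m) \<le> ?g k 0 * ?g k 1" by simp
      qed auto
      finally show ?thesis .
    qed
    \<comment> \<open>The carrier phases are frozen and merely shift the angle. Since the one-step
      bound is uniform in the shift, the result does not depend on them and can be pulled out of the
      outer integral.\<close>
    have hr: "(\<integral>\<^sup>+\<delta>r. ?H1 \<delta>c \<delta>r \<partial>phase_increments vr) \<le> (\<Prod>k = 1..n. ?A Cr 1 k)" for \<delta>c
    proof (rule nn_integral_prod_phase_le[OF v(2), where h = "\<lambda>k t. ?h 1 k (phase \<delta>c k + t)"])
      fix k s
      have "cis (phase \<delta>c k + wrap_add \<delta> s) = cis (\<delta> + (s + phase \<delta>c k))" for \<delta>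
        using cis_wrap_pi_add[of "\<delta> + s" "phase \<delta>c k"] by (simp add: wrap_add_def ac_simps)
      then show "(\<integral>\<^sup>+\<delta>. ?h 1 k (phase \<delta>c k + wrap_add \<delta> s) \<partial>wrapped_normal vr) \<le> ?A Cr 1 k"
        using Cr(2) by simp
    qed measurable
    have hc: "(\<integral>\<^sup>+\<delta>c. ?H0 \<delta>c \<partial>phase_increments vc) \<le> (\<Prod>k = 1..n. ?A Cc 0 k)"
    proof (rule nn_integral_prod_phase_le[OF v(1)])
      fix k s
      show "(\<integral>\<^sup>+\<delta>. ?h 0 k (wrap_add \<delta> s) \<partial>wrapped_normal vc) \<le> ?A Cc 0 k"
        using Cc(2) by (simp add: wrap_add_def)
    qed measurable
    have "ennreal (comb_kernel M vc vr n x y) \<le>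
        (\<integral>\<^sup>+\<omega>. ?H0 (fst \<omega>) * ?H1 (fst \<omega>) (snd \<omega>) \<partial>comb_phases vc vr)"
      unfolding ennreal_comb_kernel[OF v]
    proof (intro nn_integral_mono)
      fix \<omega>
      have "ennreal (comb_likelihood M n x y \<omega>) \<le> ennreal (\<Prod>k = 1..n. cgauss (y (k, 0) - cis (comb_angle \<omega> (k, 0)) * x (k, 0)) *
          cgauss (y (k, 1) - cis (comb_angle \<omega> (k, 1)) * x (k, 1)))"
        by (intro ennreal_leI lik)
      also have "\<dots> = ?H0 (fst \<omega>) * ?H1 (fst \<omega>) (snd \<omega>)"
        by (simp add: comb_angle_def prod_ennreal prod.distrib ennreal_mult prod_nonneg)
      finally show "ennreal (comb_likelihood M n x y \<omega>) \<le>
          ?H0 (fst \<omega>) * ?H1 (fst \<omega>) (snd \<omega>)" .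
    qed
    also have "\<dots> = (\<integral>\<^sup>+\<delta>c. \<integral>\<^sup>+\<delta>r. ?H0 \<delta>c * ?H1 \<delta>c \<delta>r
        \<partial>phase_increments vr \<partial>phase_increments vc)"
      unfolding comb_phases_def by (subst R.nn_integral_fst[symmetric]) auto
    also have "\<dots> = (\<integral>\<^sup>+\<delta>c. ?H0 \<delta>c * (\<integral>\<^sup>+\<delta>r. ?H1 \<delta>c \<delta>r
        \<partial>phase_increments vr) \<partial>phase_increments vc)"
      by (intro nn_integral_cong nn_integral_cmult) measurable
    also have "\<dots> \<le> (\<integral>\<^sup>+\<delta>c. ?H0 \<delta>c * (\<Prod>k = 1..n. ?A Cr 1 k) \<partial>phase_increments vc)"
      by (intro nn_integral_mono mult_left_mono hr) auto
    also have "\<dots> = (\<integral>\<^sup>+\<delta>c. ?H0 \<delta>c \<partial>phase_increments vc) * (\<Prod>k = 1..n. ?A Cr 1 k)"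
      by (intro nn_integral_multc) measurable
    also have "\<dots> \<le> (\<Prod>k = 1..n. ?A Cc 0 k) * (\<Prod>k = 1..n. ?A Cr 1 k)"
      by (intro mult_right_mono hc) auto
    also have "\<dots> = ennreal (\<Prod>k = 1..n. (Cc * Cr) / (amp (x (k, 0)) * amp (x (k, 1))))"
    proof -
      have "?A Cc 0 k * ?A Cr 1 k = ennreal ((Cc * Cr) / (amp (x (k, 0)) * amp (x (k, 1))))" for k
        using Cc(1) Cr(1) by (subst ennreal_mult[symmetric]) auto
      then show ?thesis
        using Cc(1) Cr(1) by (subst prod_ennreal[symmetric]) (auto simp: prod.distrib[symmetric])
    qed
    finally show ?thesis
      using Cc(1) Cr(1) by (subst (asm) ennreal_le_iff) (auto intro!: prod_nonneg)
  qed
  show ?thesis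
    using Cc(1) Cr(1) by (intro that[OF _ bound]) auto
qed

section \<open>Second moments of input and noise\<close>

lemma comb_power_measurable [measurable]:
  assumes "k \<in> {1..n}"
  shows "(\<lambda>x. block_power M x k) \<in> borel_measurable (block_space M n)"
proof (intro borel_measurable_sum)
  fix m assume "m \<in> {..<M}"
  then have [measurable]: "(\<lambda>x. x (k, m)) \<in> borel_measurable (block_space M n)"
    using assms by (intro measurable_component_singleton) (auto simp: comb_indices_def)
  show "(\<lambda>x. (cmod (x (k, m)))\<^sup>2) \<in> borel_measurable (block_space M n)"
    by measurable
qed

lemma input_laws_second_moments:
  assumes P: "P \<in> input_laws M n \<rho>" and \<rho>: "0 \<le> \<rho>"
  shows "k \<in> {1..n} \<Longrightarrow> integrable P (\<lambda>x. block_power M x k)"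
    and "(\<Sum>k = 1..n. \<integral>x. (block_power M x k) \<partial>P) \<le> real n * \<rho>"
proof -
  note [measurable_cong] = P[unfolded input_laws_def, simplified, THEN conjunct2, THEN conjunct1]
  let ?t = "\<lambda>k x. \<Sum>m<M. (cmod (x (k, m)))\<^sup>2"
  have le: "(\<Sum>k = 1..n. \<integral>\<^sup>+x. ennreal (?t k x) \<partial>P) \<le> ennreal (real n * \<rho>)"
    using P by (simp add: input_laws_def)
  show int: "integrable P (?t k)" if k: "k \<in> {1..n}" for k
  proof -
    have "(\<integral>\<^sup>+x. ennreal (?t k x) \<partial>P) \<le> (\<Sum>k = 1..n. \<integral>\<^sup>+x. ennreal (?t k x) \<partial>P)"
      using k by (intro member_le_sum) auto
    also have "\<dots> < \<infinity>"
      using le by (rule le_less_trans) simp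
    finally show ?thesis
      using k by (intro integrableI_nonneg) (auto intro!: sum_nonneg)
  qed
  have "(\<Sum>k = 1..n. \<integral>\<^sup>+x. ennreal (?t k x) \<partial>P) = (\<Sum>k = 1..n. ennreal (\<integral>x. ?t k x \<partial>P))"
    using int by (intro sum.cong refl nn_integral_eq_integral) (auto intro!: sum_nonneg)
  also have "\<dots> = ennreal (\<Sum>k = 1..n. \<integral>x. ?t k x \<partial>P)"
    by (intro sum_ennreal integral_nonneg_AE) (auto intro!: sum_nonneg)
  finally show "(\<Sum>k = 1..n. \<integral>x. ?t k x \<partial>P) \<le> real n * \<rho>"
    using le \<rho> by (simp add: ennreal_le_iff)
qed

lemma distr_pair_snd:
  assumes "prob_space M1" "prob_space M2"
  shows "distr (M1 \<Otimes>\<^sub>M M2) M2 snd = M2"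
proof (rule measure_eqI)
  interpret M1: prob_space M1 by fact
  interpret M2: prob_space M2 by fact
  fix A assume "A \<in> sets (distr (M1 \<Otimes>\<^sub>M M2) M2 snd)"
  then have A: "A \<in> sets M2" by simp
  have "snd -` A \<inter> space (M1 \<Otimes>\<^sub>M M2) = space M1 \<times> A"
    using sets.sets_into_space[OF A] by (auto simp: space_pair_measure)
  then show "emeasure (distr (M1 \<Otimes>\<^sub>M M2) M2 snd) A = emeasure M2 A"
    using A by (simp add: emeasure_distr M2.emeasure_pair_measure_Times M1.emeasure_space_1)
qed simp

lemma distr_comb_noise:
  assumes v: "0 < vc" "0 < vr" and P: "prob_space P" and i: "i \<in> {1..} \<times> {..<M}"
  shows "(\<lambda>s. comb_noise s i) \<in> measurable (comb_space M vc vr P) std_complex_normal"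
    and "distr (comb_space M vc vr P) std_complex_normal (\<lambda>s. comb_noise s i) = std_complex_normal"
proof -
  let ?N = "additive_noise M" and ?C = "phase_increments vc" and ?R = "phase_increments vr"
  have N: "distr ?N std_complex_normal (\<lambda>w. w i) = std_complex_normal"
    unfolding additive_noise_def by (intro distr_PiM_component prob_space_std_complex_normal i)
  note p = prob_space_phase_increments[OF v(1)] prob_space_phase_increments[OF v(2)] prob_space_additive_noise[of M]
  have w[measurable]: "(\<lambda>w. w i) \<in> measurable ?N std_complex_normal"
    unfolding additive_noise_def by (rule measurable_component_singleton[OF i])
  show "(\<lambda>s. comb_noise s i) \<in> measurable (comb_space M vc vr P) std_complex_normal"
    unfolding comb_space_def by measurable
  have "distr (comb_space M vc vr P) std_complex_normal (\<lambda>s. comb_noise s i) =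
      distr (distr (distr (distr (comb_space M vc vr P) (?C \<Otimes>\<^sub>M (?R \<Otimes>\<^sub>M ?N)) snd) (?R \<Otimes>\<^sub>M ?N) snd) ?N snd) std_complex_normal (\<lambda>w. w i)"
    unfolding comb_space_def by (simp add: distr_distr comp_def)
  also have "\<dots> = std_complex_normal"
    unfolding comb_space_def using p P by (simp add: distr_pair_snd prob_space_pair N)
  finally show "distr (comb_space M vc vr P) std_complex_normal (\<lambda>s. comb_noise s i) = std_complex_normal" .
qed

lemma noise_power_integrable:
  assumes v: "0 < vc" "0 < vr" and P: "prob_space P"
    and i: "i \<in> {1..} \<times> {..<M}"
  shows "integrable (comb_space M vc vr P) (\<lambda>s. (cmod (comb_noise s i))\<^sup>2)"
    and "(\<integral>s. (cmod (comb_noise s i))\<^sup>2 \<partial>comb_space M vc vr P) \<le> 4"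
proof -
  note d = distr_comb_noise[OF v P i]
  have "(\<integral>\<^sup>+s. ennreal ((cmod (comb_noise s i))\<^sup>2) \<partial>comb_space M vc vr P) =
      (\<integral>\<^sup>+z. ennreal ((cmod z)\<^sup>2) \<partial>distr (comb_space M vc vr P) std_complex_normal (\<lambda>s. comb_noise s i))"
    by (rule nn_integral_distr[OF d(1), symmetric]) simp
  then have le: "(\<integral>\<^sup>+s. ennreal ((cmod (comb_noise s i))\<^sup>2) \<partial>comb_space M vc vr P) \<le> 4"
    using second_moment_std_complex_normal by (simp add: d(2))
  have [measurable]: "(\<lambda>s. comb_noise s i) \<in> borel_measurable (comb_space M vc vr P)"
    using d(1) by (simp cong: measurable_cong_sets)
  show int: "integrable (comb_space M vc vr P) (\<lambda>s. (cmod (comb_noise s i))\<^sup>2)"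
    using le by (intro integrableI_nonneg) (auto intro: le_less_trans)
  show "(\<integral>s. (cmod (comb_noise s i))\<^sup>2 \<partial>comb_space M vc vr P) \<le> 4"
    using le nn_integral_eq_integral[OF int] by (simp add: ennreal_le_iff flip: ennreal_numeral)
qed

lemma block_noise_power:
  assumes v: "0 < vc" "0 < vr" and P: "prob_space P" and k: "1 \<le> k"
  shows "integrable (comb_space M vc vr P) (\<lambda>s. block_power M (comb_noise s) k)" (is "integrable ?S ?w")
    and "(\<integral>s. (block_power M (comb_noise s) k) \<partial>comb_space M vc vr P) \<le> 4 * real M"
proof -
  have km: "(k, m) \<in> {1..} \<times> {..<M}" if "m \<in> {..<M}" for m
    using k that by auto
  show "integrable ?S ?w"
    using km by (intro Bochner_Integration.integrable_sum noise_power_integrable[OF v P])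
  have "(\<integral>s. ?w s \<partial>?S) = (\<Sum>m<M. \<integral>s. (cmod (comb_noise s (k, m)))\<^sup>2 \<partial>?S)"
    using km by (intro Bochner_Integration.integral_sum noise_power_integrable[OF v P])
  also have "\<dots> \<le> (\<Sum>m<M. 4)"
    using km by (intro sum_mono noise_power_integrable[OF v P])
  finally show "(\<integral>s. ?w s \<partial>?S) \<le> 4 * real M" by simp
qed

lemma block_input_power:
  assumes v: "0 < vc" "0 < vr" and P: "P \<in> input_laws M n \<rho>" and \<rho>: "0 \<le> \<rho>" and k: "k \<in> {1..n}"
  shows "integrable (comb_space M vc vr P) (\<lambda>s. block_power M (comb_input s) k)"
    and "(\<integral>s. (block_power M (comb_input s) k) \<partial>comb_space M vc vr P) = (\<integral>x. (block_power M x k) \<partial>P)"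
proof -
  have p: "prob_space P" "sets P = sets (block_space M n)"
    using P by (auto simp: input_laws_def)
  interpret ch: density_channel P "block_lborel M n" "comb_space M vc vr P" "comb_kernel M vc vr n" 1 comb_input "comb_output M n"
    by (rule density_channel_comb[OF v p])
  have m: "(\<lambda>x. block_power M x k) \<in> borel_measurable P"
    using comb_power_measurable[OF k] p(2) by (simp cong: measurable_cong_sets)
  show "integrable (comb_space M vc vr P) (\<lambda>s. block_power M (comb_input s) k)"
    using input_laws_second_moments(1)[OF P \<rho> k] integrable_distr_eq[OF ch.X_measurable m]
    by (simp add: ch.distr_X)
  show "(\<integral>s. (block_power M (comb_input s) k) \<partial>comb_space M vc vr P) = (\<integral>x. (block_power M x k) \<partial>P)"
    using integral_distr[OF ch.X_measurable m] by (simp add: ch.distr_X)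
qed

section \<open>Inequalities behind the trial density\<close>

text \<open>Linearity in \<open>t\<close> is the point: summed over blocks and averaged, the
  correction involves only the total power, whereas individual blocks may exceed \<rho>.\<close>

lemma ln_le_tangent:
  fixes t \<rho> :: real
  assumes "0 \<le> t" "0 \<le> \<rho>"
  shows "ln (1 + 2 * t) \<le> ln (1 + 2 * \<rho>) + 2 * (t - \<rho>) / (1 + 2 * \<rho>)"
proof -
  have "ln ((1 + 2 * t) / (1 + 2 * \<rho>)) \<le> (1 + 2 * t) / (1 + 2 * \<rho>) - 1"
    using assms by (intro ln_le_minus_one) auto
  also have "\<dots> = 2 * (t - \<rho>) / (1 + 2 * \<rho>)"
    using assms by (simp add: field_simps)
  finally show ?thesis
    using assms by (simp add: ln_div)
qed

text \<open>Separates signal and noise multiplicatively, so that in the logarithm the noise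
  contributes only a multiple of its second moment.\<close>

lemma cmod_power2_add_le:
  fixes a b :: complex
  shows "1 + (cmod (a + b))\<^sup>2 \<le> (1 + 2 * (cmod a)\<^sup>2) * exp (2 * (cmod b)\<^sup>2)"
proof -
  have "(cmod (a + b))\<^sup>2 \<le> (cmod a + cmod b)\<^sup>2"
    by (intro power_mono norm_triangle_ineq) auto
  also have "\<dots> \<le> 2 * (cmod a)\<^sup>2 + 2 * (cmod b)\<^sup>2"
    using sum_squares_ge_zero[of "cmod a - cmod b" 0] by (simp add: power2_eq_square algebra_simps)
  also have "1 + (2 * (cmod a)\<^sup>2 + 2 * (cmod b)\<^sup>2) \<le> (1 + 2 * (cmod a)\<^sup>2) * (1 + 2 * (cmod b)\<^sup>2)"
    by (simp add: algebra_simps)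
  also have "\<dots> \<le> (1 + 2 * (cmod a)\<^sup>2) * exp (2 * (cmod b)\<^sup>2)"
    by (intro mult_left_mono exp_ge_add_one_self) auto
  finally show ?thesis by simp
qed

text \<open>The count of degrees of freedom. After subtracting the halves every coefficient is still
  positive, so each \<open>l m\<close> may be replaced by \<open>L\<close>; the coefficients add up
  to (1 + \<epsilon>) M - 1.\<close>

lemma sum_minus_half_first_two_le:
  fixes l :: "nat \<Rightarrow> real" and L \<epsilon> :: real
  assumes M: "2 \<le> M" and l: "\<And>m. m < M \<Longrightarrow> l m \<le> L" and \<epsilon>: "0 \<le> \<epsilon>"
  shows "(1 + \<epsilon>) * (\<Sum>m<M. l m) - l 0 / 2 - l 1 / 2 \<le> (real M - 1 + real M * \<epsilon>) * L"
proof -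
  have "{..<M} = {0, 1} \<union> {2..<M}" using M by auto
  then have split: "(\<Sum>m<M. l m) = l 0 + l 1 + (\<Sum>m\<in>{2..<M}. l m)"
    by (simp only:) (subst sum.union_disjoint, auto)
  have rest: "(\<Sum>m\<in>{2..<M}. l m) \<le> (real M - 2) * L"
    using sum_bounded_above[of "{2..<M}" l L] l M by (simp add: of_nat_diff)
  have "\<epsilon> * (\<Sum>m<M. l m) \<le> \<epsilon> * (real M * L)"
    using sum_bounded_above[of "{..<M}" l L] l \<epsilon> by (intro mult_left_mono) auto
  then show ?thesis
    using rest l[of 0] l[of 1] M unfolding distrib_right left_diff_distrib
    by (simp add: split algebra_simps)
qed

text \<open>The trial output density is a product of heavy-tailed densities proportional to
  \<open>(1 + |y|\<^sup>2) powr - (1 + \<epsilon>)\<close>: it charges \<open>(1 + \<epsilon>) ln |x|\<^sup>2\<close> for every subchannel, of which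
  the kernel bound refunds one half for each of the first two.\<close>

lemma comb_information_upper_bound:
  assumes M: "2 \<le> M" and v: "0 < vc" "0 < vr" and \<epsilon>: "0 < \<epsilon>"
  obtains c where
    "\<And>n \<rho> P. 0 \<le> \<rho> \<Longrightarrow> P \<in> input_laws M n \<rho> \<Longrightarrow>
      comb_information M vc vr n P \<le> real n * (c + (real M - 1 + real M * \<epsilon>) * ln (1 + 2 * \<rho>)) / ln 2"
    "\<And>n \<rho> P. 0 \<le> \<rho> \<Longrightarrow> P \<in> input_laws M n \<rho> \<Longrightarrow>
      integrable (comb_space M vc vr P)
        (density_channel.info P (comb_kernel M vc vr n) comb_input (comb_output M n))"
proof -
  obtain C where C: "0 < C" "\<And>n x y. comb_kernel M vc vr n x y \<le>
      (\<Prod>k = 1..n. C / (amp (x (k, 0)) * amp (x (k, 1))))"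
    using comb_kernel_upper_bound[OF M v] by blast
  obtain Z where Z: "0 < Z" "(\<integral>\<^sup>+z. ennreal ((1 + (cmod z)\<^sup>2) powr - (1 + \<epsilon>) / Z) \<partial>lborel) \<le> 1"
    using complex_cauchy_power_density[OF \<epsilon>] by blast
  \<comment> \<open>Per block, \<open>a\<close> is the coefficient of the logarithm of the power,
    \<open>b\<close> the charge for noise power (the 2 of \<open>cmod_power2_add_le\<close> times
    the tail exponent), and \<open>d\<close> collects \<open>C\<close> together with one
    normalisation \<open>Z\<close> per subchannel.\<close>
  define a where "a = real M - 1 + real M * \<epsilon>"
  define b where "b = 2 * (1 + \<epsilon>)"
  define d where "d = ln C + real M * ln Z"
  have a: "0 \<le> a" using M \<epsilon> by (simp add: a_def)
  have "integrable (comb_space M vc vr P)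
        (density_channel.info P (comb_kernel M vc vr n) comb_input (comb_output M n)) \<and>
      comb_information M vc vr n P \<le> real n * (d + 4 * b * real M + a * ln (1 + 2 * \<rho>)) / ln 2"
    if \<rho>: "0 \<le> \<rho>" and PL: "P \<in> input_laws M n \<rho>" for n \<rho> P
  proof -
    have P: "prob_space P" "sets P = sets (block_space M n)"
      using PL by (auto simp: input_laws_def)
    let ?S = "comb_space M vc vr P" and ?I = "comb_indices M n"
    interpret ch: density_channel P "block_lborel M n" ?S "comb_kernel M vc vr n" 1 comb_input "comb_output M n"
      by (rule density_channel_comb[OF v P])
    let ?t = "\<lambda>k x. \<Sum>m<M. (cmod (x (k, m)))\<^sup>2"
    let ?w = "\<lambda>s k. block_power M (comb_noise s) k"
    \<comment> \<open>The exponent charged to one block, affine in its input power \<open>p\<close>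
      and noise power \<open>q\<close>, so that its expectation is obtained by inserting the
      expected powers.\<close>
    let ?u = "\<lambda>p q. d + a * (ln (1 + 2 * \<rho>) + 2 * (p - \<rho>) / (1 + 2 * \<rho>)) + b * q"
    define U where "U s = (\<Sum>k = 1..n. ?u (?t k (comb_input s)) (?w s k))"
      for s :: comb_sample
    let ?f = "\<lambda>z::complex. (1 + (cmod z)\<^sup>2) powr - (1 + \<epsilon>) / Z"
    define r where "r y = (\<Prod>i\<in>?I. ?f (y i))" for y :: block

    note t_int = block_input_power(1)[OF v PL \<rho>] and t_eq = block_input_power(2)[OF v PL \<rho>]
    have w_int: "integrable ?S (\<lambda>s. ?w s k)" and w_le: "(\<integral>s. ?w s k \<partial>?S) \<le> 4 * real M" if "k \<in> {1..n}" for k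
      using that block_noise_power[OF v P(1)] by auto
    have U_term_int: "integrable ?S (\<lambda>s. ?u (?t k (comb_input s)) (?w s k))"
      if "k \<in> {1..n}" for k
      using t_int[OF that] w_int[OF that] by simp
    have U_int: "integrable ?S U"
      unfolding U_def using U_term_int by (intro Bochner_Integration.integrable_sum)
    have U_le: "(\<integral>s. U s \<partial>?S) \<le> real n * (d + 4 * b * real M + a * ln (1 + 2 * \<rho>))"
    proof -
      have "(\<integral>s. U s \<partial>?S) = (\<Sum>k = 1..n. \<integral>s. ?u (?t k (comb_input s)) (?w s k) \<partial>?S)"
        unfolding U_def using U_term_int by (intro Bochner_Integration.integral_sum)
      also have "\<dots> = (\<Sum>k = 1..n. ?u (\<integral>x. ?t k x \<partial>P) (\<integral>s. ?w s k \<partial>?S))"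
      proof (intro sum.cong refl)
        fix k assume k: "k \<in> {1..n}"
        have "(\<integral>s. ?u (?t k (comb_input s)) (?w s k) \<partial>?S) =
            d + a * (ln (1 + 2 * \<rho>) + 2 * ((\<integral>s. ?t k (comb_input s) \<partial>?S) - \<rho>) / (1 + 2 * \<rho>)) + b * (\<integral>s. ?w s k \<partial>?S)"
          using t_int[OF k] w_int[OF k] by (simp add: ch.S.prob_space del: Bochner_Integration.integral_sum)
        then show "(\<integral>s. ?u (?t k (comb_input s)) (?w s k) \<partial>?S) =
            ?u (\<integral>x. ?t k x \<partial>P) (\<integral>s. ?w s k \<partial>?S)"
          by (simp only: t_eq[OF k])
      qed
      also have "\<dots> \<le> (\<Sum>k = 1..n. (d + a * ln (1 + 2 * \<rho>) + 4 * b * real M) + a * 2 / (1 + 2 * \<rho>) * ((\<integral>x. ?t k x \<partial>P) - \<rho>))"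
      proof (intro sum_mono)
        fix k assume k: "k \<in> {1..n}"
        have "b * (\<integral>s. ?w s k \<partial>?S) \<le> b * (4 * real M)"
          using \<epsilon> by (intro mult_left_mono w_le[OF k]) (simp add: b_def)
        moreover have "a * 2 / (1 + 2 * \<rho>) * ((\<integral>x. ?t k x \<partial>P) - \<rho>) = a * (2 * ((\<integral>x. ?t k x \<partial>P) - \<rho>) / (1 + 2 * \<rho>))"
          by simp
        ultimately show "?u (\<integral>x. ?t k x \<partial>P) (\<integral>s. ?w s k \<partial>?S) \<le>
            (d + a * ln (1 + 2 * \<rho>) + 4 * b * real M) + a * 2 / (1 + 2 * \<rho>) * ((\<integral>x. ?t k x \<partial>P) - \<rho>)"
          unfolding distrib_left[of a] by linarith
      qed
      also have "\<dots> = real n * (d + a * ln (1 + 2 * \<rho>) + 4 * b * real M) +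
          a * 2 / (1 + 2 * \<rho>) * ((\<Sum>k = 1..n. \<integral>x. ?t k x \<partial>P) - real n * \<rho>)"
        unfolding sum.distrib sum_distrib_left[symmetric] sum_subtractf by (simp, simp add: algebra_simps)
      \<comment> \<open>The only place where the power constraint enters the estimate of
        \<open>U\<close>: the tangent corrections of all blocks sum to a multiple of total power
        minus its budget.\<close>
      also have "a * 2 / (1 + 2 * \<rho>) * ((\<Sum>k = 1..n. \<integral>x. ?t k x \<partial>P) - real n * \<rho>) \<le> 0"
        using a \<rho> input_laws_second_moments(2)[OF PL \<rho>] by (intro mult_nonneg_nonpos) auto
      finally show ?thesis by (simp add: algebra_simps)
    qed
    have le: "comb_kernel M vc vr n (comb_input s) (comb_output M n s) \<le> r (comb_output M n s) * exp (U s)" for s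
    proof -
      obtain x \<delta>c \<delta>r w where s: "s = (x, \<delta>c, \<delta>r, w)" by (cases s)
      define y where "y = comb_output M n s"
      define l where "l k m = ln (1 + 2 * (cmod (x (k, m)))\<^sup>2)" for k m
      have pos: "0 < 1 + 2 * (cmod z)\<^sup>2" for z :: complex by (simp add: add_pos_nonneg)
      have factor: "C / (amp (x (k, 0)) * amp (x (k, 1))) \<le>
          (\<Prod>m<M. ?f (y (k, m))) *
          exp (?u (?t k x) (?w s k))" if k: "k \<in> {1..n}" for k
      proof -
        have y1: "1 + (cmod (y (k, m)))\<^sup>2 \<le> exp (l k m + 2 * (cmod (w (k, m)))\<^sup>2)" if "m < M" for m
        proof -
          have "(k, m) \<in> ?I" using k that by (auto simp: comb_indices_def)
          then have "y (k, m) = cis (comb_angle (\<delta>c, \<delta>r) (k, m)) * x (k, m) + w (k, m)"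
            by (simp add: y_def s comb_output_eq)
          then show ?thesis
            using cmod_power2_add_le[of "cis (comb_angle (\<delta>c, \<delta>r) (k, m)) * x (k, m)" "w (k, m)"] pos[of "x (k, m)"]
            by (simp add: norm_mult l_def exp_add)
        qed
        \<comment> \<open>The trial density decreases in |y|, so the upper bound \<open>y1\<close>
          on the output power becomes a lower bound on the density.\<close>
        have "exp (- ((1 + \<epsilon>) * (\<Sum>m<M. l k m + 2 * (cmod (w (k, m)))\<^sup>2)) - real M * ln Z) =
            (\<Prod>m<M. exp (l k m + 2 * (cmod (w (k, m)))\<^sup>2) powr - (1 + \<epsilon>) / Z)"
        proof -
          have "exp u powr - (1 + \<epsilon>) / Z = exp (- ((1 + \<epsilon>) * u) - ln Z)" for u
            using Z(1) by (simp add: powr_def exp_diff) (simp add: algebra_simps)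
          then show ?thesis
            by (simp add: exp_sum[symmetric] sum_subtractf sum_negf sum_distrib_left)
        qed
        also have "\<dots> \<le> (\<Prod>m<M. ?f (y (k, m)))"
          using y1 Z(1) \<epsilon>
          by (intro prod_mono conjI divide_right_mono powr_mono2') (auto simp: add_pos_nonneg)
        finally have low: "exp (- ((1 + \<epsilon>) * (\<Sum>m<M. l k m + 2 * (cmod (w (k, m)))\<^sup>2)) - real M * ln Z) \<le>
            (\<Prod>m<M. ?f (y (k, m)))" .
        have "C / (amp (x (k, 0)) * amp (x (k, 1))) =
            exp (ln C - l k 0 / 2 - l k 1 / 2)"
        proof -
          have "exp (l k m / 2) = amp (x (k, m))" for m
            using pos[of "x (k, m)"] by (simp add: l_def powr_half_sqrt[symmetric] powr_def)
          then show ?thesis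
            using C(1) by (simp add: exp_diff)
        qed
        also have "\<dots> \<le> exp (- ((1 + \<epsilon>) * (\<Sum>m<M. l k m + 2 * (cmod (w (k, m)))\<^sup>2)) - real M * ln Z +
            (?u (?t k x) (?w s k)))"
        proof -
          \<comment> \<open>Each subchannel is allowed the power of the whole block; this loses only
            a constant, since M is fixed.\<close>
          have "l k m \<le> ln (1 + 2 * ?t k x)" if "m < M" for m
            unfolding l_def using that pos[of "x (k, m)"]
            by (subst ln_le_cancel_iff) (auto intro!: member_le_sum add_pos_nonneg sum_nonneg)
          then have "(1 + \<epsilon>) * (\<Sum>m<M. l k m) - l k 0 / 2 - l k 1 / 2 \<le> a * ln (1 + 2 * ?t k x)"
            unfolding a_def using \<epsilon> by (intro sum_minus_half_first_two_le M) auto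
          also have "\<dots> \<le> a * (ln (1 + 2 * \<rho>) + 2 * (?t k x - \<rho>) / (1 + 2 * \<rho>))"
            using \<rho> by (intro mult_left_mono ln_le_tangent a) (auto intro!: sum_nonneg)
          finally have "(1 + \<epsilon>) * (\<Sum>m<M. l k m) - l k 0 / 2 - l k 1 / 2 \<le>
              a * (ln (1 + 2 * \<rho>) + 2 * (?t k x - \<rho>) / (1 + 2 * \<rho>))" .
          moreover have "(1 + \<epsilon>) * (\<Sum>m<M. l k m + 2 * (cmod (w (k, m)))\<^sup>2) = (1 + \<epsilon>) * (\<Sum>m<M. l k m) + b * ?w s k"
            by (simp add: s b_def sum.distrib sum_distrib_left algebra_simps)
          ultimately show ?thesis
            by (simp add: d_def)
        qed
        also have "\<dots> \<le> (\<Prod>m<M. ?f (y (k, m))) *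
            exp (?u (?t k x) (?w s k))"
          unfolding exp_add by (intro mult_right_mono low) auto
        finally show ?thesis .
      qed
      have "comb_kernel M vc vr n x y \<le>
          (\<Prod>k = 1..n. C / (amp (x (k, 0)) * amp (x (k, 1))))"
        by (rule C)
      also have "\<dots> \<le> (\<Prod>k = 1..n. (\<Prod>m<M. ?f (y (k, m))) *
          exp (?u (?t k x) (?w s k)))"
        using factor C(1) by (intro prod_mono) auto
      also have "\<dots> = (\<Prod>k = 1..n. \<Prod>m<M. ?f (y (k, m))) * exp (U s)"
        unfolding prod.distrib U_def by (simp add: exp_sum s comb_input_def)
      also have "(\<Prod>k = 1..n. \<Prod>m<M. ?f (y (k, m))) = r y"
        unfolding r_def comb_indices_def by (subst prod.cartesian_product) (simp add: split_beta')
      finally show ?thesis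
        by (simp add: y_def s comb_input_def)
    qed
    have r_pos: "0 < r y" for y
      unfolding r_def using Z(1) by (intro prod_pos) (auto simp: add_pos_nonneg less_imp_neq[THEN not_sym])
    have r_total: "(\<integral>\<^sup>+y. ennreal (r y) \<partial>block_lborel M n) \<le> 1"
    proof -
      interpret product_sigma_finite "\<lambda>_::nat \<times> nat. lborel :: complex measure" ..
      have "(\<integral>\<^sup>+y. ennreal (r y) \<partial>block_lborel M n) =
          (\<integral>\<^sup>+y. (\<Prod>i\<in>?I. ennreal (?f (y i))) \<partial>block_lborel M n)"
        unfolding r_def using Z(1) by (simp add: prod_ennreal)
      also have "\<dots> = (\<Prod>i\<in>?I. \<integral>\<^sup>+z. ennreal (?f z) \<partial>lborel)"
        by (intro product_nn_integral_prod) auto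
      also have "\<dots> \<le> (\<Prod>i\<in>?I. 1)"
        by (intro prod_mono_ennreal Z)
      finally show ?thesis by simp
    qed
    have r_meas: "r \<in> borel_measurable (block_lborel M n)"
      unfolding r_def
    proof (intro borel_measurable_prod)
      fix i assume i: "i \<in> ?I"
      have [measurable]: "(\<lambda>y. y i) \<in> borel_measurable (block_lborel M n)"
        using measurable_component_singleton[OF i, of "\<lambda>_. lborel :: complex measure"] by simp
      show "(\<lambda>y. ?f (y i)) \<in> borel_measurable (block_lborel M n)"
        by measurable
    qed
    note ub = ch.info_upper_bound[OF r_meas r_pos r_total U_int le]
    have "comb_information M vc vr n P = (\<integral>s. ch.info s \<partial>?S) / ln 2"
      unfolding comb_information_def
      by (intro ch.mutual_information_eq) (simp_all add: P(2) sets_block_lborel)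
    also have "\<dots> \<le> real n * (d + 4 * b * real M + a * ln (1 + 2 * \<rho>)) / ln 2"
      using ub(2) U_le by (intro divide_right_mono) auto
    finally show ?thesis using ub(1) by simp
  qed
  then show ?thesis
    by (intro that[of "d + 4 * b * real M"]) (auto simp: a_def)
qed

text \<open>The integrability claim does not mention \<epsilon>, so the value 1 will do.\<close>

lemma comb_info_integrable:
  assumes "2 \<le> M" "0 < vc" "0 < vr" "0 \<le> \<rho>" "P \<in> input_laws M n \<rho>"
  shows "integrable (comb_space M vc vr P)
    (density_channel.info P (comb_kernel M vc vr n) comb_input (comb_output M n))"
  by (rule comb_information_upper_bound[OF assms(1-3) zero_less_one]) (use assms(4,5) in blast)

section \<open>Superadditivity in the number of blocks\<close>

text \<open>Block numbers start at 1, so \<open>fst i \<le> n1\<close> selects exactly the first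
  stretch and block k of the second sits at position n1 + k.\<close>

definition block_append ::
  "nat \<Rightarrow> nat \<Rightarrow> nat \<Rightarrow> block \<times> block \<Rightarrow> block" where
  "block_append M n1 n2 = (\<lambda>(x1, x2). \<lambda>i\<in>comb_indices M (n1 + n2).
     if fst i \<le> n1 then x1 i else x2 (fst i - n1, snd i))"

definition block_first :: "nat \<Rightarrow> nat \<Rightarrow> block \<Rightarrow> block" where
  "block_first M n1 x = restrict x (comb_indices M n1)"

definition block_second :: "nat \<Rightarrow> nat \<Rightarrow> nat \<Rightarrow> block \<Rightarrow> block" where
  "block_second M n1 n2 x = (\<lambda>i\<in>comb_indices M n2. x (fst i + n1, snd i))"

lemma block_append_measurable [measurable]:
  "block_append M n1 n2 \<in> measurable (block_space M n1 \<Otimes>\<^sub>M block_space M n2) (block_space M (n1 + n2))"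
  unfolding block_append_def split_beta'
proof (intro measurable_restrict)
  fix i assume i: "i \<in> comb_indices M (n1 + n2)"
  show "(\<lambda>x. if fst i \<le> n1 then fst x i else snd x (fst i - n1, snd i))
      \<in> borel_measurable (block_space M n1 \<Otimes>\<^sub>M block_space M n2)"
  proof (cases "fst i \<le> n1")
    case True
    then have "i \<in> comb_indices M n1" using i by (auto simp: comb_indices_def)
    then have [measurable]: "(\<lambda>x. x i) \<in> borel_measurable (block_space M n1)"
      by (intro measurable_component_singleton)
    show ?thesis using True by simp
  next
    case False
    then have "(fst i - n1, snd i) \<in> comb_indices M n2" using i by (auto simp: comb_indices_def)
    then have [measurable]: "(\<lambda>x. x (fst i - n1, snd i)) \<in> borel_measurable (block_space M n2)"
      by (intro measurable_component_singleton)
    show ?thesis using False by simp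
  qed
qed

lemma block_first_measurable [measurable]:
  "block_first M n1 \<in> measurable (block_space M (n1 + n2)) (block_space M n1)"
  unfolding block_first_def by (rule measurable_restrict_subset) (auto simp: comb_indices_def)

lemma block_second_measurable [measurable]:
  "block_second M n1 n2 \<in> measurable (block_space M (n1 + n2)) (block_space M n2)"
  unfolding block_second_def
  by (intro measurable_restrict measurable_component_singleton) (auto simp: comb_indices_def)

lemma block_first_append: "x1 \<in> space (block_space M n1) \<Longrightarrow> block_first M n1 (block_append M n1 n2 (x1, x2)) = x1"
  by (auto simp: block_first_def block_append_def comb_indices_def space_PiM PiE_iff extensional_def fun_eq_iff restrict_def)

lemma block_second_append: "x2 \<in> space (block_space M n2) \<Longrightarrow> block_second M n1 n2 (block_append M n1 n2 (x1, x2)) = x2"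
  by (auto simp: block_second_def block_append_def comb_indices_def space_PiM PiE_iff extensional_def fun_eq_iff restrict_def)

lemma comb_output_first:
  "comb_output M n1 (block_first M n1 x, \<delta>c, \<delta>r, w) = block_first M n1 (comb_output M (n1 + n2) (x, \<delta>c, \<delta>r, w))"
  by (auto simp: comb_output_eq block_first_def comb_indices_def fun_eq_iff restrict_def)

text \<open>The second stretch is itself a run of the channel, driven by the shifted phases and the
  shifted noise.\<close>

lemma comb_output_second:
  "comb_output M n2 (block_second M n1 n2 x, (shift_increments ^^ n1) \<delta>c, (shift_increments ^^ n1) \<delta>r,
      \<lambda>i\<in>{1..} \<times> {..<M}. w (fst i + n1, snd i)) =
    block_second M n1 n2 (comb_output M (n1 + n2) (x, \<delta>c, \<delta>r, w))"
  by (auto simp: comb_output_eq block_second_def comb_indices_def fun_eq_iff restrict_def comb_angle_def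
      phase_shift_increments_funpow add.commute)

lemma distr_additive_noise_shift:
  "distr (additive_noise M) (additive_noise M) (\<lambda>w. \<lambda>i\<in>{1..} \<times> {..<M}. w (fst i + n, snd i)) = additive_noise M"
  unfolding additive_noise_def
  by (rule distr_PiM_reindex[where f = "\<lambda>i. (fst i + n, snd i)" and M = "\<lambda>_. std_complex_normal"])
     (auto simp: inj_on_def prob_space_std_complex_normal)

lemma additive_noise_shift_measurable [measurable]:
  "(\<lambda>w. \<lambda>i\<in>{1..} \<times> {..<M}. w (fst i + n, snd i)) \<in> measurable (additive_noise M) (additive_noise M)"
  unfolding additive_noise_def by (intro measurable_restrict measurable_component_singleton) auto

text \<open>Input, both phase processes and noise are independent, so a map acting on each
  separately carries the product law to the product of the image laws. It makes either stretch of
  the long channel a sample of a short one.\<close>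

lemma distr_comb_space_map:
  assumes v: "0 < vc" "0 < vr" and P': "prob_space P'"
    and f: "f \<in> measurable P P'" "distr P P' f = P'"
    and g: "g \<in> measurable (phase_increments vc) (phase_increments vc)" "distr (phase_increments vc) (phase_increments vc) g = phase_increments vc"
    and h: "h \<in> measurable (phase_increments vr) (phase_increments vr)" "distr (phase_increments vr) (phase_increments vr) h = phase_increments vr"
    and u: "u \<in> measurable (additive_noise M) (additive_noise M)" "distr (additive_noise M) (additive_noise M) u = additive_noise M"
  shows "(\<lambda>(x, \<delta>c, \<delta>r, w). (f x, g \<delta>c, h \<delta>r, u w)) \<in> measurable (comb_space M vc vr P) (comb_space M vc vr P')"
    and "distr (comb_space M vc vr P) (comb_space M vc vr P') (\<lambda>(x, \<delta>c, \<delta>r, w). (f x, g \<delta>c, h \<delta>r, u w)) = comb_space M vc vr P'"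
proof -
  note [measurable] = f(1) g(1) h(1) u(1)
  let ?N = "additive_noise M" and ?C = "phase_increments vc" and ?R = "phase_increments vr"
  let ?RN = "?R \<Otimes>\<^sub>M ?N" and ?hu = "\<lambda>(\<delta>r, w). (h \<delta>r, u w)"
  let ?ghu = "\<lambda>(\<delta>c, t). (g \<delta>c, ?hu t)"
  have N: "sigma_finite_measure ?N" and RN: "sigma_finite_measure (?RN)" and CRN: "sigma_finite_measure (?C \<Otimes>\<^sub>M ?RN)"
    by (intro prob_space_imp_sigma_finite prob_space_pair prob_space_phase_increments prob_space_additive_noise v)+
  show "(\<lambda>(x, \<delta>c, \<delta>r, w). (f x, g \<delta>c, h \<delta>r, u w)) \<in> measurable (comb_space M vc vr P) (comb_space M vc vr P')"
    unfolding comb_space_def by measurable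
  have 1: "distr (?RN) (?RN) ?hu = ?RN"
    using pair_measure_distr[OF h(1) u(1)] N by (simp add: h(2) u(2))
  have 2: "distr (?C \<Otimes>\<^sub>M ?RN) (?C \<Otimes>\<^sub>M ?RN) ?ghu = ?C \<Otimes>\<^sub>M ?RN"
    using pair_measure_distr[OF g(1), of ?hu "?RN" "?RN"] RN by (simp add: g(2) 1)
  have 3: "distr (P \<Otimes>\<^sub>M (?C \<Otimes>\<^sub>M ?RN)) (P' \<Otimes>\<^sub>M (?C \<Otimes>\<^sub>M ?RN))
      (\<lambda>(x, t). (f x, ?ghu t)) = P' \<Otimes>\<^sub>M (?C \<Otimes>\<^sub>M ?RN)"
    using pair_measure_distr[OF f(1), of ?ghu "?C \<Otimes>\<^sub>M ?RN" "?C \<Otimes>\<^sub>M ?RN"] CRN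
    by (simp add: f(2) 2)
  show "distr (comb_space M vc vr P) (comb_space M vc vr P') (\<lambda>(x, \<delta>c, \<delta>r, w). (f x, g \<delta>c, h \<delta>r, u w)) = comb_space M vc vr P'"
    using 3 by (simp add: comb_space_def split_beta')
qed

text \<open>The power sum over n1 + n2 blocks splits at n1, and the two budgets add up to the joint
  one.\<close>

lemma input_laws_append:
  assumes P1: "P1 \<in> input_laws M n1 \<rho>" and P2: "P2 \<in> input_laws M n2 \<rho>" and \<rho>: "0 \<le> \<rho>"
  defines "P \<equiv> distr (P1 \<Otimes>\<^sub>M P2) (block_space M (n1 + n2)) (block_append M n1 n2)"
  shows "P \<in> input_laws M (n1 + n2) \<rho>" "distr P P1 (block_first M n1) = P1" "distr P P2 (block_second M n1 n2) = P2"
proof -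
  have p: "prob_space P1" "prob_space P2" and [measurable_cong]: "sets P1 = sets (block_space M n1)" "sets P2 = sets (block_space M n2)"
    using P1 P2 by (auto simp: input_laws_def)
  note sp = sets_eq_imp_space_eq[OF \<open>sets P1 = _\<close>] sets_eq_imp_space_eq[OF \<open>sets P2 = _\<close>]
  interpret P1: prob_space P1 by (rule p)
  interpret P2: prob_space P2 by (rule p)
  interpret PP: pair_prob_space P1 P2 ..
  have m[measurable]: "block_append M n1 n2 \<in> measurable (P1 \<Otimes>\<^sub>M P2) (block_space M (n1 + n2))"
    by measurable
  have "distr P P1 (block_first M n1) = distr (P1 \<Otimes>\<^sub>M P2) P1 (block_first M n1 \<circ> block_append M n1 n2)"
    unfolding P_def by (rule distr_distr) measurable
  also have "\<dots> = distr (P1 \<Otimes>\<^sub>M P2) P1 fst"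
    by (intro distr_cong refl) (auto simp: space_pair_measure sp block_first_append)
  finally show "distr P P1 (block_first M n1) = P1"
    by (simp add: P2.distr_pair_fst)
  have "distr P P2 (block_second M n1 n2) = distr (P1 \<Otimes>\<^sub>M P2) P2 (block_second M n1 n2 \<circ> block_append M n1 n2)"
    unfolding P_def by (rule distr_distr) measurable
  also have "\<dots> = distr (P1 \<Otimes>\<^sub>M P2) P2 snd"
    by (intro distr_cong refl) (auto simp: space_pair_measure sp block_second_append)
  finally show "distr P P2 (block_second M n1 n2) = P2"
    by (simp add: distr_pair_snd p)
  let ?t = "\<lambda>k x. ennreal (block_power M x k)"
  have tm[measurable]: "?t k \<in> borel_measurable (block_space M n)" if "k \<in> {1..n}" for k n
    using comb_power_measurable[OF that] by measurable
  have t1: "(\<integral>\<^sup>+x. ?t k x \<partial>P) = (\<integral>\<^sup>+x. ?t k x \<partial>P1)" if k: "k \<in> {1..n1}" for k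
  proof -
    have "(\<integral>\<^sup>+x. ?t k x \<partial>P) = (\<integral>\<^sup>+z. ?t k (block_append M n1 n2 z) \<partial>(P1 \<Otimes>\<^sub>M P2))"
      unfolding P_def using k by (intro nn_integral_distr m) (simp add: tm)
    also have "\<dots> = (\<integral>\<^sup>+z. ?t k (fst z) \<partial>(P1 \<Otimes>\<^sub>M P2))"
      using k by (intro nn_integral_cong) (auto simp: block_append_def comb_indices_def intro!: arg_cong[where f = ennreal] sum.cong)
    also have "\<dots> = (\<integral>\<^sup>+x. ?t k x \<partial>distr (P1 \<Otimes>\<^sub>M P2) P1 fst)"
      using k by (subst nn_integral_distr) auto
    finally show ?thesis by (simp add: P2.distr_pair_fst)
  qed
  have t2: "(\<integral>\<^sup>+x. ?t (k + n1) x \<partial>P) = (\<integral>\<^sup>+x. ?t k x \<partial>P2)" if k: "k \<in> {1..n2}" for k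
  proof -
    have "(\<integral>\<^sup>+x. ?t (k + n1) x \<partial>P) = (\<integral>\<^sup>+z. ?t (k + n1) (block_append M n1 n2 z) \<partial>(P1 \<Otimes>\<^sub>M P2))"
      unfolding P_def using k by (intro nn_integral_distr m) (simp add: tm)
    also have "\<dots> = (\<integral>\<^sup>+z. ?t k (snd z) \<partial>(P1 \<Otimes>\<^sub>M P2))"
      using k by (intro nn_integral_cong) (auto simp: block_append_def comb_indices_def intro!: arg_cong[where f = ennreal] sum.cong)
    also have "\<dots> = (\<integral>\<^sup>+x. ?t k x \<partial>distr (P1 \<Otimes>\<^sub>M P2) P2 snd)"
      using k by (subst nn_integral_distr) auto
    finally show ?thesis by (simp add: distr_pair_snd p)
  qed
  have "(\<Sum>k = 1..n1 + n2. \<integral>\<^sup>+x. ?t k x \<partial>P) = (\<Sum>k = 1..n1. \<integral>\<^sup>+x. ?t k x \<partial>P) + (\<Sum>k = 1..n2. \<integral>\<^sup>+x. ?t (k + n1) x \<partial>P)"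
    unfolding sum.shift_bounds_cl_nat_ivl[of "\<lambda>k. \<integral>\<^sup>+x. ?t k x \<partial>P" 1 n1 n2, symmetric]
    by (subst sum.ub_add_nat) (auto simp only: add.commute)
  also have "\<dots> = (\<Sum>k = 1..n1. \<integral>\<^sup>+x. ?t k x \<partial>P1) + (\<Sum>k = 1..n2. \<integral>\<^sup>+x. ?t k x \<partial>P2)"
    using t1 t2 by simp
  also have "\<dots> \<le> ennreal (real n1 * \<rho>) + ennreal (real n2 * \<rho>)"
    using P1 P2 by (intro add_mono) (auto simp: input_laws_def)
  also have "\<dots> = ennreal (real (n1 + n2) * \<rho>)"
    using \<rho> by (simp add: ennreal_plus[symmetric] distrib_right del: ennreal_plus)
  finally show "P \<in> input_laws M (n1 + n2) \<rho>"
    using PP.prob_space_distr[OF m] by (simp add: input_laws_def P_def)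
qed

text \<open>The stretches share phase memory, so their outputs are dependent and the product of the
  two posteriors is not the true one. It is nevertheless a conditional density of the input, which
  is all that \<open>mismatched_le_info\<close> asks for.\<close>

lemma comb_information_append:
  assumes M: "2 \<le> M" and v: "0 < vc" "0 < vr" and \<rho>: "0 \<le> \<rho>"
    and P1: "P1 \<in> input_laws M n1 \<rho>" and P2: "P2 \<in> input_laws M n2 \<rho>"
  obtains P where "P \<in> input_laws M (n1 + n2) \<rho>"
    "comb_information M vc vr n1 P1 + comb_information M vc vr n2 P2 \<le> comb_information M vc vr (n1 + n2) P"
proof -
  note int = comb_info_integrable[OF M v \<rho>]
  define P where "P = distr (P1 \<Otimes>\<^sub>M P2) (block_space M (n1 + n2)) (block_append M n1 n2)"
  have P: "P \<in> input_laws M (n1 + n2) \<rho>" "distr P P1 (block_first M n1) = P1" "distr P P2 (block_second M n1 n2) = P2"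
    unfolding P_def by (rule input_laws_append[OF P1 P2 \<rho>])+
  have p: "prob_space P1" "prob_space P2" "prob_space P"
    and s: "sets P1 = sets (block_space M n1)" "sets P2 = sets (block_space M n2)" "sets P = sets (block_space M (n1 + n2))"
    using P1 P2 P by (auto simp: input_laws_def)
  note [measurable_cong] = s
  note sp = sets_eq_imp_space_eq[OF s(1)] sets_eq_imp_space_eq[OF s(2)] sets_eq_imp_space_eq[OF s(3)]
  let ?S = "comb_space M vc vr P"
  interpret ch: density_channel P "block_lborel M (n1 + n2)" ?S "comb_kernel M vc vr (n1 + n2)" 1 comb_input "comb_output M (n1 + n2)"
    by (rule density_channel_comb[OF v p(3) s(3)])
  interpret c1: density_channel P1 "block_lborel M n1" "comb_space M vc vr P1" "comb_kernel M vc vr n1" 1 comb_input "comb_output M n1"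
    by (rule density_channel_comb[OF v p(1) s(1)])
  interpret c2: density_channel P2 "block_lborel M n2" "comb_space M vc vr P2" "comb_kernel M vc vr n2" 1 comb_input "comb_output M n2"
    by (rule density_channel_comb[OF v p(2) s(2)])
  interpret P12: pair_prob_space P1 P2 ..
  \<comment> \<open>\<open>T1\<close> and \<open>T2\<close> read a sample of each short channel off
    one sample of the long channel. The occurrences of \<open>id\<close> give \<open>T1\<close> the
    shape of a componentwise map.\<close>
  define T1 where "T1 = (\<lambda>(x, \<delta>c, \<delta>r, w). (block_first M n1 x, id \<delta>c, id \<delta>r, id w) :: comb_sample)"
  define T2 where "T2 = (\<lambda>(x, \<delta>c, \<delta>r, w). (block_second M n1 n2 x, (shift_increments ^^ n1) \<delta>c, (shift_increments ^^ n1) \<delta>r,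
      \<lambda>i\<in>{1..} \<times> {..<M}. w (fst i + n1, snd i)) :: comb_sample)"
  have T1: "T1 \<in> measurable ?S (comb_space M vc vr P1)" "distr ?S (comb_space M vc vr P1) T1 = comb_space M vc vr P1"
    unfolding T1_def using P(2) by (intro distr_comb_space_map[OF v p(1)]; simp add: distr_id2 id_def)+
  have shift_meas: "shift_increments ^^ n \<in> measurable (phase_increments v) (phase_increments v)" for n v
    by measurable
  have sec: "block_second M n1 n2 \<in> measurable P P2"
    by measurable
  have T2: "T2 \<in> measurable ?S (comb_space M vc vr P2)" "distr ?S (comb_space M vc vr P2) T2 = comb_space M vc vr P2"
    unfolding T2_def
    by (rule distr_comb_space_map[OF v p(2) sec P(3) shift_meas distr_shift_increments_funpow[OF v(1)]
          shift_meas distr_shift_increments_funpow[OF v(2)] additive_noise_shift_measurable distr_additive_noise_shift])+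
  let ?O = "comb_output M (n1 + n2)" and ?f = "block_first M n1" and ?g = "block_second M n1 n2"
  have T1_io: "comb_input (T1 s) = ?f (comb_input s)"
      "comb_output M n1 (T1 s) = ?f (?O s)" for s
  proof -
    obtain x \<delta>c \<delta>r w where [simp]: "s = (x, \<delta>c, \<delta>r, w)" by (rule prod_cases4)
    show "comb_input (T1 s) = ?f (comb_input s)"
      by (simp add: T1_def comb_input_def)
    have "T1 s = (?f x, \<delta>c, \<delta>r, w)"
      by (simp add: T1_def)
    then show "comb_output M n1 (T1 s) = ?f (?O s)"
      by (simp only: comb_output_first[of M n1 x \<delta>c \<delta>r w n2] \<open>s = _\<close>)
  qed
  have T2_io: "comb_input (T2 s) = ?g (comb_input s)"
      "comb_output M n2 (T2 s) = ?g (?O s)" for s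
  proof -
    obtain x \<delta>c \<delta>r w where [simp]: "s = (x, \<delta>c, \<delta>r, w)" by (rule prod_cases4)
    show "comb_input (T2 s) = ?g (comb_input s)"
      by (simp add: T2_def comb_input_def)
    have "T2 s = (?g x, (shift_increments ^^ n1) \<delta>c, (shift_increments ^^ n1) \<delta>r,
        \<lambda>i\<in>{1..} \<times> {..<M}. w (fst i + n1, snd i))"
      by (simp add: T2_def)
    then show "comb_output M n2 (T2 s) = ?g (?O s)"
      by (simp only: comb_output_second \<open>s = _\<close>)
  qed

  define V1 where "V1 x y = comb_kernel M vc vr n1 x y / c1.out y" for x y
  define V2 where "V2 x y = comb_kernel M vc vr n2 x y / c2.out y" for x y
  have V_pos: "x \<in> space (block_space M n1) \<Longrightarrow> y \<in> space (block_space M n1) \<Longrightarrow> 0 < V1 x y"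
    "x \<in> space (block_space M n2) \<Longrightarrow> y \<in> space (block_space M n2) \<Longrightarrow> 0 < V2 x y" for x y
    unfolding V1_def V2_def using c1.out_pos c2.out_pos
    by (auto intro!: divide_pos_pos comb_kernel_pos[OF v] simp: space_block_lborel)
  have [measurable]: "c1.out \<in> borel_measurable (block_space M n1)" "c2.out \<in> borel_measurable (block_space M n2)"
    using c1.out_measurable c2.out_measurable by (simp_all cong: measurable_cong_sets add: sets_block_lborel)
  have V1m[measurable]: "(\<lambda>z. V1 (fst z) (snd z)) \<in> borel_measurable (block_space M n1 \<Otimes>\<^sub>M block_space M n1)"
    and V2m[measurable]: "(\<lambda>z. V2 (fst z) (snd z)) \<in> borel_measurable (block_space M n2 \<Otimes>\<^sub>M block_space M n2)"
    unfolding V1_def V2_def using v by measurable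
  define V where "V x y = V1 (?f x) (?f y) * V2 (?g x) (?g y)" for x y
  have fs: "x \<in> space (block_space M (n1 + n2)) \<Longrightarrow> ?f x \<in> space (block_space M n1)"
    "x \<in> space (block_space M (n1 + n2)) \<Longrightarrow> ?g x \<in> space (block_space M n2)" for x
    using measurable_space[OF block_first_measurable] measurable_space[OF block_second_measurable] by auto
  have Vm: "(\<lambda>(x, y). V x y) \<in> borel_measurable (P \<Otimes>\<^sub>M block_lborel M (n1 + n2))"
  proof -
    have "(\<lambda>z. (?f (fst z), ?f (snd z))) \<in>
        measurable (P \<Otimes>\<^sub>M block_lborel M (n1 + n2)) (block_space M n1 \<Otimes>\<^sub>M block_space M n1)"
      "(\<lambda>z. (?g (fst z), ?g (snd z))) \<in>
        measurable (P \<Otimes>\<^sub>M block_lborel M (n1 + n2)) (block_space M n2 \<Otimes>\<^sub>M block_space M n2)"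
      by measurable
    from measurable_compose[OF this(1) V1m] measurable_compose[OF this(2) V2m] show ?thesis
      unfolding V_def by (simp add: split_beta')
  qed
  have Vpos: "0 < V x y" if "x \<in> space P" "y \<in> space (block_lborel M (n1 + n2))" for x y
    using that unfolding V_def by (intro mult_pos_pos V_pos fs) (auto simp: sp space_block_lborel)
  have one1: "(\<integral>\<^sup>+x. ennreal (V1 x y) \<partial>P1) = 1" if "y \<in> space (block_space M n1)" for y
    unfolding V1_def using that by (intro c1.posterior_total) (simp only: space_block_lborel)
  have one2: "(\<integral>\<^sup>+x. ennreal (V2 x y) \<partial>P2) = 1" if "y \<in> space (block_space M n2)" for y
    unfolding V2_def using that by (intro c2.posterior_total) (simp only: space_block_lborel)
  \<comment> \<open>The inputs to the two stretches are independent under \<open>P\<close>, so for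
    each fixed output the mass is a product of two posterior masses, both equal to 1.\<close>
  have V_total: "(\<integral>\<^sup>+x. ennreal (V x y) \<partial>P) \<le> 1" if y: "y \<in> space (block_lborel M (n1 + n2))" for y
  proof -
    let ?y1 = "?f y" and ?y2 = "?g y"
    have y': "?y1 \<in> space (block_space M n1)" "?y2 \<in> space (block_space M n2)"
      using y fs by (auto simp: space_block_lborel)
    have m1: "(\<lambda>x. V1 x ?y1) \<in> borel_measurable P1" and m2: "(\<lambda>x. V2 x ?y2) \<in> borel_measurable P2"
      using measurable_compose[OF measurable_Pair2'[of ?y1 "block_space M n1"] V1m]
        measurable_compose[OF measurable_Pair2'[of ?y2 "block_space M n2"] V2m] y'
      by (simp_all cong: measurable_cong_sets add: s)
    have "(\<lambda>x. ennreal (V x y)) \<in> borel_measurable (block_space M (n1 + n2))"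
      using measurable_compose[OF measurable_Pair2'[OF y] Vm] by (simp cong: measurable_cong_sets add: s)
    then have "(\<integral>\<^sup>+x. ennreal (V x y) \<partial>P) = (\<integral>\<^sup>+z. ennreal (V (block_append M n1 n2 z) y) \<partial>(P1 \<Otimes>\<^sub>M P2))"
      unfolding P_def by (subst nn_integral_distr) auto
    also have "\<dots> = (\<integral>\<^sup>+z. ennreal (V1 (fst z) ?y1) * ennreal (V2 (snd z) ?y2) \<partial>(P1 \<Otimes>\<^sub>M P2))"
      using V_pos y' by (intro nn_integral_cong)
        (auto simp: space_pair_measure sp V_def block_first_append block_second_append ennreal_mult less_imp_le)
    also have "\<dots> = (\<integral>\<^sup>+x1. \<integral>\<^sup>+x2. ennreal (V1 x1 ?y1) * ennreal (V2 x2 ?y2) \<partial>P2 \<partial>P1)"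
      using m1 m2 by (subst c2.P.nn_integral_fst[symmetric]) auto
    also have "\<dots> = 1"
      using m2 by (simp add: nn_integral_cmult one1 one2 y')
    finally show ?thesis by simp
  qed
  \<comment> \<open>The identity holds pointwise, so in expectation each term is evaluated under its
    own marginal law and the dependence between the stretches is irrelevant.\<close>
  have ln_V: "ln (V (comb_input s) (?O s)) = c1.info (T1 s) + c2.info (T2 s)" if s: "s \<in> space ?S" for s
  proof -
    have io: "comb_input s \<in> space (block_space M (n1 + n2))" "?O s \<in> space (block_space M (n1 + n2))"
      using measurable_space[OF ch.X_measurable s] measurable_space[OF ch.Y_measurable s]
      by (auto simp: sp space_block_lborel)
    have pos: "0 < V1 (?f (comb_input s)) (?f (?O s))"
      "0 < V2 (?g (comb_input s)) (?g (?O s))"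
      using io by (auto intro!: V_pos fs)
    have "c1.info (T1 s) = ln (V1 (?f (comb_input s)) (?f (?O s)))"
      "c2.info (T2 s) = ln (V2 (?g (comb_input s)) (?g (?O s)))"
      by (simp_all add: c1.info_def c2.info_def T1_io T2_io V1_def V2_def)
    then show ?thesis
      using pos unfolding V_def by (simp add: ln_mult)
  qed
  have i1: "integrable ?S (\<lambda>s. c1.info (T1 s))" and e1: "(\<integral>s. c1.info (T1 s) \<partial>?S) = (\<integral>s. c1.info s \<partial>comb_space M vc vr P1)"
    using integrable_distr_eq[OF T1(1) c1.info_measurable] integral_distr[OF T1(1) c1.info_measurable] int[OF P1]
    by (simp_all add: T1(2))
  have i2: "integrable ?S (\<lambda>s. c2.info (T2 s))" and e2: "(\<integral>s. c2.info (T2 s) \<partial>?S) = (\<integral>s. c2.info s \<partial>comb_space M vc vr P2)"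
    using integrable_distr_eq[OF T2(1) c2.info_measurable] integral_distr[OF T2(1) c2.info_measurable] int[OF P2]
    by (simp_all add: T2(2))
  have int_V: "integrable ?S (\<lambda>s. ln (V (comb_input s) (?O s)))"
    using Bochner_Integration.integrable_add[OF i1 i2] by (simp add: ln_V cong: Bochner_Integration.integrable_cong)
  have "(\<integral>s. c1.info s \<partial>comb_space M vc vr P1) + (\<integral>s. c2.info s \<partial>comb_space M vc vr P2) =
      (\<integral>s. ln (V (comb_input s) (?O s)) \<partial>?S)"
    using i1 i2 by (simp add: ln_V e1 e2 cong: Bochner_Integration.integral_cong)
  also have "\<dots> \<le> (\<integral>s. ch.info s \<partial>?S)"
    by (rule ch.mismatched_le_info[OF Vm Vpos V_total int_V int[OF P(1)]])
  finally have "((\<integral>s. c1.info s \<partial>comb_space M vc vr P1) + (\<integral>s. c2.info s \<partial>comb_space M vc vr P2)) / ln 2 \<le>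
      (\<integral>s. ch.info s \<partial>?S) / ln 2"
    by (intro divide_right_mono) auto
  moreover have "comb_information M vc vr n1 P1 = (\<integral>s. c1.info s \<partial>comb_space M vc vr P1) / ln 2"
    unfolding comb_information_def by (intro c1.mutual_information_eq) (simp_all add: s sets_block_lborel)
  moreover have "comb_information M vc vr n2 P2 = (\<integral>s. c2.info s \<partial>comb_space M vc vr P2) / ln 2"
    unfolding comb_information_def by (intro c2.mutual_information_eq) (simp_all add: s sets_block_lborel)
  moreover have "comb_information M vc vr (n1 + n2) P = (\<integral>s. ch.info s \<partial>?S) / ln 2"
    unfolding comb_information_def by (intro ch.mutual_information_eq) (simp_all add: s sets_block_lborel)
  ultimately show ?thesis
    by (intro that[OF P(1)]) (simp add: add_divide_distrib)
qed

section \<open>Lower bound from a single block\<close>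

lemma cmod_cis_diff_le: "cmod (cis s - cis t) \<le> \<bar>s - t\<bar>"
proof -
  have "(cmod (cis s - cis t))\<^sup>2 = (cos s - cos t)\<^sup>2 + (sin s - sin t)\<^sup>2"
    by (simp add: cmod_power2)
  also have "\<dots> = (2 * sin ((s - t) / 2))\<^sup>2"
  proof -
    have "(cos s - cos t)\<^sup>2 + (sin s - sin t)\<^sup>2 =
        (cos s ^ 2 + sin s ^ 2) + (cos t ^ 2 + sin t ^ 2) - 2 * (cos s * cos t + sin s * sin t)"
      by (simp add: power2_eq_square algebra_simps)
    also have "\<dots> = 2 - 2 * cos (s - t)"
      by (simp add: cos_diff)
    also have "cos (s - t) = 1 - 2 * (sin ((s - t) / 2))\<^sup>2"
    proof -
      have "2 * ((s - t) / 2) = s - t" by simp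
      then show ?thesis using cos_double_sin[of "(s - t) / 2"] by (simp only:)
    qed
    finally show ?thesis by (simp add: power_mult_distrib)
  qed
  also have "\<dots> \<le> (s - t)\<^sup>2"
    using abs_sin_x_le_abs_x[of "(s - t) / 2"] by (subst abs_le_square_iff[symmetric]) (simp add: abs_mult)
  finally show ?thesis
    using abs_le_square_iff[of "cmod (cis s - cis t)" "s - t"] by simp
qed

text \<open>The window is measured on the line, without wrapping, so near an endpoint half of it may
  fall outside the interval. The half facing 0, chosen by \<open>l\<close>, always stays inside
  because \<eta> <= pi; hence \<eta> and not 2 \<eta> in the numerator.\<close>

lemma uniform_phase_near:
  assumes \<theta>: "\<theta> \<in> {-pi..<pi}" and \<eta>: "0 \<le> \<eta>" "\<eta> \<le> pi"
  shows "ennreal (\<eta> / (2 * pi)) \<le> (\<integral>\<^sup>+u. indicator {\<theta>-\<eta>..\<theta>+\<eta>} u \<partial>uniform_measure lborel {-pi..<pi})"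
proof -
  define l where "l = (if \<theta> \<le> 0 then \<theta> else \<theta> - \<eta>)"
  have sub: "{l..<l+\<eta>} \<subseteq> {-pi..<pi} \<inter> {\<theta>-\<eta>..\<theta>+\<eta>}"
    using \<theta> \<eta> by (auto simp: l_def split: if_splits)
  have "ennreal (\<eta> / (2 * pi)) = emeasure lborel {l..<l+\<eta>} / ennreal (2 * pi)"
    using \<eta> by (simp add: divide_ennreal)
  also have "\<dots> \<le> emeasure lborel ({-pi..<pi} \<inter> {\<theta>-\<eta>..\<theta>+\<eta>}) / ennreal (2 * pi)"
    by (intro divide_right_mono_ennreal emeasure_mono sub) auto
  also have "\<dots> = (\<integral>\<^sup>+u. indicator {\<theta>-\<eta>..\<theta>+\<eta>} u \<partial>uniform_measure lborel {-pi..<pi})"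
    by simp
  finally show ?thesis .
qed

lemma phase_1_bounds: "phase \<delta> 1 \<in> {-pi..<pi}"
  using wrap_pi_bounds by (simp add: wrap_add_def)

text \<open>The kernel is bounded below by restricting the phase average to phases within \<open>\<eta>\<close> of the
  true ones, an event of probability of order \<open>\<eta>\<^sup>2\<close>.\<close>

lemma comb_kernel_lower_bound:
  assumes v: "0 < vc" "0 < vr" and \<eta>: "0 < \<eta>" "\<eta> \<le> pi"
  shows "exp (- (real M * ln pi + 2 * ln (2 * pi) - 2 * ln \<eta> +
      (\<Sum>m<M. 2 * (real M * \<eta>)\<^sup>2 * (cmod (x (1, m)))\<^sup>2 + 2 * (cmod (w (1, m)))\<^sup>2)))
    \<le> comb_kernel M vc vr 1 x (comb_output M 1 (x, \<delta>c, \<delta>r, w))"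
proof -
  let ?y = "comb_output M 1 (x, \<delta>c, \<delta>r, w)"
  let ?q = "\<Sum>m<M. 2 * (real M * \<eta>)\<^sup>2 * (cmod (x (1, m)))\<^sup>2 + 2 * (cmod (w (1, m)))\<^sup>2"
  let ?E = "\<lambda>\<delta> \<delta>'. indicator {phase \<delta> 1 - \<eta>..phase \<delta> 1 + \<eta>} (phase \<delta>' 1) :: ennreal"
  interpret R: prob_space "phase_increments vr" by (rule prob_space_phase_increments[OF v(2)])
  have near: "ennreal (\<eta> / (2 * pi)) \<le> (\<integral>\<^sup>+\<delta>'. ?E \<delta> \<delta>' \<partial>phase_increments v)" if "0 < v" for \<delta> v
  proof -
    have "ennreal (\<eta> / (2 * pi)) \<le> (\<integral>\<^sup>+u. indicator {phase \<delta> 1 - \<eta>..phase \<delta> 1 + \<eta>} u \<partial>uniform_measure lborel {-pi..<pi})"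
      using \<eta> by (intro uniform_phase_near phase_1_bounds) auto
    also have "\<dots> = (\<integral>\<^sup>+\<delta>'. ?E \<delta> \<delta>' \<partial>phase_increments v)"
      unfolding distr_phase_1[OF that, symmetric] by (rule nn_integral_distr) auto
    finally show ?thesis .
  qed
  have lik: "exp (- ?q) / pi ^ M \<le> comb_likelihood M 1 x ?y \<omega>"
    if \<omega>: "\<bar>phase (fst \<omega>) 1 - phase \<delta>c 1\<bar> \<le> \<eta>" "\<bar>phase (snd \<omega>) 1 - phase \<delta>r 1\<bar> \<le> \<eta>" for \<omega>
  proof -
    have "exp (- ?q) / pi ^ M = (\<Prod>m<M. exp (- (2 * (real M * \<eta>)\<^sup>2 * (cmod (x (1, m)))\<^sup>2 + 2 * (cmod (w (1, m)))\<^sup>2)) / pi)"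
      by (simp only: sum_negf[symmetric] exp_sum[OF finite_lessThan] prod_dividef prod_constant card_lessThan)
    also have "\<dots> \<le> (\<Prod>m<M. cgauss (?y (1, m) - cis (comb_angle \<omega> (1, m)) * x (1, m)))"
    proof (intro prod_mono conjI)
      fix m assume m: "m \<in> {..<M}"
      then have "(1, m) \<in> comb_indices M 1" by (simp add: comb_indices_def)
      then have "?y (1, m) - cis (comb_angle \<omega> (1, m)) * x (1, m) =
          (cis (comb_angle (\<delta>c, \<delta>r) (1, m)) - cis (comb_angle \<omega> (1, m))) * x (1, m) + w (1, m)"
        by (simp add: comb_output_eq algebra_simps del: One_nat_def)
      then have "cmod (?y (1, m) - cis (comb_angle \<omega> (1, m)) * x (1, m)) \<le>
          cmod (cis (comb_angle (\<delta>c, \<delta>r) (1, m)) - cis (comb_angle \<omega> (1, m))) * cmod (x (1, m)) + cmod (w (1, m))"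
        by (metis norm_mult norm_triangle_ineq)
      \<comment> \<open>An error of at most \<eta> in each phase changes the angle of subchannel m
        by at most (1 + m) \<eta>, and m < M. A chord is no longer than its arc.\<close>
      also have "\<dots> \<le> real M * \<eta> * cmod (x (1, m)) + cmod (w (1, m))"
      proof -
        have "cmod (cis (comb_angle (\<delta>c, \<delta>r) (1, m)) - cis (comb_angle \<omega> (1, m))) \<le>
            \<bar>comb_angle (\<delta>c, \<delta>r) (1, m) - comb_angle \<omega> (1, m)\<bar>"
          by (rule cmod_cis_diff_le)
        also have "\<dots> = \<bar>(phase \<delta>c 1 - phase (fst \<omega>) 1) + real m * (phase \<delta>r 1 - phase (snd \<omega>) 1)\<bar>"
          by (simp add: comb_angle_def algebra_simps del: phase.simps One_nat_def)
        also have "\<dots> \<le> \<bar>phase \<delta>c 1 - phase (fst \<omega>) 1\<bar> + \<bar>real m * (phase \<delta>r 1 - phase (snd \<omega>) 1)\<bar>"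
          by (rule abs_triangle_ineq)
        also have "\<dots> = \<bar>phase (fst \<omega>) 1 - phase \<delta>c 1\<bar> + real m * \<bar>phase (snd \<omega>) 1 - phase \<delta>r 1\<bar>"
          by (simp add: abs_mult abs_minus_commute del: phase.simps One_nat_def)
        also have "\<dots> \<le> \<eta> + real m * \<eta>"
          using \<omega> by (intro add_mono mult_left_mono) auto
        also have "\<dots> = (1 + real m) * \<eta>"
          by (simp add: algebra_simps)
        also have "\<dots> \<le> real M * \<eta>"
          using m \<eta> by (intro mult_right_mono) auto
        finally show ?thesis
          by (intro add_right_mono mult_right_mono) auto
      qed
      finally have "(cmod (?y (1, m) - cis (comb_angle \<omega> (1, m)) * x (1, m)))\<^sup>2 \<le>
          (real M * \<eta> * cmod (x (1, m)) + cmod (w (1, m)))\<^sup>2"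
        by (intro power_mono) auto
      also have "\<dots> \<le> 2 * (real M * \<eta>)\<^sup>2 * (cmod (x (1, m)))\<^sup>2 + 2 * (cmod (w (1, m)))\<^sup>2"
        using sum_squares_ge_zero[of "real M * \<eta> * cmod (x (1, m)) - cmod (w (1, m))" 0]
        by (simp add: power2_eq_square algebra_simps)
      finally show "exp (- (2 * (real M * \<eta>)\<^sup>2 * (cmod (x (1, m)))\<^sup>2 + 2 * (cmod (w (1, m)))\<^sup>2)) / pi \<le>
          cgauss (?y (1, m) - cis (comb_angle \<omega> (1, m)) * x (1, m))"
        by (simp add: cgauss_def divide_right_mono)
    qed auto
    also have "\<dots> = comb_likelihood M 1 x ?y \<omega>"
    proof -
      have "comb_indices M 1 = Pair 1 ` {..<M}"
        by (auto simp: comb_indices_def)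
      then show ?thesis
        unfolding comb_likelihood_def by (simp add: prod.reindex inj_on_def del: One_nat_def)
    qed
    finally show ?thesis .
  qed
  \<comment> \<open>The two windows are independent events, each of probability at least \<eta> / (2
    pi), and on their intersection the likelihood is at least the constant in front.\<close>
  have "ennreal (exp (- ?q) / pi ^ M * (\<eta> / (2 * pi) * (\<eta> / (2 * pi)))) =
      ennreal (exp (- ?q) / pi ^ M) * (ennreal (\<eta> / (2 * pi)) * ennreal (\<eta> / (2 * pi)))"
    using \<eta> by (simp add: ennreal_mult[symmetric])
  also have "\<dots> \<le> ennreal (exp (- ?q) / pi ^ M) *
      ((\<integral>\<^sup>+\<delta>'. ?E \<delta>c \<delta>' \<partial>phase_increments vc) * (\<integral>\<^sup>+\<delta>'. ?E \<delta>r \<delta>' \<partial>phase_increments vr))"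
    by (intro mult_left_mono mult_mono near v) auto
  also have "\<dots> = ennreal (exp (- ?q) / pi ^ M) *
      (\<integral>\<^sup>+\<delta>1. \<integral>\<^sup>+\<delta>2. ?E \<delta>c \<delta>1 * ?E \<delta>r \<delta>2 \<partial>phase_increments vr \<partial>phase_increments vc)"
    by (subst nn_integral_cmult, measurable, subst nn_integral_multc, measurable)
  also have "\<dots> = (\<integral>\<^sup>+\<omega>. ennreal (exp (- ?q) / pi ^ M) * (?E \<delta>c (fst \<omega>) * ?E \<delta>r (snd \<omega>)) \<partial>comb_phases vc vr)"
    unfolding comb_phases_def by (subst nn_integral_cmult, measurable, subst R.nn_integral_fst[symmetric]) auto
  also have "\<dots> \<le> (\<integral>\<^sup>+\<omega>. ennreal (comb_likelihood M 1 x ?y \<omega>) \<partial>comb_phases vc vr)"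
    using lik by (intro nn_integral_mono) (auto split: split_indicator intro!: ennreal_leI simp: abs_le_iff simp del: phase.simps One_nat_def)
  also have "\<dots> = ennreal (comb_kernel M vc vr 1 x ?y)"
    by (simp add: ennreal_comb_kernel[OF v])
  finally have "exp (- ?q) / pi ^ M * (\<eta> / (2 * pi) * (\<eta> / (2 * pi))) \<le> comb_kernel M vc vr 1 x ?y"
    using comb_kernel_pos[OF v] by (subst (asm) ennreal_le_iff) (auto simp: less_imp_le)
  moreover have "exp (- (real M * ln pi + 2 * ln (2 * pi) - 2 * ln \<eta> + ?q)) = exp (- ?q) / pi ^ M * (\<eta> / (2 * pi) * (\<eta> / (2 * pi)))"
  proof -
    have "exp (real M * ln pi) = pi ^ M"
      by (simp add: exp_of_nat_mult)
    moreover have "exp (2 * ln (2 * pi)) = (2 * pi) * (2 * pi)" "exp (2 * ln \<eta>) = \<eta> * \<eta>"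
      using \<eta> exp_of_nat_mult[of 2 "ln (2 * pi)"] exp_of_nat_mult[of 2 "ln \<eta>"] by (simp_all add: power2_eq_square)
    moreover have "- (real M * ln pi + 2 * ln (2 * pi) - 2 * ln \<eta> + ?q) =
        - ?q - real M * ln pi - 2 * ln (2 * pi) + 2 * ln \<eta>"
      by simp
    ultimately show ?thesis
      by (simp only: exp_add exp_diff) simp
  qed
  ultimately show ?thesis by simp
qed

text \<open>A box of area of order \<rho> per subchannel gives M ln \<rho> from the output density,
  and the kernel costs a single ln \<rho>. With 1 <= \<rho> the logarithm is nonnegative and the
  phase window below is admissible.\<close>

lemma comb_information_lower_bound:
  assumes M: "2 \<le> M" and v: "0 < vc" "0 < vr"
  obtains c where "\<And>\<rho>. 1 \<le> \<rho> \<Longrightarrow> \<exists>P\<in>input_laws M 1 \<rho>. ((real M - 1) * ln \<rho> - c) / ln 2 \<le> comb_information M vc vr 1 P"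
proof -
  \<comment> \<open>In order: Gaussian normalisation, the two phase windows, the expected effect of
    the phase errors, the expected noise (twice 4 M), and the conversion of the box area 2 \<rho> /
    M to \<rho>.\<close>
  define c where "c = real M * ln pi + 2 * ln (2 * pi) + 2 * (real M)\<^sup>2 + 8 * real M + real M * ln (real M / 2)"
  have "\<exists>P\<in>input_laws M 1 \<rho>. ((real M - 1) * ln \<rho> - c) / ln 2 \<le> comb_information M vc vr 1 P" if \<rho>: "1 \<le> \<rho>" for \<rho>
  proof -
    \<comment> \<open>At the corners of the box the power is 2 s^2 = \<rho> / M, so the power
      constraint holds almost surely, not only on average.\<close>
    define s where "s = sqrt (\<rho> / (2 * real M))"
    define D where "D = cbox (Complex (- s) (- s)) (Complex s s)"
    define G where "G = uniform_measure lborel D"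
    define P where "P = (\<Pi>\<^sub>M i\<in>comb_indices M 1. G)"
    let ?I = "comb_indices M 1" and ?S = "comb_space M vc vr P"
    define vol where "vol = 2 * \<rho> / real M"
    have s: "0 < s" "s\<^sup>2 = \<rho> / (2 * real M)" and vol: "0 < vol"
      using M \<rho> by (auto simp: s_def vol_def)
    have card: "card ?I = M"
      by (simp add: comb_indices_def)
    have D: "emeasure lborel D = ennreal vol"
    proof -
      have "emeasure lborel D = ennreal (2 * s * (2 * s))"
        unfolding D_def using s by (subst emeasure_lborel_cbox) (auto simp: Basis_complex_def)
      also have "2 * s * (2 * s) = vol"
        using s(2) by (simp add: vol_def power2_eq_square)
      finally show ?thesis .
    qed
    have G: "prob_space G"
      unfolding G_def using vol by (intro prob_space_uniform_measure) (auto simp: D)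
    have sG[simp]: "sets G = sets borel" by (simp add: G_def)
    have pP: "prob_space P" unfolding P_def by (intro prob_space_PiM G)
    have sP: "sets P = sets (block_space M 1)" unfolding P_def by (rule sets_PiM_cong) auto
    note [measurable_cong] = sP
    have spP: "space P = space (block_space M 1)" by (rule sets_eq_imp_space_eq[OF sP])

    have G2: "(\<integral>\<^sup>+z. ennreal ((cmod z)\<^sup>2) \<partial>G) \<le> ennreal (\<rho> / real M)"
    proof -
      interpret G: prob_space G by (rule G)
      have "(\<integral>\<^sup>+z. ennreal ((cmod z)\<^sup>2) \<partial>G) \<le> (\<integral>\<^sup>+z. ennreal (\<rho> / real M) \<partial>G)"
      proof (rule nn_integral_mono_AE)
        have "(cmod z)\<^sup>2 \<le> \<rho> / real M" if "z \<in> D" for z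
        proof -
          have "\<bar>Re z\<bar> \<le> \<bar>s\<bar>" "\<bar>Im z\<bar> \<le> \<bar>s\<bar>"
            using that s by (auto simp: D_def in_cbox_complex_iff)
          then have "(Re z)\<^sup>2 \<le> s\<^sup>2" "(Im z)\<^sup>2 \<le> s\<^sup>2"
            by (simp_all only: abs_le_square_iff)
          then show ?thesis using s(2) by (simp add: cmod_power2)
        qed
        then show "AE z in G. ennreal ((cmod z)\<^sup>2) \<le> ennreal (\<rho> / real M)"
          unfolding G_def by (intro AE_uniform_measureI) (auto simp: D_def intro!: ennreal_leI)
      qed
      then show ?thesis by (simp add: G.emeasure_space_1)
    qed
    have PL: "P \<in> input_laws M 1 \<rho>"
    proof -
      have comp: "(\<integral>\<^sup>+x. ennreal ((cmod (x (1, m)))\<^sup>2) \<partial>P) \<le> ennreal (\<rho> / real M)" if "m < M" for m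
      proof -
        have i: "(1, m) \<in> ?I" using that by (simp add: comb_indices_def)
        have "(\<integral>\<^sup>+x. ennreal ((cmod (x (1, m)))\<^sup>2) \<partial>P) =
            (\<integral>\<^sup>+z. ennreal ((cmod z)\<^sup>2) \<partial>distr P G (\<lambda>x. x (1, m)))"
          unfolding P_def using i by (subst nn_integral_distr) (auto simp: G_def)
        also have "distr P G (\<lambda>x. x (1, m)) = G"
          unfolding P_def by (intro distr_PiM_component G i)
        finally show ?thesis using G2 by simp
      qed
      have "(\<integral>\<^sup>+x. ennreal (block_power M x 1) \<partial>P) = (\<Sum>m<M. \<integral>\<^sup>+x. ennreal ((cmod (x (1, m)))\<^sup>2) \<partial>P)"
      proof -
        have "(\<lambda>x. ennreal ((cmod (x (1, m)))\<^sup>2)) \<in> borel_measurable P" if "m \<in> {..<M}" for m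
        proof -
          have [measurable]: "(\<lambda>x. x (1, m)) \<in> borel_measurable (block_space M 1)"
            using that by (intro measurable_component_singleton) (simp add: comb_indices_def)
          show ?thesis by measurable
        qed
        then show ?thesis
          by (subst nn_integral_sum[symmetric]) auto
      qed
      also have "\<dots> \<le> (\<Sum>m<M. ennreal (\<rho> / real M))"
        using comp by (intro sum_mono) auto
      also have "\<dots> = ennreal \<rho>"
        using M \<rho> by (simp add: ennreal_of_nat_eq_real_of_nat ennreal_mult[symmetric])
      finally show ?thesis
        using pP sP by (simp add: input_laws_def)
    qed

    interpret ch: density_channel P "block_lborel M 1" ?S "comb_kernel M vc vr 1" 1 comb_input "comb_output M 1"
      by (rule density_channel_comb[OF v pP sP])
    have info_int: "integrable ?S ch.info"
      using \<rho> by (intro comb_info_integrable[OF M v _ PL]) simp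

    \<comment> \<open>The input density is at most vol^(-M), and the kernel integrated over all
      inputs has mass 1.\<close>
    have out_le: "ch.out y \<le> (1 / vol) ^ M" if y: "y \<in> space (block_lborel M 1)" for y
    proof -
      interpret L: product_sigma_finite "\<lambda>_::nat \<times> nat. lborel :: complex measure" ..
      have dens: "G = density lborel (\<lambda>z. indicator D z / ennreal vol)"
        by (simp add: G_def uniform_measure_def D)
      have Pd: "P = density (block_lborel M 1) (\<lambda>x. \<Prod>i\<in>?I. indicator D (x i) / ennreal vol)"
        unfolding P_def dens using prob_space_imp_sigma_finite[OF G, unfolded dens]
        by (intro L.PiM_density) (auto simp: D_def)
      have dm: "(\<lambda>x. \<Prod>i\<in>?I. indicator D (x i) / ennreal vol) \<in> borel_measurable (block_lborel M 1)"
      proof (intro borel_measurable_prod_ennreal)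
        fix i assume i: "i \<in> ?I"
        have [measurable]: "(\<lambda>x. x i) \<in> borel_measurable (block_lborel M 1)"
          using measurable_component_singleton[OF i, of "\<lambda>_. lborel :: complex measure"] by simp
        have [measurable]: "D \<in> sets borel" by (simp add: D_def)
        show "(\<lambda>x. indicator D (x i) / ennreal vol) \<in> borel_measurable (block_lborel M 1)" by measurable
      qed
      have y': "y \<in> space (block_space M 1)" using y by (simp only: space_block_lborel)
      have km: "(\<lambda>x. ennreal (comb_kernel M vc vr 1 x y)) \<in> borel_measurable (block_lborel M 1)"
        using v y' by measurable
      have "ennreal (ch.out y) = (\<integral>\<^sup>+x. (\<Prod>i\<in>?I. indicator D (x i) / ennreal vol) * ennreal (comb_kernel M vc vr 1 x y) \<partial>block_lborel M 1)"
        unfolding ch.ennreal_out[OF y] by (subst Pd) (rule nn_integral_density[OF dm km])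
      also have "\<dots> \<le> (\<integral>\<^sup>+x. ennreal ((1 / vol) ^ M) * ennreal (comb_kernel M vc vr 1 x y) \<partial>block_lborel M 1)"
      proof (intro nn_integral_mono mult_right_mono)
        fix x
        have "(\<Prod>i\<in>?I. indicator D (x i) / ennreal vol) \<le> (\<Prod>i\<in>?I. ennreal (1 / vol))"
          using vol by (intro prod_mono_ennreal) (auto split: split_indicator simp: divide_ennreal[of 1, simplified])
        also have "\<dots> = ennreal ((1 / vol) ^ M)"
          unfolding prod_constant card using vol by (intro ennreal_power) simp
        finally show "(\<Prod>i\<in>?I. indicator D (x i) / ennreal vol) \<le> ennreal ((1 / vol) ^ M)" .
      qed simp
      also have "\<dots> = ennreal ((1 / vol) ^ M)"
        by (subst nn_integral_cmult[OF km]) (simp only: comb_kernel_total(2)[OF v y'] mult_1_right)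
      finally show ?thesis
        using vol by (subst (asm) ennreal_le_iff) auto
    qed

    \<comment> \<open>The critical scale: phase error times amplitude stays bounded because \<eta>^2
      \<rho> = 1, while the probability of the two windows, of order \<eta>^2, costs exactly one ln
      \<rho>.\<close>
    define \<eta> where "\<eta> = 1 / sqrt \<rho>"
    have \<eta>: "0 < \<eta>" "\<eta> \<le> pi" "\<eta>\<^sup>2 = 1 / \<rho>" "ln \<eta> = - ln \<rho> / 2"
    proof -
      have "\<eta> \<le> 1" using \<rho> by (simp add: \<eta>_def)
      then show "\<eta> \<le> pi" using pi_ge_two by linarith
    qed (use \<rho> in \<open>auto simp: \<eta>_def power_divide ln_div ln_sqrt\<close>)
    let ?t = "\<lambda>x. block_power M x 1"
    define a where "a = real M * ln pi + 2 * ln (2 * pi) + ln \<rho>"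
    define U where "U s = a + 2 * (real M)\<^sup>2 / \<rho> * ?t (comb_input s) + 2 * (block_power M (comb_noise s) 1)"
      for s :: comb_sample
    have lower: "- U s + real M * ln vol \<le> ch.info s" if s: "s \<in> space ?S" for s
    proof -
      obtain x \<delta>c \<delta>r w where s_eq: "s = (x, \<delta>c, \<delta>r, w)" by (rule prod_cases4)
      note pos = ch.out_Y_pos[OF s]
      have "U s = real M * ln pi + 2 * ln (2 * pi) - 2 * ln \<eta> +
          (\<Sum>m<M. 2 * (real M * \<eta>)\<^sup>2 * (cmod (x (1, m)))\<^sup>2 + 2 * (cmod (w (1, m)))\<^sup>2)"
      proof -
        have "(\<Sum>m<M. 2 * (real M * \<eta>)\<^sup>2 * (cmod (x (1, m)))\<^sup>2 + 2 * (cmod (w (1, m)))\<^sup>2) =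
            2 * (real M * \<eta>)\<^sup>2 * ?t x + 2 * (\<Sum>m<M. (cmod (w (1, m)))\<^sup>2)"
          by (simp only: sum.distrib sum_distrib_left)
        moreover have "2 * (real M * \<eta>)\<^sup>2 = 2 * (real M)\<^sup>2 / \<rho>" "2 * ln \<eta> = - ln \<rho>"
          using \<eta>(3,4) by (simp_all add: power_mult_distrib)
        ultimately show ?thesis
          by (simp only: U_def a_def s_eq comb_input_def fst_conv snd_conv)
      qed
      then have "exp (- U s) \<le> comb_kernel M vc vr 1 (comb_input s) (comb_output M 1 s)"
        using comb_kernel_lower_bound[OF v \<eta>(1,2), of M x w \<delta>c \<delta>r] by (simp only: s_eq comb_input_def fst_conv)
      then have "- U s \<le> ln (comb_kernel M vc vr 1 (comb_input s) (comb_output M 1 s))"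
        using comb_kernel_pos[OF v] by (subst ln_ge_iff)
      moreover have "ln (ch.out (comb_output M 1 s)) \<le> - (real M * ln vol)"
      proof -
        have "ln (ch.out (comb_output M 1 s)) \<le> ln ((1 / vol) ^ M)"
          using out_le[OF measurable_space[OF ch.Y_measurable s]] pos vol by (subst ln_le_cancel_iff) auto
        also have "\<dots> = - (real M * ln vol)"
          using vol by (simp add: ln_realpow ln_div)
        finally show ?thesis .
      qed
      moreover have "ch.info s = ln (comb_kernel M vc vr 1 (comb_input s) (comb_output M 1 s)) - ln (ch.out (comb_output M 1 s))"
        unfolding ch.info_def using comb_kernel_pos[OF v] pos
        by (simp add: ln_div comb_kernel_pos[OF v, THEN less_imp_neq, THEN not_sym])
      ultimately show ?thesis by simp
    qed
    have t_int: "integrable ?S (\<lambda>s. ?t (comb_input s))" and t_le: "(\<integral>s. ?t (comb_input s) \<partial>?S) \<le> \<rho>"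
      using block_input_power[OF v PL, of 1] input_laws_second_moments(2)[OF PL] \<rho> by simp_all
    let ?w = "\<lambda>s. block_power M (comb_noise s) 1"
    have w_int: "integrable ?S ?w" and w_le: "(\<integral>s. ?w s \<partial>?S) \<le> 4 * real M"
      by (rule block_noise_power[OF v pP order_refl])+
    have U_int: "integrable ?S U"
      unfolding U_def using t_int w_int by simp
    have "(\<integral>s. U s \<partial>?S) = a + 2 * (real M)\<^sup>2 / \<rho> * (\<integral>s. ?t (comb_input s) \<partial>?S) + 2 * (\<integral>s. ?w s \<partial>?S)"
      unfolding U_def using t_int w_int by (simp add: ch.S.prob_space del: Bochner_Integration.integral_sum)
    also have "\<dots> \<le> a + 2 * (real M)\<^sup>2 / \<rho> * \<rho> + 2 * (4 * real M)"
      using t_le w_le \<rho> by (intro add_mono mult_left_mono) auto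
    finally have U_le: "(\<integral>s. U s \<partial>?S) \<le> a + 2 * (real M)\<^sup>2 + 8 * real M"
      using \<rho> by simp
    have "ln vol = ln \<rho> - ln (real M / 2)"
      using M \<rho> by (simp add: vol_def ln_div ln_mult)
    then have "real M * ln vol = real M * ln \<rho> - real M * ln (real M / 2)"
      by (simp add: right_diff_distrib)
    then have "(real M - 1) * ln \<rho> - c = - (a + 2 * (real M)\<^sup>2 + 8 * real M) + real M * ln vol"
      by (simp add: a_def c_def left_diff_distrib)
    also have "\<dots> \<le> - (\<integral>s. U s \<partial>?S) + real M * ln vol"
      using U_le by simp
    also have "\<dots> = (\<integral>s. - U s + real M * ln vol \<partial>?S)"
      using U_int by (simp add: ch.S.prob_space)
    also have "\<dots> \<le> (\<integral>s. ch.info s \<partial>?S)"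
      using U_int info_int lower by (intro integral_mono) auto
    finally have "((real M - 1) * ln \<rho> - c) / ln 2 \<le> (\<integral>s. ch.info s \<partial>?S) / ln 2"
      by (intro divide_right_mono) auto
    also have "\<dots> = comb_information M vc vr 1 P"
      unfolding comb_information_def
      by (intro ch.mutual_information_eq[symmetric]) (simp_all only: sP sets_block_lborel)
    finally show ?thesis using PL by blast
  qed
  then show ?thesis by (rule that)
qed

section \<open>The capacity and its pre-log\<close>

text \<open>Fekete's lemma: the limit is the supremum, which the linear bound makes finite. That the
  supremum dominates n = 1 is what turns the one-block estimate into a capacity bound.\<close>

lemma superadditive_converges:
  fixes a :: "nat \<Rightarrow> real"
  assumes super: "\<And>m n. a m + a n \<le> a (m + n)" and bound: "\<And>n. a n \<le> real n * K"
  obtains L where "(\<lambda>n. a n / real n) \<longlonglongrightarrow> L" "\<And>n. 0 < n \<Longrightarrow> a n / real n \<le> L"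
proof -
  define L where "L = (SUP n\<in>{0<..}. a n / real n)"
  have bdd: "bdd_above ((\<lambda>n. a n / real n) ` {0<..})"
    using bound by (intro bdd_aboveI2[where M = K]) (auto simp: divide_le_eq mult.commute)
  have upper: "a n / real n \<le> L" if "0 < n" for n
    unfolding L_def using that by (intro cSUP_upper bdd) auto
  have mult: "real q * a m + a r \<le> a (q * m + r)" for q m r
  proof (induction q)
    case (Suc q)
    then show ?case
      using super[of m "q * m + r"] by (simp add: distrib_right add.assoc)
  qed simp
  have "(\<lambda>n. a n / real n) \<longlonglongrightarrow> L"
  proof (rule order_tendstoI)
    fix l assume "l < L"
    then obtain m where m: "0 < m" "l < a m / real m"
      unfolding L_def using less_cSUP_iff[OF _ bdd] by auto
    \<comment> \<open>For n = q m + r this pays for the remainder term \<open>a r\<close> and for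
      the share r / m of \<open>a m\<close> that the q full pieces do not cover; it does not depend
      on n.\<close>
    define B where "B = Max ((\<lambda>r. \<bar>a r\<bar>) ` {..<m}) + \<bar>a m\<bar>"
    have lower: "a m / real m - B / real n \<le> a n / real n" if n: "0 < n" for n
    proof -
      define q r where "q = n div m" and "r = n mod m"
      have n_eq: "n = q * m + r" and r: "r < m"
        using m by (auto simp: q_def r_def)
      have 1: "\<bar>a r\<bar> \<le> Max ((\<lambda>r. \<bar>a r\<bar>) ` {..<m})"
        using r by (intro Max_ge) auto
      have "real r * a m / real m \<le> real r * \<bar>a m\<bar> / real m"
        by (intro divide_right_mono mult_left_mono) auto
      also have "\<dots> \<le> \<bar>a m\<bar>"
      proof -
        have "real r * \<bar>a m\<bar> \<le> real m * \<bar>a m\<bar>"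
          using r by (intro mult_right_mono) auto
        then show ?thesis using m by (simp add: divide_le_eq mult.commute)
      qed
      finally have 2: "real r * a m / real m \<le> \<bar>a m\<bar>" .
      have 3: "real n * (a m / real m) = real q * a m + real r * a m / real m"
        using m by (simp add: n_eq field_simps)
      have "real n * (a m / real m) - B \<le> real q * a m + a r"
      proof -
        have "- Max ((\<lambda>r. \<bar>a r\<bar>) ` {..<m}) \<le> a r"
          using 1 by (simp only: abs_le_iff) linarith
        then show ?thesis
          unfolding B_def 3 using 2 by (simp only: diff_le_eq)
      qed
      also have "\<dots> \<le> a n"
        using mult[of q m r] by (simp add: n_eq)
      finally have "(real n * (a m / real m) - B) / real n \<le> a n / real n"
        by (intro divide_right_mono) auto
      then show ?thesis using n by (simp add: diff_divide_distrib)
    qed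
    have "(\<lambda>n. a m / real m - B / real n) \<longlonglongrightarrow> a m / real m - 0"
      by (intro tendsto_diff tendsto_const lim_const_over_n)
    then have "\<forall>\<^sub>F n in sequentially. l < a m / real m - B / real n"
      using m(2) by (intro order_tendstoD(1)) auto
    then show "\<forall>\<^sub>F n in sequentially. l < a n / real n"
      using eventually_gt_at_top[of 0]
    proof eventually_elim
      case (elim n)
      then show ?case using lower[of n] by linarith
    qed
  next
    fix u assume "L < u"
    show "\<forall>\<^sub>F n in sequentially. a n / real n < u"
      using eventually_gt_at_top[of 0]
    proof eventually_elim
      case (elim n)
      then show ?case using upper[of n] \<open>L < u\<close> by linarith
    qed
  qed
  then show ?thesis using upper by (rule that)
qed

text \<open>Witness: the zero input. A real-valued supremum is informative only over a nonempty
  bounded set.\<close>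

lemma input_laws_nonempty:
  assumes "0 \<le> \<rho>" shows "input_laws M n \<rho> \<noteq> {}"
proof -
  let ?z = "\<lambda>i\<in>comb_indices M n. 0 :: complex"
  let ?P = "return (block_space M n) ?z"
  have z: "?z \<in> space (block_space M n)"
    by (auto simp: space_PiM)
  have "(\<Sum>k = 1..n. \<integral>\<^sup>+x. ennreal (block_power M x k) \<partial>?P) = 0"
  proof (intro sum.neutral ballI)
    fix k assume k: "k \<in> {1..n}"
    have "(\<integral>\<^sup>+x. ennreal (block_power M x k) \<partial>?P) = ennreal (\<Sum>m<M. (cmod (?z (k, m)))\<^sup>2)"
      using comb_power_measurable[OF k, where M = M] by (intro nn_integral_return z measurable_compose[OF _ measurable_ennreal])
    also have "(\<Sum>m<M. (cmod (?z (k, m)))\<^sup>2) = 0"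
      using k by (intro sum.neutral) (auto simp: comb_indices_def)
    finally show "(\<integral>\<^sup>+x. ennreal (block_power M x k) \<partial>?P) = 0" by (simp only: ennreal_0)
  qed
  then have "?P \<in> input_laws M n \<rho>"
    using prob_space_return[OF z] by (simp add: input_laws_def)
  then show ?thesis by blast
qed

lemma comb_capacity_bounds:
  assumes M: "2 \<le> M" and v: "0 < vc" "0 < vr" and \<epsilon>: "0 < \<epsilon>"
  obtains c where "\<And>\<rho>. 1 \<le> \<rho> \<Longrightarrow> ((real M - 1) * ln \<rho> - c) / ln 2 \<le> comb_capacity M vc vr \<rho>"
    "\<And>\<rho>. 1 \<le> \<rho> \<Longrightarrow> comb_capacity M vc vr \<rho> \<le> (c + (real M - 1 + real M * \<epsilon>) * ln \<rho>) / ln 2"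
proof -
  define A where "A = real M - 1 + real M * \<epsilon>"
  have A: "0 \<le> A" using M \<epsilon> by (simp add: A_def)
  obtain cl where cl: "\<And>\<rho>. 1 \<le> \<rho> \<Longrightarrow> \<exists>P\<in>input_laws M 1 \<rho>. ((real M - 1) * ln \<rho> - cl) / ln 2 \<le> comb_information M vc vr 1 P"
    using comb_information_lower_bound[OF M v] by blast
  obtain cu where cu: "\<And>n \<rho> P. 0 \<le> \<rho> \<Longrightarrow> P \<in> input_laws M n \<rho> \<Longrightarrow>
      comb_information M vc vr n P \<le> real n * (cu + A * ln (1 + 2 * \<rho>)) / ln 2"
    using comb_information_upper_bound[OF M v \<epsilon>] unfolding A_def by metis
  \<comment> \<open>One constant for both sides; ln 3 comes from 1 + 2 \<rho> <= 3 \<rho>.\<close>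
  define c where "c = max cl (cu + A * ln 3)"
  have main: "((real M - 1) * ln \<rho> - cl) / ln 2 \<le> comb_capacity M vc vr \<rho> \<and>
      comb_capacity M vc vr \<rho> \<le> (cu + A * ln (1 + 2 * \<rho>)) / ln 2" if \<rho>1: "1 \<le> \<rho>" for \<rho>
  proof -
    have \<rho>: "0 \<le> \<rho>" using \<rho>1 by simp
    let ?I = "comb_information M vc vr"
    define K where "K = (cu + A * ln (1 + 2 * \<rho>)) / ln 2"
    define a where "a n = (SUP P\<in>input_laws M n \<rho>. ?I n P)" for n
    note ne = input_laws_nonempty[OF \<rho>, of M]
    have le_K: "?I n P \<le> real n * K" if "P \<in> input_laws M n \<rho>" for n P
      using cu[OF \<rho> that] by (simp add: K_def)
    have bdd: "bdd_above (?I n ` input_laws M n \<rho>)" for n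
      using le_K by (intro bdd_aboveI2) auto
    have a_le: "a n \<le> real n * K" for n
      unfolding a_def using ne le_K by (intro cSUP_least) auto
    have le_a: "?I n P \<le> a n" if "P \<in> input_laws M n \<rho>" for n P
      unfolding a_def using that bdd by (intro cSUP_upper) auto
    \<comment> \<open>The two suprema are taken one after the other: first over the law of the first
      stretch with the second fixed, then over the second.\<close>
    have super: "a m + a n \<le> a (m + n)" for m n
    proof -
      have "?I m P1 + ?I n P2 \<le> a (m + n)" if P: "P1 \<in> input_laws M m \<rho>" "P2 \<in> input_laws M n \<rho>" for P1 P2
        using comb_information_append[OF M v \<rho> P] le_a by (metis order_trans)
      then have "?I m P1 \<le> a (m + n) - ?I n P2" if "P1 \<in> input_laws M m \<rho>" "P2 \<in> input_laws M n \<rho>" for P1 P2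
        using that by (simp add: le_diff_eq)
      then have "a m \<le> a (m + n) - ?I n P2" if "P2 \<in> input_laws M n \<rho>" for P2
        unfolding a_def[of m] using that ne by (intro cSUP_least) auto
      then have "?I n P2 \<le> a (m + n) - a m" if "P2 \<in> input_laws M n \<rho>" for P2
        using that by (simp add: le_diff_eq add.commute)
      then have "a n \<le> a (m + n) - a m"
        unfolding a_def[of n] using ne by (intro cSUP_least) auto
      then show ?thesis by simp
    qed
    obtain L where L: "(\<lambda>n. a n / real n) \<longlonglongrightarrow> L" "\<And>n. 0 < n \<Longrightarrow> a n / real n \<le> L"
      using superadditive_converges[OF super a_le] by blast
    have cap: "comb_capacity M vc vr \<rho> = L"
      unfolding comb_capacity_def a_def[symmetric] by (rule limI[OF L(1)])
    have "L \<le> K"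
      by (rule LIMSEQ_le_const2[OF L(1)]) (use a_le in \<open>auto intro!: exI[of _ 1] simp: divide_le_eq mult.commute\<close>)
    moreover obtain P where "P \<in> input_laws M 1 \<rho>" "((real M - 1) * ln \<rho> - cl) / ln 2 \<le> ?I 1 P"
      using cl[OF \<rho>1] by blast
    then have "((real M - 1) * ln \<rho> - cl) / ln 2 \<le> L"
      using le_a[of P 1] L(2)[of 1] by simp
    ultimately show ?thesis
      by (simp add: cap K_def)
  qed
  show ?thesis
  proof (rule that[of c])
    fix \<rho> :: real assume \<rho>: "1 \<le> \<rho>"
    have "((real M - 1) * ln \<rho> - c) / ln 2 \<le> ((real M - 1) * ln \<rho> - cl) / ln 2"
      by (intro divide_right_mono) (auto simp: c_def)
    then show "((real M - 1) * ln \<rho> - c) / ln 2 \<le> comb_capacity M vc vr \<rho>"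
      using main[OF \<rho>] by linarith
    have "ln (1 + 2 * \<rho>) \<le> ln (3 * \<rho>)"
      using \<rho> by (subst ln_le_cancel_iff) auto
    also have "\<dots> = ln 3 + ln \<rho>"
      using \<rho> by (simp add: ln_mult)
    finally have "A * ln (1 + 2 * \<rho>) \<le> A * (ln 3 + ln \<rho>)"
      using A by (intro mult_left_mono)
    then have "(cu + A * ln (1 + 2 * \<rho>)) / ln 2 \<le> (c + A * ln \<rho>) / ln 2"
      by (intro divide_right_mono) (auto simp: c_def distrib_left)
    then show "comb_capacity M vc vr \<rho> \<le> (c + (real M - 1 + real M * \<epsilon>) * ln \<rho>) / ln 2"
      using main[OF \<rho>] unfolding A_def by linarith
  qed
qed

lemma affine_over_ln_tendsto: "((\<lambda>\<rho>. (b + A * ln \<rho>) / ln \<rho>) \<longlongrightarrow> A) (at_top :: real filter)"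
proof -
  have "((\<lambda>\<rho>. b / ln \<rho> + A) \<longlongrightarrow> 0 + A) (at_top :: real filter)"
    by (intro tendsto_add tendsto_const tendsto_divide_0[OF tendsto_const] filterlim_at_top_imp_at_infinity ln_at_top)
  moreover have "\<forall>\<^sub>F \<rho> in at_top. b / ln \<rho> + A = (b + A * ln \<rho>) / ln \<rho>"
    using eventually_gt_at_top[of "1::real"] by eventually_elim (simp add: add_divide_distrib)
  ultimately show ?thesis
    by (simp add: tendsto_cong)
qed

theorem mainTheorem6:
  fixes M :: nat and sigma_c_sq sigma_r_sq :: real
  assumes "M \<ge> 2" and "sigma_c_sq > 0" and "sigma_r_sq > 0"
  shows "((\<lambda>\<rho>. comb_capacity M sigma_c_sq sigma_r_sq \<rho> / log 2 \<rho>) \<longlongrightarrow> real M - 1) at_top"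
proof (rule order_tendstoI)
  let ?C = "comb_capacity M sigma_c_sq sigma_r_sq"
  \<comment> \<open>Capacity is in bits and the logarithm is binary, so after this rewriting only
    natural logarithms are compared.\<close>
  have ratio: "?C \<rho> / log 2 \<rho> = ?C \<rho> * ln 2 / ln \<rho>" for \<rho>
    by (simp add: log_def)
  {
    fix l assume l: "l < real M - 1"
    \<comment> \<open>The lower estimate is free of \<epsilon>, so the bounds are instantiated at
      1.\<close>
    obtain c where c: "\<And>\<rho>. 1 \<le> \<rho> \<Longrightarrow> ((real M - 1) * ln \<rho> - c) / ln 2 \<le> ?C \<rho>"
      by (rule comb_capacity_bounds[OF assms zero_less_one]) (rule that)
    have "\<forall>\<^sub>F \<rho> in at_top. l < (- c + (real M - 1) * ln \<rho>) / ln \<rho>"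
      by (rule order_tendstoD(1)[OF affine_over_ln_tendsto l])
    then show "\<forall>\<^sub>F \<rho> in at_top. l < ?C \<rho> / log 2 \<rho>"
      using eventually_gt_at_top[of 1]
    proof eventually_elim
      case (elim \<rho>)
      have "- c + (real M - 1) * ln \<rho> \<le> ?C \<rho> * ln 2"
        using c[of \<rho>] elim(2) by (simp add: divide_le_eq)
      then have "(- c + (real M - 1) * ln \<rho>) / ln \<rho> \<le> ?C \<rho> * ln 2 / ln \<rho>"
        using elim(2) by (intro divide_right_mono) auto
      then show ?case using elim(1) unfolding ratio by linarith
    qed
  }
  {
    fix u assume u: "real M - 1 < u"
    \<comment> \<open>Chosen so that M \<epsilon> is half of the gap between u and M - 1.\<close>
    define \<epsilon> where "\<epsilon> = (u - (real M - 1)) / (2 * real M)"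
    have \<epsilon>: "0 < \<epsilon>" "real M - 1 + real M * \<epsilon> < u"
    proof -
      have "real M * \<epsilon> = (u - (real M - 1)) / 2"
        using assms(1) by (simp add: \<epsilon>_def)
      then show "real M - 1 + real M * \<epsilon> < u"
        using u by (simp add: field_simps)
    qed (use u assms(1) in \<open>simp add: \<epsilon>_def\<close>)
    obtain c where c: "\<And>\<rho>. 1 \<le> \<rho> \<Longrightarrow> ?C \<rho> \<le> (c + (real M - 1 + real M * \<epsilon>) * ln \<rho>) / ln 2"
      by (rule comb_capacity_bounds[OF assms \<epsilon>(1)]) (rule that)
    have "\<forall>\<^sub>F \<rho> in at_top. (c + (real M - 1 + real M * \<epsilon>) * ln \<rho>) / ln \<rho> < u"
      by (rule order_tendstoD(2)[OF affine_over_ln_tendsto \<epsilon>(2)])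
    then show "\<forall>\<^sub>F \<rho> in at_top. ?C \<rho> / log 2 \<rho> < u"
      using eventually_gt_at_top[of 1]
    proof eventually_elim
      case (elim \<rho>)
      have "?C \<rho> * ln 2 \<le> c + (real M - 1 + real M * \<epsilon>) * ln \<rho>"
        using c[of \<rho>] elim(2) by (simp add: le_divide_eq)
      then have "?C \<rho> * ln 2 / ln \<rho> \<le> (c + (real M - 1 + real M * \<epsilon>) * ln \<rho>) / ln \<rho>"
        using elim(2) by (intro divide_right_mono) auto
      then show ?case using elim(1) unfolding ratio by linarith
    qed
  }
qed

end
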